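(* a) Let $0<p<1/2$ and $f\in H_p$. Then there exists an absolute constant $c_p$, depending only on $p$, such that $$\sum_{k=1}^{\infty}\frac{\|\sigma_kf\|_p^p}{k^{2-2p}}\le c_p\|f\|_{H_p}^p .$$ b) Let $0<p<1/2$ and let $\{\Phi_k:k\in\mathbb N\}$ be any non-decreasing sequence of positive numbers satisfying $\Phi_n\uparrow\infty$ and $$\limsup_{k\to\infty}\frac{k^{2-2p}}{\Phi_k}=\infty .$$ Then there exists a martingale $f\in H_p$ such that $$\sum_{k=1}^{\infty}\frac{\|\sigma_kf\|_{weak-L_p}^p}{\Phi_k}=\infty .$$
   Context: $\mathbb N_+$ is the set of positive integers, $\mathbb N=\mathbb N_+\cup\{0\}$. Fix a bounded sequence $m=(m_0,m_1,\dots)$ of integers $m_k\ge 2$. $G_m=\prod_{k\ge0}Z_{m_k}$, where $Z_{m_k}=\{0,\dots,m_k-1\}$ is the additive group modulo $m_k$, with the product of the discrete topologies; $\mu$ is the Haar measure with $\mu(G_m)=1$. $M_0:=1$, $M_{k+1}:=m_kM_k$; every $n\in\mathbb N$ is uniquely $n=\sum_{j\ge0}n_jM_j$ with $n_j\in Z_{m_j}$. $r_k(x):=\exp(2\pi i x_k/m_k)$, $\psi_n:=\prod_{k\ge0}r_k^{n_k}$ (Vilenkin system). $I_0(x):=G_m$, $I_n(x):=\{y: y_0=x_0,\dots,y_{n-1}=x_{n-1}\}$; $\mathcal F_n$ is the $\sigma$-algebra generated by $\{I_n(x):x\in G_m\}$. For $g\in L_1(G_m)$: $\widehat g(k):=\int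 g\overline{\psi_k}\,d\mu$, $S_ng:=\sum_{k=0}^{n-1}\widehat g(k)\psi_k$. A martingale is a sequence $f=(f^{(n)}:n\in\mathbb N)$ of integrable functions with $f^{(n)}$ $\mathcal F_n$-measurable and $S_{M_n}f^{(k)}=f^{(n)}$ for $n\le k$; $f^*:=\sup_n|f^{(n)}|$; $H_p$ is the set of martingales with $\|f\|_{H_p}:=\|f^*\|_p<\infty$, where $\|g\|_p:=(\int|g|^pd\mu)^{1/p}$. For a martingale, $\widehat f(i):=\lim_k\int f^{(k)}\overline{\psi_i}\,d\mu$, $S_nf:=\sum_{k=0}^{n-1}\widehat f(k)\psi_k$, and $\sigma_nf:=\frac1n\sum_{k=1}^nS_kf$ ($n\in\mathbb N_+$). $\|g\|_{weak-L_p}:=\sup_{\lambda>0}\lambda\,\mu(|g|>\lambda)^{1/p}$. The sequence $m$ is fixed, and "absolute" constants may depend on it. *)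

theory Defs
  imports "HOL-Probability.Probability"
begin

section \<open>The Vilenkin group and its Haar measure\<close>

text \<open>\<open>Z\<^sub>k\<close> is represented by \<^term>\<open>{..<k}\<close> with addition modulo \<open>k\<close>; functions on the group
  are HOL functions on \<^typ>\<open>nat \<Rightarrow> nat\<close> whose values outside the carrier are irrelevant.\<close>

definition vil_group :: "(nat \<Rightarrow> nat) \<Rightarrow> (nat \<Rightarrow> nat) set" where
  "vil_group m = (\<Pi>\<^sub>E k\<in>UNIV. {..<m k})"

definition vil_add :: "(nat \<Rightarrow> nat) \<Rightarrow> (nat \<Rightarrow> nat) \<Rightarrow> (nat \<Rightarrow> nat) \<Rightarrow> nat \<Rightarrow> nat" where
  "vil_add m x y = (\<lambda>k. (x k + y k) mod m k)"

definition vil_topology :: "(nat \<Rightarrow> nat) \<Rightarrow> (nat \<Rightarrow> nat) topology" where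
  "vil_topology m = product_topology (\<lambda>k. discrete_topology {..<m k}) UNIV"

text \<open>Normalised Haar measure: the translation-invariant Borel probability measure. The group is
  compact and metrizable, so regularity is automatic and need not be required.\<close>

definition is_vil_haar :: "(nat \<Rightarrow> nat) \<Rightarrow> (nat \<Rightarrow> nat) measure \<Rightarrow> bool" where
  "is_vil_haar m \<mu> \<longleftrightarrow>
     space \<mu> = vil_group m \<and>
     sets \<mu> = sigma_sets (vil_group m) {U. openin (vil_topology m) U} \<and>
     (\<forall>a\<in>vil_group m. \<forall>A\<in>sets \<mu>. emeasure \<mu> (vil_add m a ` A) = emeasure \<mu> A) \<and>
     emeasure \<mu> (vil_group m) = 1"

definition vil_haar :: "(nat \<Rightarrow> nat) \<Rightarrow> (nat \<Rightarrow> nat) measure" where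
  "vil_haar m = (THE \<mu>. is_vil_haar m \<mu>)"

text \<open>The cosets \<open>I\<^sub>n(x)\<close> and the filtration they generate.\<close>

definition vil_I :: "(nat \<Rightarrow> nat) \<Rightarrow> nat \<Rightarrow> (nat \<Rightarrow> nat) \<Rightarrow> (nat \<Rightarrow> nat) set" where
  "vil_I m n x = {y \<in> vil_group m. \<forall>j<n. y j = x j}"

definition vil_F :: "(nat \<Rightarrow> nat) \<Rightarrow> nat \<Rightarrow> (nat \<Rightarrow> nat) measure" where
  "vil_F m n = sigma (vil_group m) (vil_I m n ` vil_group m)"


subsection \<open>The definite description is well defined: it is the product of the uniform measures\<close>

abbreviation vil_prod :: "(nat \<Rightarrow> nat) \<Rightarrow> (nat \<Rightarrow> nat) measure" where
  "vil_prod m \<equiv> (\<Pi>\<^sub>M k\<in>UNIV. uniform_count_measure {..<m k})"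

lemma mem_vil_group: "x \<in> vil_group m \<longleftrightarrow> (\<forall>k. x k < m k)"
  by (auto simp: vil_group_def PiE_iff)

lemma space_vil_prod: "space (vil_prod m) = vil_group m"
  by (simp add: space_PiM vil_group_def space_uniform_count_measure)

lemma topspace_vil: "topspace (vil_topology m) = vil_group m"
  by (simp add: vil_topology_def vil_group_def)

lemma vil_I_prod: "vil_I m n x \<in> sets (vil_prod m)"
proof -
  have "{y \<in> space (vil_prod m). \<forall>j\<in>{..<n}. y j \<in> {x j} \<inter> {..<m j}} \<in> sets (vil_prod m)"
    by (intro sets.sets_Collect_finite_All sets_Collect_single)
       (auto simp: sets_uniform_count_measure)
  also have "{y \<in> space (vil_prod m). \<forall>j\<in>{..<n}. y j \<in> {x j} \<inter> {..<m j}} = vil_I m n x"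
    by (auto simp: space_vil_prod vil_I_def mem_vil_group)
  finally show ?thesis .
qed

lemma finite_vil_I: "finite (vil_I m n ` vil_group m)"
proof -
  have "vil_I m n ` vil_group m \<subseteq> vil_I m n ` (\<Pi>\<^sub>E j\<in>{..<n}. {..<m j})"
  proof clarify
    fix x assume x: "x \<in> vil_group m"
    have "vil_I m n x = vil_I m n (restrict x {..<n})" by (auto simp: vil_I_def)
    moreover have "restrict x {..<n} \<in> (\<Pi>\<^sub>E j\<in>{..<n}. {..<m j})"
      using x by (auto simp: mem_vil_group)
    ultimately show "vil_I m n x \<in> vil_I m n ` (\<Pi>\<^sub>E j\<in>{..<n}. {..<m j})" by blast
  qed
  then show ?thesis by (rule finite_subset) (intro finite_imageI finite_PiE, auto)
qed

lemma vil_openin_I: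
  assumes "openin (vil_topology m) U" "x \<in> U"
  shows "\<exists>n. vil_I m n x \<subseteq> U"
proof -
  obtain X where X: "x \<in> (\<Pi>\<^sub>E i\<in>UNIV. X i)"
      "finite {i. X i \<noteq> topspace (discrete_topology {..<m i})}" "(\<Pi>\<^sub>E i\<in>UNIV. X i) \<subseteq> U"
    using product_topology_open_contains_basis[OF assms[unfolded vil_topology_def]] by blast
  then obtain n where n: "\<And>i. X i \<noteq> {..<m i} \<Longrightarrow> i < n"
    by (auto simp: finite_nat_set_iff_bounded)
  have "vil_I m n x \<subseteq> (\<Pi>\<^sub>E i\<in>UNIV. X i)"
  proof (clarsimp simp: vil_I_def mem_vil_group PiE_iff)
    fix y i assume y: "\<forall>k. y k < m k" "\<forall>j<n. y j = x j"
    show "y i \<in> X i"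
      using y X(1) n[of i] by (cases "i < n") (auto simp: PiE_iff)
  qed
  then show ?thesis using X(3) by blast
qed

lemma sets_vil_prod_eq:
  "sets (vil_prod m) = sigma_sets (vil_group m) {U. openin (vil_topology m) U}"
proof (rule antisym)
  show "sigma_sets (vil_group m) {U. openin (vil_topology m) U} \<subseteq> sets (vil_prod m)"
    unfolding space_vil_prod[symmetric]
  proof (rule sets.sigma_sets_subset, clarify)
    fix U assume U: "openin (vil_topology m) U"
    have sub: "U \<subseteq> vil_group m" using openin_subset[OF U] by (simp add: topspace_vil)
    have "U = (\<Union>n. \<Union>{C \<in> vil_I m n ` vil_group m. C \<subseteq> U})"
    proof (intro equalityI subsetI)
      fix x assume x: "x \<in> U"
      obtain n where "vil_I m n x \<subseteq> U" using vil_openin_I[OF U x] by blast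
      moreover have "x \<in> vil_I m n x" using x sub by (auto simp: vil_I_def)
      ultimately show "x \<in> (\<Union>n. \<Union>{C \<in> vil_I m n ` vil_group m. C \<subseteq> U})" using x sub by blast
    qed auto
    moreover have "(\<Union>n. \<Union>{C \<in> vil_I m n ` vil_group m. C \<subseteq> U}) \<in> sets (vil_prod m)"
    proof (intro sets.countable_UN subsetI, clarify)
      fix n show "\<Union>{C \<in> vil_I m n ` vil_group m. C \<subseteq> U} \<in> sets (vil_prod m)"
        by (intro sets.finite_Union finite_subset[OF _ finite_vil_I[of m n]]) (auto intro: vil_I_prod)
    qed
    ultimately show "U \<in> sets (vil_prod m)" by simp
  qed
next
  show "sets (vil_prod m) \<subseteq> sigma_sets (vil_group m) {U. openin (vil_topology m) U}"
    unfolding sets_PiM_single space_uniform_count_measure vil_group_def[symmetric]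
  proof (rule sigma_sets_mono, clarify)
    fix i A assume A: "A \<in> sets (uniform_count_measure {..<m i})"
    have "openin (vil_topology m) {x \<in> topspace (vil_topology m). x i \<in> A}"
      unfolding vil_topology_def
      by (rule openin_continuous_map_preimage[OF continuous_map_product_projection])
         (use A in \<open>auto simp: sets_uniform_count_measure\<close>)
    then show "{f \<in> vil_group m. f i \<in> A} \<in> sigma_sets (vil_group m) {U. openin (vil_topology m) U}"
      by (auto simp: topspace_vil)
  qed
qed

lemma sets_vil_generated:
  "sets (vil_prod m) = sigma_sets (vil_group m) (insert {} (\<Union>n. vil_I m n ` vil_group m))"
proof (rule antisym)
  show "sigma_sets (vil_group m) (insert {} (\<Union>n. vil_I m n ` vil_group m)) \<subseteq> sets (vil_prod m)"
    unfolding space_vil_prod[symmetric]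
    by (rule sets.sigma_sets_subset) (auto simp: space_vil_prod intro: vil_I_prod)
  let ?S = "sigma_sets (vil_group m) (insert {} (\<Union>n. vil_I m n ` vil_group m))"
  interpret S: sigma_algebra "vil_group m" ?S
    by (rule sigma_algebra_sigma_sets) (auto simp: vil_I_def)
  show "sets (vil_prod m) \<subseteq> ?S"
    unfolding sets_vil_prod_eq
  proof (rule sigma_sets_mono, clarify)
    fix U assume U: "openin (vil_topology m) U"
    have sub: "U \<subseteq> vil_group m" using openin_subset[OF U] by (simp add: topspace_vil)
    have "U = (\<Union>n. \<Union>{C \<in> vil_I m n ` vil_group m. C \<subseteq> U})"
    proof (intro equalityI subsetI)
      fix x assume x: "x \<in> U"
      obtain n where "vil_I m n x \<subseteq> U" using vil_openin_I[OF U x] by blast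
      moreover have "x \<in> vil_I m n x" using x sub by (auto simp: vil_I_def)
      ultimately show "x \<in> (\<Union>n. \<Union>{C \<in> vil_I m n ` vil_group m. C \<subseteq> U})" using x sub by blast
    qed auto
    moreover have "(\<Union>n. \<Union>{C \<in> vil_I m n ` vil_group m. C \<subseteq> U}) \<in> ?S"
    proof (intro S.countable_UN subsetI, clarify)
      fix n show "\<Union>{C \<in> vil_I m n ` vil_group m. C \<subseteq> U} \<in> ?S"
        by (intro S.finite_Union finite_subset[OF _ finite_vil_I[of m n]]) auto
    qed
    ultimately show "U \<in> ?S" by simp
  qed
qed

lemma vil_neg:
  assumes "x \<in> vil_group m"
  obtains y where "y \<in> vil_group m"
    "\<And>z. z \<in> vil_group m \<Longrightarrow> vil_add m y (vil_add m x z) = z"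
    "\<And>z. z \<in> vil_group m \<Longrightarrow> vil_add m x (vil_add m y z) = z"
proof
  let ?y = "\<lambda>k. (m k - x k) mod m k"
  have x: "x k < m k" for k using assms by (auto simp: mem_vil_group)
  show "?y \<in> vil_group m"
    using x by (auto simp: mem_vil_group intro!: mod_less_divisor intro: le_less_trans)
  have *: "((m k - x k) mod m k + (x k + z) mod m k) mod m k = z mod m k" for k z
  proof -
    have "((m k - x k) mod m k + (x k + z) mod m k) mod m k = (m k - x k + (x k + z)) mod m k"
      by (simp add: mod_simps)
    also have "m k - x k + (x k + z) = z + m k" using x[of k] by simp
    finally show ?thesis by simp
  qed
  have **: "(x k + ((m k - x k) mod m k + z) mod m k) mod m k = z mod m k" for k z
  proof -
    have "(x k + ((m k - x k) mod m k + z) mod m k) mod m k = (x k + (m k - x k + z)) mod m k"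
      by (simp add: mod_simps)
    also have "x k + (m k - x k + z) = z + m k" using x[of k] by simp
    finally show ?thesis by simp
  qed
  show "vil_add m ?y (vil_add m x z) = z" if "z \<in> vil_group m" for z
    using that by (simp add: vil_add_def * mem_vil_group)
  show "vil_add m x (vil_add m ?y z) = z" if "z \<in> vil_group m" for z
    using that by (simp add: vil_add_def ** mem_vil_group)
qed

lemma vil_add_closed: "x \<in> vil_group m \<Longrightarrow> y \<in> vil_group m \<Longrightarrow> vil_add m x y \<in> vil_group m"
  by (auto simp: mem_vil_group vil_add_def intro!: mod_less_divisor intro: le_less_trans)

lemma vil_add_image_I:
  assumes "x \<in> vil_group m" "z \<in> vil_group m"
  shows "vil_add m x ` vil_I m n z = vil_I m n (vil_add m x z)"
proof -
  obtain y where y: "y \<in> vil_group m"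
    "\<And>z. z \<in> vil_group m \<Longrightarrow> vil_add m y (vil_add m x z) = z"
    "\<And>z. z \<in> vil_group m \<Longrightarrow> vil_add m x (vil_add m y z) = z"
    using vil_neg[OF assms(1)] by blast
  show ?thesis
  proof (intro equalityI subsetI)
    fix w assume "w \<in> vil_add m x ` vil_I m n z"
    then show "w \<in> vil_I m n (vil_add m x z)"
      using vil_add_closed[OF assms(1)] by (auto simp: vil_I_def) (auto simp: vil_add_def)
  next
    fix w assume w: "w \<in> vil_I m n (vil_add m x z)"
    have "vil_add m y w j = z j" if "j < n" for j
    proof -
      have "vil_add m y w j = vil_add m y (vil_add m x z) j"
        using w that by (simp add: vil_I_def vil_add_def)
      then show ?thesis using y(2)[OF assms(2)] by simp
    qed
    then have "vil_add m y w \<in> vil_I m n z"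
      using w vil_add_closed[OF y(1)] by (auto simp: vil_I_def)
    moreover have "w = vil_add m x (vil_add m y w)" using w y(3) by (simp add: vil_I_def)
    ultimately show "w \<in> vil_add m x ` vil_I m n z" by blast
  qed
qed

lemma is_vil_haar_I:
  assumes \<mu>: "is_vil_haar m \<mu>" and x: "x \<in> vil_group m"
  shows "emeasure \<mu> (vil_I m n x) = 1 / of_nat (card (vil_I m n ` vil_group m))"
proof -
  have sets: "sets \<mu> = sets (vil_prod m)" using \<mu> by (simp add: is_vil_haar_def sets_vil_prod_eq)
  have eq: "emeasure \<mu> (vil_I m n z) = emeasure \<mu> (vil_I m n x)" if z: "z \<in> vil_group m" for z
  proof -
    let ?o = "\<lambda>k. 0 :: nat"
    have o: "?o \<in> vil_group m" using x by (auto simp: mem_vil_group intro: le_less_trans)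
    have "emeasure \<mu> (vil_I m n z) = emeasure \<mu> (vil_I m n ?o)" if z: "z \<in> vil_group m" for z
    proof -
      have "vil_add m z ?o = z" using z by (auto simp: vil_add_def mem_vil_group)
      then have "vil_I m n z = vil_add m z ` vil_I m n ?o"
        using vil_add_image_I[OF z o, of n] by simp
      then show ?thesis using \<mu> z vil_I_prod[of m n ?o] by (simp add: is_vil_haar_def sets[symmetric])
    qed
    from this[OF z] this[OF x] show ?thesis by simp
  qed
  let ?C = "vil_I m n ` vil_group m"
  have "1 = emeasure \<mu> (\<Union>C\<in>?C. C)"
  proof -
    have "(\<Union>C\<in>?C. C) = vil_group m" by (auto simp: vil_I_def)
    then show ?thesis using \<mu> by (simp add: is_vil_haar_def)
  qed
  also have "\<dots> = (\<Sum>C\<in>?C. emeasure \<mu> C)"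
  proof (rule sum_emeasure[symmetric])
    show "(\<lambda>C. C) ` ?C \<subseteq> sets \<mu>" using vil_I_prod sets by auto
    show "disjoint_family_on (\<lambda>C. C) ?C"
      by (auto simp: disjoint_family_on_def vil_I_def)
  qed (rule finite_vil_I)
  also have "\<dots> = (\<Sum>C\<in>?C. emeasure \<mu> (vil_I m n x))"
    by (rule sum.cong) (auto simp: eq)
  finally have one: "1 = of_nat (card ?C) * emeasure \<mu> (vil_I m n x)" by simp
  have "card ?C \<noteq> 0"
  proof
    assume "card ?C = 0"
    with one show False by simp
  qed
  then have "emeasure \<mu> (vil_I m n x) * of_nat (card ?C) / of_nat (card ?C) = emeasure \<mu> (vil_I m n x)"
    by (intro mult_divide_eq_ennreal) auto
  moreover have "emeasure \<mu> (vil_I m n x) * of_nat (card ?C) = 1"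
    using one by (simp only: mult.commute)
  ultimately show ?thesis by (simp only:)
qed

lemma vil_I_Int:
  assumes "x \<in> vil_I m n a" "x \<in> vil_I m k b"
  shows "vil_I m n a \<inter> vil_I m k b = vil_I m (max n k) x"
  using assms by (auto simp: vil_I_def less_max_iff_disj)

lemma is_vil_haar_unique:
  assumes \<mu>: "is_vil_haar m \<mu>" and \<nu>: "is_vil_haar m \<nu>"
  shows "\<mu> = \<nu>"
proof (rule measure_eqI_generator_eq[where \<Omega> = "vil_group m" and A = "\<lambda>_. vil_group m"
      and E = "insert {} (\<Union>n. vil_I m n ` vil_group m)"])
  show "Int_stable (insert {} (\<Union>n. vil_I m n ` vil_group m))"
  proof (rule Int_stableI)
    fix A B assume A: "A \<in> insert {} (\<Union>n. vil_I m n ` vil_group m)"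
      and B: "B \<in> insert {} (\<Union>n. vil_I m n ` vil_group m)"
    show "A \<inter> B \<in> insert {} (\<Union>n. vil_I m n ` vil_group m)"
    proof (cases "A \<inter> B = {}")
      case False
      then obtain x where x: "x \<in> A" "x \<in> B" by blast
      from A x obtain n a where "A = vil_I m n a" by blast
      moreover from B x obtain k b where "B = vil_I m k b" by blast
      ultimately have *: "x \<in> A" "x \<in> B" "A = vil_I m n a" "B = vil_I m k b" using x by auto
      then have "A \<inter> B = vil_I m (max n k) x" using vil_I_Int by blast
      moreover have "x \<in> vil_group m" using * by (auto simp: vil_I_def)
      ultimately show ?thesis by blast
    qed simp
  qed
  show "insert {} (\<Union>n. vil_I m n ` vil_group m) \<subseteq> Pow (vil_group m)" by (auto simp: vil_I_def)
  show "emeasure \<mu> X = emeasure \<nu> X" if "X \<in> insert {} (\<Union>n. vil_I m n ` vil_group m)" for X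
    using that is_vil_haar_I[OF \<mu>] is_vil_haar_I[OF \<nu>] by auto
  show "sets \<mu> = sigma_sets (vil_group m) (insert {} (\<Union>n. vil_I m n ` vil_group m))"
    "sets \<nu> = sigma_sets (vil_group m) (insert {} (\<Union>n. vil_I m n ` vil_group m))"
    using \<mu> \<nu> by (simp_all add: is_vil_haar_def flip: sets_vil_prod_eq sets_vil_generated)
  have "vil_group m \<noteq> {}" using \<mu> by (auto simp: is_vil_haar_def)
  then obtain x where "x \<in> vil_group m" by blast
  moreover have "vil_I m 0 x = vil_group m" by (auto simp: vil_I_def)
  ultimately have "vil_group m \<in> (\<Union>n. vil_I m n ` vil_group m)" by blast
  then show "range (\<lambda>_::nat. vil_group m) \<subseteq> insert {} (\<Union>n. vil_I m n ` vil_group m)"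
    by auto
  show "emeasure \<mu> (vil_group m) \<noteq> \<infinity>" using \<mu> by (simp add: is_vil_haar_def)
qed auto

lemma is_vil_haar_prod:
  assumes m: "\<And>k. 0 < m k"
  shows "is_vil_haar m (vil_prod m)"
proof -
  have ps: "prob_space (uniform_count_measure {..<m k})" for k
    using m[of k] by (intro prob_space_uniform_count_measure) auto
  interpret product_prob_space "\<lambda>k. uniform_count_measure {..<m k}" "UNIV :: nat set"
    by (intro product_prob_spaceI ps)
  have meas: "vil_add m a \<in> vil_prod m \<rightarrow>\<^sub>M vil_prod m" for a
    unfolding vil_add_def
  proof (rule measurable_PiM_single')
    show "(\<lambda>x. (a i + x i) mod m i) \<in> vil_prod m \<rightarrow>\<^sub>M uniform_count_measure {..<m i}" for i
      by (rule measurable_compose[OF measurable_component_singleton[of i]])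
         (use m in \<open>auto simp: measurable_def space_uniform_count_measure sets_uniform_count_measure\<close>)
  qed (use m in \<open>auto simp: space_uniform_count_measure\<close>)
  have inv: "distr (vil_prod m) (vil_prod m) (vil_add m a) = vil_prod m" if a: "a \<in> vil_group m" for a
  proof (rule PiM_eq)
    fix J :: "nat set" and F assume J: "finite J" "\<And>j. j \<in> J \<Longrightarrow> F j \<in> sets (uniform_count_measure {..<m j})"
    let ?G = "\<lambda>j. {y \<in> {..<m j}. (a j + y) mod m j \<in> F j}"
    let ?X = "prod_emb UNIV (\<lambda>k. uniform_count_measure {..<m k}) J"
    have F: "F j \<subseteq> {..<m j}" if "j \<in> J" for j
      using J(2)[OF that] by (auto simp: sets_uniform_count_measure)
    have bij: "bij_betw (\<lambda>y. (a j + y) mod m j) {..<m j} {..<m j}" for j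
    proof -
      have inj: "inj_on (\<lambda>y. (a j + y) mod m j) {..<m j}"
      proof (rule inj_onI)
        fix y z assume yz: "y \<in> {..<m j}" "z \<in> {..<m j}" "(a j + y) mod m j = (a j + z) mod m j"
        have aj: "a j < m j" using a by (simp add: mem_vil_group)
        have "(a j + w) mod m j = (if a j + w < m j then a j + w else a j + w - m j)"
          if "w < m j" for w
          using that aj by (simp add: le_mod_geq)
        then show "y = z" using yz aj by (auto split: if_splits)
      qed
      moreover have "(\<lambda>y. (a j + y) mod m j) ` {..<m j} \<subseteq> {..<m j}" using m by auto
      ultimately show ?thesis unfolding bij_betw_def using endo_inj_surj[OF finite_lessThan] by blast
    qed
    have card: "card (?G j) = card (F j)" if "j \<in> J" for j
    proof -
      have "bij_betw (\<lambda>y. (a j + y) mod m j) (?G j) (F j)"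
      proof (rule bij_betw_subset[OF bij])
        show "(\<lambda>y. (a j + y) mod m j) ` ?G j = F j"
        proof (intro equalityI subsetI)
          fix w assume w: "w \<in> F j"
          then have "w \<in> (\<lambda>y. (a j + y) mod m j) ` {..<m j}"
            using bij_betw_imp_surj_on[OF bij[of j]] F[OF that] by auto
          then show "w \<in> (\<lambda>y. (a j + y) mod m j) ` ?G j" using w by auto
        qed auto
      qed auto
      then show ?thesis by (rule bij_betw_same_card)
    qed
    have X: "?X (Pi\<^sub>E J F) \<in> sets (vil_prod m)" using J by (intro sets_PiM_I) auto
    have "emeasure (distr (vil_prod m) (vil_prod m) (vil_add m a)) (?X (Pi\<^sub>E J F))
        = emeasure (vil_prod m) (vil_add m a -` ?X (Pi\<^sub>E J F) \<inter> space (vil_prod m))"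
      by (rule emeasure_distr[OF meas X])
    also have "vil_add m a -` ?X (Pi\<^sub>E J F) \<inter> space (vil_prod m) = ?X (Pi\<^sub>E J ?G)"
      using m by (auto simp: prod_emb_def space_vil_prod mem_vil_group space_uniform_count_measure
          PiE_iff vil_add_def extensional_def)
    also have "emeasure (vil_prod m) \<dots> = (\<Prod>j\<in>J. emeasure (uniform_count_measure {..<m j}) (?G j))"
      using J(1) by (intro emeasure_PiM_emb) (auto simp: sets_uniform_count_measure)
    also have "\<dots> = (\<Prod>j\<in>J. emeasure (uniform_count_measure {..<m j}) (F j))"
    proof (rule prod.cong[OF refl])
      fix j assume j: "j \<in> J"
      have "?G j \<subseteq> {..<m j}" by blast
      then show "emeasure (uniform_count_measure {..<m j}) (?G j)
          = emeasure (uniform_count_measure {..<m j}) (F j)"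
        using F[OF j] card[OF j] by (simp only: emeasure_uniform_count_measure[OF finite_lessThan])
    qed
    finally show "emeasure (distr (vil_prod m) (vil_prod m) (vil_add m a)) (?X (Pi\<^sub>E J F))
        = (\<Prod>j\<in>J. emeasure (uniform_count_measure {..<m j}) (F j))" .
  qed simp
  have "emeasure (vil_prod m) (vil_add m a ` A) = emeasure (vil_prod m) A"
    if a: "a \<in> vil_group m" and A: "A \<in> sets (vil_prod m)" for a A
  proof -
    obtain b where b: "b \<in> vil_group m"
      "\<And>z. z \<in> vil_group m \<Longrightarrow> vil_add m b (vil_add m a z) = z"
      "\<And>z. z \<in> vil_group m \<Longrightarrow> vil_add m a (vil_add m b z) = z"
      using vil_neg[OF a] by blast
    have AG: "A \<subseteq> vil_group m" using sets.sets_into_space[OF A] by (simp add: space_vil_prod)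
    have "vil_add m a ` A = vil_add m b -` A \<inter> space (vil_prod m)"
    proof (intro equalityI subsetI)
      fix w assume "w \<in> vil_add m a ` A"
      then show "w \<in> vil_add m b -` A \<inter> space (vil_prod m)"
        using b AG vil_add_closed[OF a] by (auto simp: space_vil_prod subset_iff)
    next
      fix w assume "w \<in> vil_add m b -` A \<inter> space (vil_prod m)"
      then show "w \<in> vil_add m a ` A"
        using b(3)[of w] by (auto simp: space_vil_prod intro!: image_eqI[where x = "vil_add m b w"])
    qed
    then show ?thesis using emeasure_distr[OF meas A, of b] inv[OF b(1)] by simp
  qed
  then show ?thesis
    using P.emeasure_space_1 by (simp add: is_vil_haar_def space_vil_prod sets_vil_prod_eq)
qed

theorem vil_haar_eq_prod:
  assumes "\<And>k. 0 < m k"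
  shows "vil_haar m = vil_prod m"
  unfolding vil_haar_def
  using is_vil_haar_prod[OF assms] by (rule the_equality) (erule is_vil_haar_unique[OF _ is_vil_haar_prod[OF assms]])


section \<open>The Vilenkin system\<close>

primrec vil_M :: "(nat \<Rightarrow> nat) \<Rightarrow> nat \<Rightarrow> nat" where
  "vil_M m 0 = 1"
| "vil_M m (Suc k) = m k * vil_M m k"

definition vil_digit :: "(nat \<Rightarrow> nat) \<Rightarrow> nat \<Rightarrow> nat \<Rightarrow> nat" where
  "vil_digit m n j = (n div vil_M m j) mod m j"

definition vil_r :: "(nat \<Rightarrow> nat) \<Rightarrow> nat \<Rightarrow> (nat \<Rightarrow> nat) \<Rightarrow> complex" where
  "vil_r m k x = exp (2 * of_real pi * \<i> * of_nat (x k) / of_nat (m k))"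

definition vil_psi :: "(nat \<Rightarrow> nat) \<Rightarrow> nat \<Rightarrow> (nat \<Rightarrow> nat) \<Rightarrow> complex" where
  "vil_psi m n x = (\<Prod>k. vil_r m k x ^ vil_digit m n k)"

lemma vil_M_gt: assumes "\<And>k. 2 \<le> m k" shows "k < vil_M m k"
proof (induction k)
  case (Suc k)
  have "Suc k < 2 * vil_M m k" using Suc by simp
  also have "\<dots> \<le> m k * vil_M m k" using assms by (intro mult_right_mono) auto
  finally show ?case by simp
qed simp

lemma vil_expansion_mod: "(\<Sum>j<N. vil_digit m n j * vil_M m j) = n mod vil_M m N"
proof (induction N)
  case (Suc N)
  have "n mod (m N * vil_M m N) = n mod (vil_M m N * m N)" by (simp add: mult.commute)
  also have "\<dots> = vil_M m N * (n div vil_M m N mod m N) + n mod vil_M m N" by (rule mod_mult2_eq)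
  finally show ?case using Suc by (simp add: vil_digit_def mult.commute)
qed simp

lemma vil_digit_eq_0: assumes "\<And>k. 2 \<le> m k" "n \<le> j" shows "vil_digit m n j = 0"
proof -
  have "n < vil_M m j" using vil_M_gt[OF assms(1)] assms(2) by (rule le_less_trans[rotated])
  then show ?thesis by (simp add: vil_digit_def)
qed

text \<open>The digits are those of the expansion \<open>n = \<Sum>\<^sub>j n\<^sub>j M\<^sub>j\<close>.\<close>

lemma vil_expansion:
  assumes "\<And>k. 2 \<le> m k"
  shows "vil_digit m n j < m j" and "(\<Sum>j<n. vil_digit m n j * vil_M m j) = n"
proof -
  have "0 < m j" using assms[of j] by simp
  then show "vil_digit m n j < m j" by (simp add: vil_digit_def)
  show "(\<Sum>j<n. vil_digit m n j * vil_M m j) = n"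
    unfolding vil_expansion_mod by (rule mod_less[OF vil_M_gt[OF assms]])
qed

lemma vil_psi_finite:
  assumes "\<And>k. 2 \<le> m k"
  shows "vil_psi m n x = (\<Prod>k<n. vil_r m k x ^ vil_digit m n k)"
  unfolding vil_psi_def
  by (rule prodinf_finite) (auto simp: vil_digit_eq_0[OF assms])


section \<open>Fourier coefficients, martingales and Fejer means\<close>

definition vil_coeff :: "(nat \<Rightarrow> nat) \<Rightarrow> ((nat \<Rightarrow> nat) \<Rightarrow> complex) \<Rightarrow> nat \<Rightarrow> complex" where
  "vil_coeff m g k = (\<integral>x. g x * cnj (vil_psi m k x) \<partial>vil_haar m)"

definition vil_S :: "(nat \<Rightarrow> nat) \<Rightarrow> nat \<Rightarrow> ((nat \<Rightarrow> nat) \<Rightarrow> complex) \<Rightarrow> (nat \<Rightarrow> nat) \<Rightarrow> complex" where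
  "vil_S m n g x = (\<Sum>k<n. vil_coeff m g k * vil_psi m k x)"

definition vil_martingale :: "(nat \<Rightarrow> nat) \<Rightarrow> (nat \<Rightarrow> (nat \<Rightarrow> nat) \<Rightarrow> complex) \<Rightarrow> bool" where
  "vil_martingale m f \<longleftrightarrow>
     (\<forall>n. integrable (vil_haar m) (f n) \<and> f n \<in> borel_measurable (vil_F m n)) \<and>
     (\<forall>n k. n \<le> k \<longrightarrow> (\<forall>x\<in>vil_group m. vil_S m (vil_M m n) (f k) x = f n x))"

definition vil_mcoeff :: "(nat \<Rightarrow> nat) \<Rightarrow> (nat \<Rightarrow> (nat \<Rightarrow> nat) \<Rightarrow> complex) \<Rightarrow> nat \<Rightarrow> complex" where
  "vil_mcoeff m f i = lim (\<lambda>k. vil_coeff m (f k) i)"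

definition vil_mS :: "(nat \<Rightarrow> nat) \<Rightarrow> nat \<Rightarrow> (nat \<Rightarrow> (nat \<Rightarrow> nat) \<Rightarrow> complex) \<Rightarrow> (nat \<Rightarrow> nat) \<Rightarrow> complex" where
  "vil_mS m n f x = (\<Sum>k<n. vil_mcoeff m f k * vil_psi m k x)"

definition vil_sigma :: "(nat \<Rightarrow> nat) \<Rightarrow> nat \<Rightarrow> (nat \<Rightarrow> (nat \<Rightarrow> nat) \<Rightarrow> complex) \<Rightarrow> (nat \<Rightarrow> nat) \<Rightarrow> complex" where
  "vil_sigma m n f x = (\<Sum>k=1..n. vil_mS m k f x) / of_nat n"


section \<open>Quasi-norms\<close>

text \<open>Real powers on \<open>[0,\<infinity>]\<close>, intended for exponents \<open>a > 0\<close>: \<open>0\<^sup>a = 0\<close> and \<open>\<infinity>\<^sup>a = \<infinity>\<close>.\<close>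

definition epowr :: "ennreal \<Rightarrow> real \<Rightarrow> ennreal" where
  "epowr x a = (if x = \<infinity> then \<infinity> else ennreal (enn2real x powr a))"

text \<open>The function is given through its absolute value, which may be infinite (as for \<open>f\<^sup>*\<close>).\<close>

definition Lp_qnorm :: "'a measure \<Rightarrow> real \<Rightarrow> ('a \<Rightarrow> ennreal) \<Rightarrow> ennreal" where
  "Lp_qnorm M p h = epowr (\<integral>\<^sup>+x. epowr (h x) p \<partial>M) (1 / p)"

definition weak_Lp_qnorm :: "'a measure \<Rightarrow> real \<Rightarrow> ('a \<Rightarrow> ennreal) \<Rightarrow> ennreal" where
  "weak_Lp_qnorm M p h =
     (SUP l\<in>{0::real<..}. ennreal l * epowr (emeasure M {x \<in> space M. ennreal l < h x}) (1 / p))"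

definition vil_maximal :: "(nat \<Rightarrow> (nat \<Rightarrow> nat) \<Rightarrow> complex) \<Rightarrow> (nat \<Rightarrow> nat) \<Rightarrow> ennreal" where
  "vil_maximal f x = (SUP n. ennreal (norm (f n x)))"

definition vil_Hp_norm :: "(nat \<Rightarrow> nat) \<Rightarrow> real \<Rightarrow> (nat \<Rightarrow> (nat \<Rightarrow> nat) \<Rightarrow> complex) \<Rightarrow> ennreal" where
  "vil_Hp_norm m p f = Lp_qnorm (vil_haar m) p (vil_maximal f)"

definition vil_Hp :: "(nat \<Rightarrow> nat) \<Rightarrow> real \<Rightarrow> (nat \<Rightarrow> (nat \<Rightarrow> nat) \<Rightarrow> complex) set" where
  "vil_Hp m p = {f. vil_martingale m f \<and> vil_Hp_norm m p f < \<infinity>}"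

end

theory Submission
  imports Defs
begin

text \<open>
For the upper estimate, fix \<open>N\<close> and decompose \<open>f\<^sup>(\<^sup>N\<^sup>)\<close> by stopping the martingale just before it
exceeds \<open>\<parallel>f\<parallel> 2\<^sup>j\<close>. The difference of two consecutive stopped martingales is a sum of atoms:
bounded mean-zero functions on disjoint cosets of total measure at most a constant times
\<open>\<mu>(f\<^sup>* > \<parallel>f\<parallel> 2\<^sup>j)\<close>. The lowest stopped martingale is itself an atom, on the whole group. As the
functional is \<open>p\<close>-subadditive, it suffices to bound it on an atom \<open>a\<close> supported on \<open>I\<^sub>n(z)\<close>. Then
\<open>\<sigma>\<^sub>k a\<close> vanishes for \<open>k < M\<^sub>n\<close>, is controlled in \<open>L\<^sub>2\<close> on the coset, and off the coset is bounded by
\<open>M\<^sub>s M\<^sub>l / (k M\<^sub>n)\<close>, where \<open>s < l\<close> are the first two coordinates in which the point differs from \<open>z\<close>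
(with \<open>k\<close> in place of \<open>M\<^sub>l\<close> if only one of the first \<open>n\<close> differs); the \<open>p\<close>-th powers are summable
because \<open>p < 1/2\<close>.

For the divergence, the martingale has constant coefficients \<open>w\<^sub>n\<close> on \<open>[M\<^sub>n, M\<^sub>n\<^sub>+\<^sub>1)\<close>. Where \<open>x\<^sub>0 \<noteq> 0\<close>, the
partial sums with index \<open>j \<equiv> 1\<close> modulo \<open>m\<^sub>0\<close> in this block have absolute value exactly \<open>w\<^sub>n\<close>, hence
\<open>\<sigma>\<^sub>j\<close> or \<open>\<sigma>\<^sub>j\<^sub>-\<^sub>1\<close> is at least of order \<open>w\<^sub>n / M\<^sub>n\<close> on a set of measure bounded away from zero.
\<close>

section \<open>Functions of finitely many coordinates\<close>

text \<open>All estimates concern functions of finitely many coordinates, for which measurability,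
  boundedness and integrability are automatic. Constants depend neither on the number of coordinates
  nor on the length of the partial series, so suprema are taken only at the very end. The weight
  \<open>k powr (2 * p - 2)\<close> is critical. Away from its coset, an atom of height
  \<open>lam\<close> contributes a term of order
  \<open>lam powr p * M n powr (-p) * k powr (-p)\<close>; weighted and summed over
  \<open>k \<ge> M n\<close> this becomes \<open>lam powr p / M n\<close>, the p-th power of the
  height times the measure of the coset. The same balance dictates the divergent martingale. With
  \<open>w n powr p = e n * M n powr (1 - p)\<close>, block \<open>n\<close> costs a multiple of
  \<open>e n\<close> in the p-th power of the Hardy norm, while on the order of \<open>M n\<close>
  pairs of means each contribute at least a multiple of \<open>e n * M n powr (1 - 2 * p)\<close>.
  What remains is to choose summable \<open>e\<close> whose products with an unbounded sequence are
  still unbounded. Stopping one step ahead is affordable because \<open>m\<close> is bounded: a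
  coset has at most \<open>B\<close> subcosets of the next level.\<close>

definition level :: "nat \<Rightarrow> ((nat \<Rightarrow> nat) \<Rightarrow> 'a) \<Rightarrow> bool" where
  "level n h \<longleftrightarrow> (\<forall>x y. (\<forall>i<n. x i = y i) \<longrightarrow> h x = h y)"

lemma levelI: "(\<And>x y. (\<And>i. i < n \<Longrightarrow> x i = y i) \<Longrightarrow> h x = h y) \<Longrightarrow> level n h"
  unfolding level_def by blast

lemma levelD: "level n h \<Longrightarrow> (\<And>i. i < n \<Longrightarrow> x i = y i) \<Longrightarrow> h x = h y"
  unfolding level_def by blast

lemma level_mono: "level n h \<Longrightarrow> n \<le> k \<Longrightarrow> level k h"
  by (auto simp: level_def)

lemma level_const: "level n (\<lambda>x. c)"
  by (auto simp: level_def)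

lemma level_comp: "level n h \<Longrightarrow> level n (\<lambda>x. F (h x))"
  by (auto simp: level_def intro!: arg_cong[where f=F])

lemma level_comp2: "level n h \<Longrightarrow> level n k \<Longrightarrow> level n (\<lambda>x. F (h x) (k x))"
  by (auto simp: level_def intro!: arg_cong2[where f=F])

lemma level_sum: "(\<And>i. i \<in> A \<Longrightarrow> level n (h i)) \<Longrightarrow> level n (\<lambda>x. \<Sum>i\<in>A. h i x)"
  by (auto simp: level_def intro!: sum.cong)

locale vilenkin =
  fixes m :: "nat \<Rightarrow> nat" and B :: nat
  assumes m_ge: "\<And>k. 2 \<le> m k" and m_le: "\<And>k. m k \<le> B"
begin

abbreviation "\<mu> \<equiv> vil_haar m"
abbreviation "G \<equiv> vil_group m"
abbreviation "M \<equiv> vil_M m"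
abbreviation "\<psi> \<equiv> vil_psi m"

text \<open>The coordinate set is arbitrary because the estimates away from an atom use sets with
  one coordinate left free, \<open>{..<l} - {s}\<close>, besides the cosets given by
  \<open>{..<n}\<close>.\<close>

definition agree :: "nat set \<Rightarrow> (nat \<Rightarrow> nat) \<Rightarrow> (nat \<Rightarrow> nat) \<Rightarrow> bool" where
  "agree J z x \<longleftrightarrow> (\<forall>j\<in>J. x j = z j)"

lemma m_pos [simp]: "0 < m k"
  using m_ge[of k] by linarith

lemma M_pos [simp]: "0 < M n"
  by (induction n) auto

lemma haar_eq: "\<mu> = vil_prod m"
  by (rule vil_haar_eq_prod) simp

lemma space_haar [simp]: "space \<mu> = G"
  by (simp add: haar_eq space_vil_prod)

lemma is_vil_haar_haar: "is_vil_haar m \<mu>"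
  by (simp add: haar_eq is_vil_haar_prod)

sublocale haar: prob_space \<mu>
  using is_vil_haar_haar by (intro prob_spaceI) (simp add: is_vil_haar_def)

section \<open>Haar measure of cylinders, integrability of functions of finitely many
  coordinates\<close>

lemma cylinder:
  assumes "finite J" "z \<in> G"
  shows "{x\<in>G. agree J z x} \<in> sets \<mu>" "measure \<mu> {x\<in>G. agree J z x} = (\<Prod>j\<in>J. 1 / real (m j))"
proof -
  have ps: "prob_space (uniform_count_measure {..<m k})" for k
    using m_pos[of k] by (intro prob_space_uniform_count_measure) (auto simp: lessThan_empty_iff)
  interpret P: product_prob_space "\<lambda>k. uniform_count_measure {..<m k}" "UNIV :: nat set"
    by (intro product_prob_spaceI ps)
  have z: "z k < m k" for k using assms by (simp add: mem_vil_group)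
  let ?E = "prod_emb UNIV (\<lambda>k. uniform_count_measure {..<m k}) J (Pi\<^sub>E J (\<lambda>j. {z j}))"
  have eq: "{x\<in>G. agree J z x} = ?E"
    by (auto simp add: prod_emb_def agree_def vil_group_def space_uniform_count_measure restrict_PiE_iff)
  show "{x\<in>G. agree J z x} \<in> sets \<mu>"
    unfolding eq haar_eq using assms z by (intro sets_PiM_I) (auto simp: sets_uniform_count_measure)
  have "measure \<mu> ?E = (\<Prod>j\<in>J. measure (uniform_count_measure {..<m j}) {z j})"
    unfolding haar_eq using assms z by (intro P.measure_PiM_emb) (auto simp: sets_uniform_count_measure)
  also have "\<dots> = (\<Prod>j\<in>J. 1 / real (m j))"
    using z by (intro prod.cong refl) (simp add: measure_uniform_count_measure)
  finally show "measure \<mu> {x\<in>G. agree J z x} = (\<Prod>j\<in>J. 1 / real (m j))" unfolding eq .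
qed

lemma M_prod: "real (M n) = (\<Prod>j<n. real (m j))"
  by (induction n) (auto simp: mult.commute)

lemma space_vil_F: "space (vil_F m n) = G"
  unfolding vil_F_def by (rule space_measure_of) (auto simp: vil_I_def)

lemma sets_vil_F: "sets (vil_F m n) = sigma_sets G (vil_I m n ` G)"
  unfolding vil_F_def by (rule sets_measure_of) (auto simp: vil_I_def)

text \<open>Every preimage is a union of cosets of level \<open>n\<close>, of which there are
  finitely many.\<close>

lemma level_measurable_F:
  assumes "level n h"
  shows "h \<in> measurable (vil_F m n) borel"
proof -
  show ?thesis
  proof (rule measurableI)
    fix A :: "'a set" assume A: "A \<in> sets borel"
    have "h -` A \<inter> space (vil_F m n) = \<Union>{C \<in> vil_I m n ` G. C \<subseteq> h -` A}"
    proof (intro equalityI subsetI)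
      fix x assume x: "x \<in> h -` A \<inter> space (vil_F m n)"
      have "vil_I m n x \<subseteq> h -` A"
      proof
        fix y assume "y \<in> vil_I m n x"
        then have "h y = h x" by (intro levelD[OF assms]) (simp add: vil_I_def)
        then show "y \<in> h -` A" using x by simp
      qed
      moreover have "x \<in> vil_I m n x" "x \<in> G" using x by (auto simp: vil_I_def space_vil_F)
      ultimately show "x \<in> \<Union>{C \<in> vil_I m n ` G. C \<subseteq> h -` A}" by blast
    qed (auto simp: space_vil_F vil_I_def)
    also have "\<dots> \<in> sets (vil_F m n)"
      by (intro sets.finite_Union finite_subset[OF _ finite_vil_I[of m n]]) (auto simp: sets_vil_F)
    finally show "h -` A \<inter> space (vil_F m n) \<in> sets (vil_F m n)" .
  qed simp
qed

lemma level_measurable: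
  assumes "level n h"
  shows "h \<in> borel_measurable \<mu>"
proof -
  have "sets (vil_F m n) \<subseteq> sets \<mu>"
    unfolding sets_vil_F space_haar[symmetric] by (rule sets.sigma_sets_subset) (auto simp: haar_eq vil_I_prod)
  then show ?thesis
    using measurable_sets[OF level_measurable_F[OF assms]] by (intro measurableI) (auto simp: space_vil_F)
qed

lemma level_finite_range:
  assumes "level n h" shows "finite (h ` G)"
proof -
  have "h ` G \<subseteq> (\<lambda>C. h (SOME x. x \<in> C)) ` (vil_I m n ` G)"
  proof clarify
    fix x assume x: "x \<in> G"
    then have "x \<in> vil_I m n x" by (simp add: vil_I_def)
    then have "(SOME y. y \<in> vil_I m n x) \<in> vil_I m n x" by (rule someI[where P="\<lambda>y. y \<in> vil_I m n x"])
    then have "h x = h (SOME y. y \<in> vil_I m n x)" by (intro levelD[OF assms]) (simp add: vil_I_def)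
    then show "h x \<in> (\<lambda>C. h (SOME x. x \<in> C)) ` (vil_I m n ` G)" using x by blast
  qed
  then show ?thesis using finite_vil_I finite_subset by blast
qed

lemma level_bounded:
  fixes h :: "_ \<Rightarrow> 'b::real_normed_vector"
  assumes "level n h" obtains C where "C > 0" "\<And>x. x \<in> G \<Longrightarrow> norm (h x) \<le> C"
proof -
  have "bounded (h ` G)" using level_finite_range[OF assms] by (rule finite_imp_bounded)
  then show ?thesis using that unfolding bounded_pos by auto
qed

lemma level_integrable:
  fixes h :: "_ \<Rightarrow> 'b::{banach,second_countable_topology}"
  assumes "level n h" shows "integrable \<mu> h"
proof -
  obtain C where "\<And>x. x \<in> G \<Longrightarrow> norm (h x) \<le> C" using level_bounded[OF assms] by blast
  then show ?thesis using level_measurable[OF assms] by (intro haar.integrable_const_bound[where B=C]) auto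
qed

lemma level_agree: "J \<subseteq> {..<n} \<Longrightarrow> level n (agree J z)"
  by (auto simp: level_def agree_def subset_eq)

lemma integral_agree:
  assumes "finite J" "z \<in> G"
  shows "(\<integral>x. of_bool (agree J z x) \<partial>\<mu>) = (\<Prod>j\<in>J. 1 / real (m j))"
proof -
  have "(\<integral>x. of_bool (agree J z x) \<partial>\<mu>) = (\<integral>x. indicator {x\<in>G. agree J z x} x \<partial>\<mu>)"
    by (intro Bochner_Integration.integral_cong) (auto simp: indicator_def)
  also have "\<dots> = measure \<mu> {x\<in>G. agree J z x}"
    using cylinder(1)[OF assms] sets.sets_into_space[OF cylinder(1)[OF assms]] by (simp add: Int_absorb2)
  finally show ?thesis using cylinder(2)[OF assms] by simp
qed

lemma integral_agree_I:
  assumes "z \<in> G"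
  shows "(\<integral>x. of_bool (agree {..<n} z x) \<partial>\<mu>) = 1 / real (M n)"
  using integral_agree[OF _ assms, of "{..<n}"] by (simp add: M_prod prod_dividef)

end

section \<open>Dirichlet and Fejer kernels\<close>

lemma sum_lessThan_add:
  fixes f :: "nat \<Rightarrow> 'a::comm_monoid_add"
  shows "(\<Sum>k<a + b. f k) = (\<Sum>k<a. f k) + (\<Sum>k<b. f (a + k))"
  by (induction b) (auto simp: add.assoc)

context vilenkin begin

text \<open>On the group this is the classical kernel at the difference of \<open>x\<close> and
  \<open>t\<close>, since each \<open>\<psi> k\<close> is a character. Keeping two points avoids
  group subtraction and allows single coordinates of one point to be altered.\<close>

definition dirichlet :: "nat \<Rightarrow> (nat \<Rightarrow> nat) \<Rightarrow> (nat \<Rightarrow> nat) \<Rightarrow> complex" where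
  "dirichlet n x t = (\<Sum>k<n. \<psi> k x * cnj (\<psi> k t))"

section \<open>Digits and products of Vilenkin functions\<close>

lemma M_gt: "k < M k"
  by (rule vil_M_gt) (rule m_ge)

lemma M_mono: "i \<le> j \<Longrightarrow> M i \<le> M j"
proof (induction rule: dec_induct)
  case (step n)
  then show ?case using m_pos[of n] by (simp add: Suc_leI le_trans[of _ "M n"])
qed simp

lemma M_dvd: "i \<le> j \<Longrightarrow> M i dvd M j"
  by (induction rule: dec_induct) auto

lemma digit_0: "n < M N \<Longrightarrow> N \<le> k \<Longrightarrow> vil_digit m n k = 0"
  using M_mono[of N k] by (simp add: vil_digit_def)

lemma psi_prod:
  assumes "n < M N"
  shows "\<psi> n x = (\<Prod>k<N. vil_r m k x ^ vil_digit m n k)"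
  unfolding vil_psi_def
  by (rule prodinf_finite) (auto simp: digit_0[OF assms])

lemma psi_level: "n < M N \<Longrightarrow> level N (\<psi> n)"
  by (auto intro!: levelI prod.cong simp: psi_prod vil_r_def)

lemma norm_r: "norm (vil_r m k x) = 1"
proof -
  have "vil_r m k x = exp (\<i> * of_real (2 * pi * x k / m k))" by (simp add: vil_r_def mult_ac)
  then show ?thesis by (simp only: norm_exp_i_times)
qed

lemma norm_psi [simp]: "norm (\<psi> n x) = 1"
  using psi_prod[OF M_gt[of n], of x] by (simp add: norm_power norm_r flip: prod_norm)

lemma digit_add_low:
  assumes "r < M i" "j < i"
  shows "vil_digit m (q * M i + r) j = vil_digit m r j"
proof -
  have "M (Suc j) dvd M i" using assms by (intro M_dvd) simp
  then obtain c where c: "M i = m j * M j * c" by (auto elim: dvdE)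
  have "q * M i + r = r + M j * (m j * (q * c))" by (simp add: c)
  then have "(q * M i + r) div M j = m j * (q * c) + r div M j"
    by (simp only: div_mult_self2[OF M_pos[THEN less_imp_neq, THEN not_sym]])
  then show ?thesis by (simp add: vil_digit_def)
qed

lemma digit_add_high:
  assumes "r < M i" "i \<le> j"
  shows "vil_digit m (q * M i + r) j = vil_digit m (q * M i) j"
proof -
  obtain c where c: "M j = M i * c" using M_dvd[OF assms(2)] by (auto elim: dvdE)
  have "(q * M i + r) div M j = ((q * M i + r) div M i) div c" by (simp add: c div_mult2_eq)
  also have "\<dots> = ((q * M i) div M i) div c" using assms(1) by simp
  also have "\<dots> = (q * M i) div M j" by (simp only: c div_mult2_eq)
  finally show ?thesis by (simp add: vil_digit_def)
qed

lemma digit_mult_low: "j < i \<Longrightarrow> vil_digit m (q * M i) j = 0"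
  using digit_add_low[of 0 i j q] by (simp add: vil_digit_def)

text \<open>No carry occurs: below position \<open>i\<close> the digits are those of
  \<open>r\<close>, from \<open>i\<close> on those of \<open>q * M i\<close>.\<close>

lemma psi_add:
  assumes "r < M i"
  shows "\<psi> (q * M i + r) x = \<psi> (q * M i) x * \<psi> r x"
proof -
  define N where "N = q * M i + r + i"
  have N: "q * M i + r < M N" "q * M i < M N" "r < M N"
    using M_gt[of N] by (auto simp: N_def)
  have "vil_r m k x ^ vil_digit m (q * M i + r) k =
      vil_r m k x ^ vil_digit m (q * M i) k * vil_r m k x ^ vil_digit m r k" for k
    using digit_add_low[OF assms, of k q] digit_add_high[OF assms, of k q] digit_mult_low[of k i q]
      digit_0[OF assms, of k]
    by (cases "k < i") auto
  then show ?thesis by (simp add: psi_prod[OF N(1)] psi_prod[OF N(2)] psi_prod[OF N(3)] prod.distrib)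
qed

lemma psi_high:
  assumes "\<And>j. i \<le> j \<Longrightarrow> x j = y j"
  shows "\<psi> (q * M i) x = \<psi> (q * M i) y"
proof -
  have "q * M i < M (q * M i)" by (rule M_gt)
  from psi_prod[OF this] show ?thesis
    using assms digit_mult_low[of _ i q]
    by (auto intro!: prod.cong simp: vil_r_def) (metis linorder_not_less power_0)
qed

lemma psi_mult_M:
  assumes "a < m i"
  shows "\<psi> (a * M i) x = vil_r m i x ^ a"
proof -
  have lt: "a * M i < M (Suc i)" using assms by simp
  have "vil_digit m (a * M i) i = a" using assms by (simp add: vil_digit_def)
  moreover have "(\<Prod>k<i. vil_r m k x ^ vil_digit m (a * M i) k) = 1"
    by (intro prod.neutral) (auto simp: digit_mult_low)
  ultimately show ?thesis by (simp add: psi_prod[OF lt])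
qed

text \<open>The index range is cut into \<open>q\<close> blocks of length \<open>M i\<close> and a
  remainder; by \<open>psi_add\<close> each block is an initial segment times a factor depending
  only on the block.\<close>

lemma dirichlet_blocks:
  assumes "r \<le> M i"
  shows "dirichlet (q * M i + r) x t =
    (\<Sum>a<q. \<psi> (a * M i) x * cnj (\<psi> (a * M i) t)) * dirichlet (M i) x t
    + \<psi> (q * M i) x * cnj (\<psi> (q * M i) t) * dirichlet r x t"
proof -
  have low: "(\<Sum>k<c. \<psi> (a * M i + k) x * cnj (\<psi> (a * M i + k) t)) =
      \<psi> (a * M i) x * cnj (\<psi> (a * M i) t) * dirichlet c x t" if "c \<le> M i" for a c
    unfolding dirichlet_def sum_distrib_left using that by (intro sum.cong) (auto simp: psi_add)
  have "dirichlet (q * M i) x t = (\<Sum>a<q. \<psi> (a * M i) x * cnj (\<psi> (a * M i) t)) * dirichlet (M i) x t"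
  proof (induction q)
    case (Suc q)
    have "dirichlet (Suc q * M i) x t = dirichlet (q * M i) x t + (\<Sum>k<M i. \<psi> (q * M i + k) x * cnj (\<psi> (q * M i + k) t))"
      unfolding dirichlet_def mult_Suc add.commute[of "M i"] by (rule sum_lessThan_add)
    then show ?case using Suc low[of "M i" q] by (simp add: algebra_simps)
  qed (simp add: dirichlet_def)
  moreover have "dirichlet (q * M i + r) x t = dirichlet (q * M i) x t + (\<Sum>k<r. \<psi> (q * M i + k) x * cnj (\<psi> (q * M i + k) t))"
    unfolding dirichlet_def by (rule sum_lessThan_add)
  ultimately show ?thesis using low[OF assms] by simp
qed

text \<open>A geometric sum over an \<open>m i\<close>-th root of unity, which equals 1 only for
  equal coordinates because two residues differ by less than \<open>m i\<close>.\<close>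

lemma sum_r:
  assumes "x i < m i" "t i < m i"
  shows "(\<Sum>a<m i. (vil_r m i x * cnj (vil_r m i t)) ^ a) = (if x i = t i then of_nat (m i) else 0)"
proof -
  let ?w = "vil_r m i x * cnj (vil_r m i t)"
  let ?\<theta> = "2 * pi * (real (x i) - real (t i)) / m i"
  have w: "?w = cis ?\<theta>"
  proof -
    have "vil_r m i y = cis (2 * pi * y i / m i)" for y
      by (simp add: vil_r_def cis_conv_exp mult_ac)
    then show ?thesis by (simp add: cis_cnj cis_mult diff_divide_distrib right_diff_distrib)
  qed
  have wm: "?w ^ m i = 1"
  proof -
    have "real (m i) * ?\<theta> = 2 * pi * of_int (int (x i) - int (t i))"
      using m_pos[of i] by (simp del: m_pos)
    then have "?w ^ m i = cis (2 * pi * of_int (int (x i) - int (t i)))"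
      unfolding w Complex.DeMoivre by (simp only:)
    then show ?thesis by (simp add: cis_multiple_2pi)
  qed
  show ?thesis
  proof (cases "x i = t i")
    case True
    then have "?w = 1" using w by simp
    then show ?thesis using True by simp
  next
    case False
    have "?w \<noteq> 1"
    proof
      assume "?w = 1"
      then have "cos ?\<theta> = 1" unfolding w by (metis cis.sel(1) one_complex.sel(1))
      then obtain k :: int where "?\<theta> = of_int k * 2 * pi" by (auto simp: cos_one_2pi_int)
      then have "2 * pi * (real (x i) - real (t i)) = 2 * pi * (real_of_int k * real (m i))"
        using m_pos[of i] by (simp del: m_pos add: divide_eq_eq)
      then have "real (x i) - real (t i) = real_of_int k * real (m i)"
        by (subst (asm) mult_cancel_left) simp
      then have "int (x i) - int (t i) = k * int (m i)"
        by (metis (mono_tags, lifting) of_int_diff of_int_eq_iff of_int_mult of_int_of_nat_eq)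
      moreover have "\<bar>int (x i) - int (t i)\<bar> < int (m i)" using assms by linarith
      ultimately have "\<bar>k\<bar> * int (m i) < 1 * int (m i)" by (simp add: abs_mult)
      then have "k = 0" by (subst (asm) mult_less_cancel_right) auto
      then show False using False \<open>int (x i) - int (t i) = k * int (m i)\<close> by simp
    qed
    then show ?thesis using False wm geometric_sum[of ?w "m i"] by simp
  qed
qed

text \<open>Paley's lemma: the step from \<open>M n\<close> to \<open>M (Suc n)\<close> multiplies
  the kernel by the character sum in coordinate \<open>n\<close>, which tests equality
  there.\<close>

lemma dirichlet_M:
  assumes "x \<in> G" "t \<in> G"
  shows "dirichlet (M n) x t = of_nat (M n) * of_bool (agree {..<n} t x)"
proof (induction n)
  case (Suc n)
  have "dirichlet (M (Suc n)) x t = (\<Sum>a<m n. \<psi> (a * M n) x * cnj (\<psi> (a * M n) t)) * dirichlet (M n) x t"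
    using dirichlet_blocks[of 0 n "m n" x t] by (simp add: dirichlet_def)
  also have "(\<Sum>a<m n. \<psi> (a * M n) x * cnj (\<psi> (a * M n) t))
      = (\<Sum>a<m n. (vil_r m n x * cnj (vil_r m n t)) ^ a)"
    by (intro sum.cong) (auto simp: psi_mult_M power_mult_distrib)
  also have "\<dots> = (if x n = t n then of_nat (m n) else 0)"
    using assms by (intro sum_r) (auto simp: mem_vil_group)
  finally show ?case using Suc by (auto simp: agree_def lessThan_Suc)
qed (simp add: dirichlet_def agree_def psi_prod[of 0 0])

text \<open>The kernel of order \<open>M (Suc s)\<close> vanishes when the points differ in
  coordinate \<open>s\<close>, so all full blocks drop out and only the remainder survives. This
  gives the upper bound \<open>norm_dirichlet\<close> and, for \<open>s = 0\<close>, the exact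
  modulus 1 needed for the divergence.\<close>

lemma dirichlet_mod:
  assumes "x \<in> G" "t \<in> G" "x s \<noteq> t s"
  shows "dirichlet n x t = \<psi> (n div M (Suc s) * M (Suc s)) x * cnj (\<psi> (n div M (Suc s) * M (Suc s)) t)
     * dirichlet (n mod M (Suc s)) x t"
proof -
  have "dirichlet (M (Suc s)) x t = 0" using assms(3) by (auto simp: dirichlet_M[OF assms(1,2)] agree_def simp del: vil_M.simps)
  with dirichlet_blocks[of "n mod M (Suc s)" "Suc s" "n div M (Suc s)" x t] show ?thesis
    unfolding div_mult_mod_eq by (simp del: vil_M.simps)
qed

lemma norm_dirichlet_le: "norm (dirichlet n x t) \<le> n"
  unfolding dirichlet_def by (rule order_trans[OF norm_sum]) (simp add: norm_mult)

lemma norm_dirichlet: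
  assumes "x \<in> G" "t \<in> G" "x s \<noteq> t s"
  shows "norm (dirichlet n x t) \<le> M (Suc s)"
proof -
  have "norm (dirichlet n x t) = norm (dirichlet (n mod M (Suc s)) x t)"
    by (subst dirichlet_mod[OF assms]) (simp add: norm_mult)
  also have "\<dots> \<le> n mod M (Suc s)" by (rule norm_dirichlet_le)
  also have "\<dots> \<le> real (M (Suc s))" using M_pos[of "Suc s"] by (simp del: vil_M.simps M_pos add: less_imp_le)
  finally show ?thesis .
qed

text \<open>The kernels repeat with period \<open>P = M (Suc s)\<close> up to unimodular factors
  \<open>\<Psi> a\<close>. One period sums to at most \<open>P * P\<close>, and the difference in
  coordinate \<open>l\<close> controls the sum of the factors: \<open>P\<close> times its modulus is
  at most \<open>M (Suc l)\<close>. The second unit in the factor 2 pays for the incomplete last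
  period.\<close>

lemma norm_sum_dirichlet:
  assumes "x \<in> G" "t \<in> G" "x s \<noteq> t s" "x l \<noteq> t l" "s < l"
  shows "norm (\<Sum>n<k. dirichlet n x t) \<le> 2 * M (Suc s) * M (Suc l)"
proof -
  define P where "P = M (Suc s)"
  have P: "P > 0" by (simp add: P_def del: vil_M.simps)
  define Q where "Q = k div P"
  define \<Psi> where "\<Psi> a = \<psi> (a * P) x * cnj (\<psi> (a * P) t)" for a
  have nPsi: "norm (\<Psi> a) = 1" for a by (simp add: \<Psi>_def norm_mult)
  have blk: "dirichlet (a * P + r) x t = \<Psi> a * dirichlet r x t" if "r < P" for a r
    using dirichlet_mod[OF assms(1-3), of "a * P + r"] that by (simp add: \<Psi>_def P_def del: vil_M.simps)
  have part: "norm (\<Sum>r<c. dirichlet (a * P + r) x t) \<le> P * P" if "c \<le> P" for a c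
  proof -
    have "norm (\<Sum>r<c. dirichlet (a * P + r) x t) \<le> (\<Sum>r<c. real P)"
      using norm_dirichlet[OF assms(1-3)] by (intro sum_norm_le) (simp add: P_def del: vil_M.simps)
    also have "\<dots> \<le> P * P" using that by (simp add: mult_right_mono)
    finally show ?thesis .
  qed
  define F where "F = (\<Sum>r<P. dirichlet r x t)"
  have F: "norm F \<le> P * P" using part[of P 0] by (simp add: F_def)
  have full: "(\<Sum>n<q * P. dirichlet n x t) = (\<Sum>a<q. \<Psi> a) * F" for q
  proof (induction q)
    case (Suc q)
    have "(\<Sum>n<Suc q * P. dirichlet n x t) = (\<Sum>n<q * P. dirichlet n x t) + (\<Sum>r<P. dirichlet (q * P + r) x t)"
      unfolding mult_Suc add.commute[of P] by (rule sum_lessThan_add)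
    also have "(\<Sum>r<P. dirichlet (q * P + r) x t) = \<Psi> q * F"
      unfolding F_def sum_distrib_left by (intro sum.cong) (auto simp: blk)
    finally show ?case using Suc by (simp add: algebra_simps)
  qed simp
  have Psum: "norm (\<Sum>a<q. \<Psi> a) * P \<le> M (Suc l)" for q
  proof -
    \<comment> \<open>Moving the coordinates up to \<open>s\<close> of \<open>x\<close> onto those of \<open>t\<close> turns the sum into a Dirichlet kernel.\<close>
    define y where "y = (\<lambda>j. if j \<le> s then t j else x j)"
    have y: "y \<in> G" using assms(1,2) by (auto simp: y_def mem_vil_group)
    have "\<psi> (a * P) x = \<psi> (a * P) y" for a
      unfolding P_def by (rule psi_high) (auto simp: y_def)
    then have "dirichlet (q * P) y t = (\<Sum>a<q. \<Psi> a) * dirichlet P y t"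
      using dirichlet_blocks[of 0 "Suc s" q y t] by (simp add: \<Psi>_def P_def dirichlet_def[of 0] del: vil_M.simps)
    also have "dirichlet P y t = P"
      unfolding P_def by (subst dirichlet_M[OF y assms(2)]) (auto simp: agree_def y_def)
    finally have "norm (dirichlet (q * P) y t) = norm (\<Sum>a<q. \<Psi> a) * P" by (simp add: norm_mult)
    moreover have "norm (dirichlet (q * P) y t) \<le> M (Suc l)"
      using assms by (intro norm_dirichlet[OF y assms(2)]) (auto simp: y_def)
    ultimately show ?thesis by simp
  qed
  have PM: "P \<le> M (Suc l)" unfolding P_def using assms(5) by (intro M_mono) simp
  have "(\<Sum>n<k. dirichlet n x t) = (\<Sum>n<Q * P. dirichlet n x t) + (\<Sum>r<k mod P. dirichlet (Q * P + r) x t)"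
    using sum_lessThan_add[of "\<lambda>n. dirichlet n x t" "Q * P" "k mod P"] by (simp add: Q_def)
  then have "norm (\<Sum>n<k. dirichlet n x t) \<le> norm ((\<Sum>a<Q. \<Psi> a) * F) + P * P"
    using part[of "k mod P" Q] P full[of Q] norm_triangle_ineq[of "\<Sum>n<Q * P. dirichlet n x t" "\<Sum>r<k mod P. dirichlet (Q * P + r) x t"]
    by (simp add: less_imp_le)
  also have "norm ((\<Sum>a<Q. \<Psi> a) * F) \<le> norm (\<Sum>a<Q. \<Psi> a) * (P * P)"
    unfolding norm_mult using F by (intro mult_left_mono) auto
  also have "norm (\<Sum>a<Q. \<Psi> a) * (P * P) \<le> M (Suc l) * P"
    using mult_right_mono[OF Psum[of Q], of "real P"] by (simp add: mult_ac)
  also have "real (P * P) \<le> M (Suc l) * P" using PM by (simp add: mult_right_mono flip: of_nat_mult)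
  finally show ?thesis by (simp add: P_def mult_ac del: vil_M.simps)
qed

section \<open>Fourier expansions\<close>

lemma level_psi: "n \<le> N \<Longrightarrow> level N (\<psi> n)"
  by (rule level_mono[OF psi_level[OF M_gt]])

lemma integral_agree_I_complex:
  assumes "z \<in> G"
  shows "(\<integral>x. of_bool (agree {..<n} z x) \<partial>\<mu>) = 1 / complex_of_nat (M n)"
proof -
  have "(\<integral>x. of_bool (agree {..<n} z x) \<partial>\<mu>) = (\<integral>x. complex_of_real (of_bool (agree {..<n} z x)) \<partial>\<mu>)"
    by (intro Bochner_Integration.integral_cong) auto
  also have "\<dots> = complex_of_real (\<integral>x. of_bool (agree {..<n} z x) \<partial>\<mu>)"
    by (rule integral_complex_of_real)
  finally show ?thesis using integral_agree_I[OF assms] by simp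
qed

lemma S_kernel:
  assumes "level N h"
  shows "vil_S m n h x = (\<integral>t. h t * dirichlet n x t \<partial>\<mu>)"
proof -
  have int: "integrable \<mu> (\<lambda>t. h t * cnj (\<psi> k t))" if "k < n" for k
    using that assms
    by (intro level_integrable[of "max N n"] level_comp2[where F="\<lambda>a b. a * cnj b"] level_psi) (auto intro: level_mono)
  have "vil_S m n h x = (\<Sum>k<n. (\<integral>t. h t * cnj (\<psi> k t) * \<psi> k x \<partial>\<mu>))"
    unfolding vil_S_def vil_coeff_def by simp
  also have "\<dots> = (\<integral>t. (\<Sum>k<n. h t * cnj (\<psi> k t) * \<psi> k x) \<partial>\<mu>)"
    using int by (intro Bochner_Integration.integral_sum[symmetric]) auto
  also have "\<dots> = (\<integral>t. h t * dirichlet n x t \<partial>\<mu>)"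
    unfolding dirichlet_def sum_distrib_left
    by (intro Bochner_Integration.integral_cong refl sum.cong) (auto simp: mult_ac)
  finally show ?thesis .
qed

text \<open>The kernel of order \<open>M n\<close> averages over the coset of level \<open>n\<close>
  around \<open>x\<close>, on which \<open>h\<close> is constant.\<close>

lemma S_level_eq:
  assumes "level n h" "x \<in> G"
  shows "vil_S m (M n) h x = h x"
proof -
  have "vil_S m (M n) h x = (\<integral>t. h x * of_nat (M n) * of_bool (agree {..<n} x t) \<partial>\<mu>)"
    unfolding S_kernel[OF assms(1)]
  proof (intro Bochner_Integration.integral_cong refl)
    fix t assume "t \<in> space \<mu>"
    then have "dirichlet (M n) x t = of_nat (M n) * of_bool (agree {..<n} t x)"
      using assms(2) by (intro dirichlet_M) auto
    moreover have "agree {..<n} t x \<longleftrightarrow> agree {..<n} x t" by (auto simp: agree_def)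
    moreover have "h t = h x" if "agree {..<n} x t"
      using that by (intro levelD[OF assms(1)]) (auto simp: agree_def)
    ultimately show "h t * dirichlet (M n) x t = h x * of_nat (M n) * of_bool (agree {..<n} x t)" by auto
  qed
  also have "\<dots> = h x" using assms(2) by (simp add: integral_agree_I_complex)
  finally show ?thesis .
qed

text \<open>The kernel \<open>D\<close> of order \<open>M\<^sub>N\<close> reproduces \<open>\<psi>\<^sub>j\<close>, so \<open>\<psi>\<^sub>j = \<Sum>\<^sub>k g\<^sub>k\<^sub>j \<psi>\<^sub>k\<close> with the Gram matrix \<open>g\<close>;
  integrating against \<open>\<psi>\<^sub>j\<close> gives \<open>1 = \<Sum>\<^sub>k |g\<^sub>k\<^sub>j|\<^sup>2\<close>, where the diagonal term is already \<open>1\<close>.\<close>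

lemma orthonormal: "(\<integral>t. \<psi> i t * cnj (\<psi> j t) \<partial>\<mu>) = of_bool (i = j)"
proof -
  define N where "N = max i j"
  have N: "i < M N" "j < M N" using M_gt[of N] by (auto simp: N_def)
  define g where "g k l = (\<integral>t. \<psi> l t * cnj (\<psi> k t) \<partial>\<mu>)" for k l
  have int: "integrable \<mu> (\<lambda>t. \<psi> l t * cnj (\<psi> k t))" for k l
    by (rule level_integrable[of "max k l"]) (auto intro!: level_comp2[where F="\<lambda>a b. a * cnj b"] level_psi)
  have g1: "g k k = 1" for k
  proof -
    have "\<psi> k t * cnj (\<psi> k t) = 1" for t by (simp flip: complex_norm_square)
    then show ?thesis by (simp add: g_def haar.prob_space[simplified])
  qed
  have gc: "g k l = cnj (g l k)" for k l
    unfolding g_def by (subst Bochner_Integration.integral_cnj[symmetric]) (auto simp: mult_ac)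
  have "g j j = (\<integral>t. (\<Sum>k<M N. g k j * \<psi> k t) * cnj (\<psi> j t) \<partial>\<mu>)"
    unfolding g_def[of j j]
  proof (intro Bochner_Integration.integral_cong refl)
    fix t assume "t \<in> space \<mu>"
    then have "\<psi> j t = vil_S m (M N) (\<psi> j) t"
      using psi_level[OF N(2)] by (simp add: S_level_eq)
    then show "\<psi> j t * cnj (\<psi> j t) = (\<Sum>k<M N. g k j * \<psi> k t) * cnj (\<psi> j t)"
      by (simp add: vil_S_def vil_coeff_def g_def)
  qed
  also have "\<dots> = (\<integral>t. (\<Sum>k<M N. g k j * (\<psi> k t * cnj (\<psi> j t))) \<partial>\<mu>)"
    by (simp add: sum_distrib_right mult.assoc)
  also have "\<dots> = (\<Sum>k<M N. g k j * g j k)"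
    by (subst Bochner_Integration.integral_sum) (auto simp: int g_def)
  also have "\<dots> = (\<Sum>k<M N. complex_of_real ((norm (g k j))\<^sup>2))"
    by (intro sum.cong refl, subst (2) gc) (simp only: complex_norm_square)
  finally have "complex_of_real 1 = complex_of_real (\<Sum>k<M N. (norm (g k j))\<^sup>2)" by (simp add: g1)
  then have one: "1 = (\<Sum>k<M N. (norm (g k j))\<^sup>2)" by (simp only: of_real_eq_iff)
  also have "\<dots> = (norm (g j j))\<^sup>2 + (\<Sum>k\<in>{..<M N} - {j}. (norm (g k j))\<^sup>2)"
    using N by (subst sum.remove[of _ j]) auto
  finally have zero: "(\<Sum>k\<in>{..<M N} - {j}. (norm (g k j))\<^sup>2) = 0" by (simp add: g1)
  show ?thesis
  proof (cases "i = j")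
    case True then show ?thesis using g1[of j] by (simp add: g_def)
  next
    case False
    with zero N have "(norm (g i j))\<^sup>2 = 0"
      by (subst (asm) sum_nonneg_eq_0_iff) auto
    then have "g j i = 0" using gc[of j i] by simp
    then show ?thesis using False by (simp add: g_def)
  qed
qed

lemma coeff_poly:
  "vil_coeff m (\<lambda>x. \<Sum>k<n. c k * \<psi> k x) i = (if i < n then c i else 0)"
proof -
  have int: "integrable \<mu> (\<lambda>t. \<psi> l t * cnj (\<psi> k t))" for k l
    by (rule level_integrable[of "max k l"]) (auto intro!: level_comp2[where F="\<lambda>a b. a * cnj b"] level_psi)
  have "vil_coeff m (\<lambda>x. \<Sum>k<n. c k * \<psi> k x) i = (\<integral>x. (\<Sum>k<n. c k * (\<psi> k x * cnj (\<psi> i x))) \<partial>\<mu>)"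
    unfolding vil_coeff_def by (simp add: sum_distrib_right mult.assoc)
  also have "\<dots> = (\<Sum>k<n. c k * of_bool (k = i))"
    by (subst Bochner_Integration.integral_sum) (auto simp: int orthonormal)
  also have "\<dots> = (if i < n then c i else 0)" by (simp add: of_bool_def if_distrib sum.delta cong: if_cong)
  finally show ?thesis .
qed

text \<open>Parseval: only the conjugate factor of the square is expanded, so that
  \<open>coeff_poly\<close> evaluates the remaining integrals.\<close>

lemma norm2_poly:
  "(\<integral>x. (norm (\<Sum>k<n. c k * \<psi> k x))\<^sup>2 \<partial>\<mu>) = (\<Sum>k<n. (norm (c k))\<^sup>2)"
proof -
  let ?h = "\<lambda>x. \<Sum>k<n. c k * \<psi> k x"
  have level: "level n ?h"
    by (rule level_sum, rule level_comp[OF level_psi]) simp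
  have int: "integrable \<mu> (\<lambda>t. ?h t * cnj (\<psi> k t))" if "k < n" for k
    using that by (intro level_integrable[of n] level_comp2[where F="\<lambda>a b. a * cnj b", OF level] level_psi) auto
  have "complex_of_real (\<integral>x. (norm (?h x))\<^sup>2 \<partial>\<mu>) = (\<integral>x. ?h x * cnj (?h x) \<partial>\<mu>)"
    by (subst integral_complex_of_real[symmetric]) (simp only: complex_norm_square)
  also have "\<dots> = (\<integral>x. (\<Sum>k<n. cnj (c k) * (?h x * cnj (\<psi> k x))) \<partial>\<mu>)"
    by (simp add: sum_distrib_left mult_ac)
  also have "\<dots> = (\<Sum>k<n. cnj (c k) * vil_coeff m ?h k)"
    unfolding vil_coeff_def using int by (subst Bochner_Integration.integral_sum) auto
  also have "\<dots> = (\<Sum>k<n. complex_of_real ((norm (c k))\<^sup>2))"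
    unfolding coeff_poly complex_norm_square by (intro sum.cong refl) simp
  finally have "complex_of_real (\<integral>x. (norm (?h x))\<^sup>2 \<partial>\<mu>) = complex_of_real (\<Sum>k<n. (norm (c k))\<^sup>2)"
    by simp
  then show ?thesis by (simp only: of_real_eq_iff)
qed

lemma coeff_cong: "(\<And>x. x \<in> G \<Longrightarrow> h x = k x) \<Longrightarrow> vil_coeff m h i = vil_coeff m k i"
  unfolding vil_coeff_def by (intro Bochner_Integration.integral_cong) auto

lemma coeff_sum:
  assumes "\<And>a. a \<in> A \<Longrightarrow> level N (h a)"
  shows "vil_coeff m (\<lambda>x. \<Sum>a\<in>A. h a x) i = (\<Sum>a\<in>A. vil_coeff m (h a) i)"
  unfolding vil_coeff_def sum_distrib_right using assms
  by (intro Bochner_Integration.integral_sum level_integrable[of "max N i"]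
        level_comp2[where F="\<lambda>a b. a * cnj b"] level_psi) (auto intro!: level_mono[OF assms])

text \<open>Partial sums up to \<open>M\<^sub>n\<close> are conditional expectations on \<open>\<F>\<^sub>n\<close>.\<close>

lemma S_M_adjoint:
  assumes "level N h" "level n u"
  shows "(\<integral>x. vil_S m (M n) h x * u x \<partial>\<mu>) = (\<integral>x. h x * u x \<partial>\<mu>)"
proof -
  let ?L = "max N (max n (M n))"
  have l: "level ?L h" "level ?L u" "\<And>k. k < M n \<Longrightarrow> level ?L (\<psi> k)"
    using assms by (auto intro: level_mono level_psi)
  have int1: "integrable \<mu> (\<lambda>x. \<psi> k x * u x)" if "k < M n" for k
    by (rule level_integrable[OF level_comp2[where F="(*)", OF l(3)[OF that] l(2)]])
  have int2: "integrable \<mu> (\<lambda>x. h x * cnj (\<psi> k x))" if "k < M n" for k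
    by (rule level_integrable[OF level_comp2[where F="\<lambda>a b. a * cnj b", OF l(1) l(3)[OF that]]])
  define b where "b k = (\<integral>x. \<psi> k x * u x \<partial>\<mu>)" for k
  have bc: "b k = cnj (vil_coeff m (\<lambda>x. cnj (u x)) k)" for k
    unfolding b_def vil_coeff_def Bochner_Integration.integral_cnj[symmetric] by (simp add: mult.commute)
  have "(\<integral>x. vil_S m (M n) h x * u x \<partial>\<mu>) = (\<integral>x. (\<Sum>k<M n. vil_coeff m h k * (\<psi> k x * u x)) \<partial>\<mu>)"
    by (simp add: vil_S_def sum_distrib_right mult.assoc)
  also have "\<dots> = (\<Sum>k<M n. vil_coeff m h k * b k)"
    unfolding b_def by (subst Bochner_Integration.integral_sum) (auto simp: int1)
  also have "\<dots> = (\<Sum>k<M n. (\<integral>x. h x * cnj (\<psi> k x) * b k \<partial>\<mu>))"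
    by (simp add: vil_coeff_def)
  also have "\<dots> = (\<integral>x. (\<Sum>k<M n. h x * cnj (\<psi> k x) * b k) \<partial>\<mu>)"
    using int2 by (intro Bochner_Integration.integral_sum[symmetric] integrable_mult_left) auto
  also have "\<dots> = (\<integral>x. h x * u x \<partial>\<mu>)"
  proof (intro Bochner_Integration.integral_cong refl)
    fix x assume "x \<in> space \<mu>"
    then have "cnj (vil_S m (M n) (\<lambda>x. cnj (u x)) x) = u x"
      using level_comp[OF assms(2)] by (subst S_level_eq) auto
    then have "(\<Sum>k<M n. cnj (\<psi> k x) * b k) = u x"
      by (simp add: vil_S_def bc mult_ac)
    then show "(\<Sum>k<M n. h x * cnj (\<psi> k x) * b k) = h x * u x"
      by (simp add: mult.assoc flip: sum_distrib_left)
  qed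
  finally show ?thesis .
qed

text \<open>This is \<open>k\<close> times the Fejer mean, for a function instead of a martingale.
  Without the division by \<open>k\<close> the kernel bounds for sums of Dirichlet kernels apply
  directly.\<close>

definition fejer_total :: "nat \<Rightarrow> ((nat \<Rightarrow> nat) \<Rightarrow> complex) \<Rightarrow> (nat \<Rightarrow> nat) \<Rightarrow> complex" where
  "fejer_total k h x = (\<Sum>l=1..k. vil_S m l h x)"

lemma fejer_total_cong: "(\<And>x. x \<in> G \<Longrightarrow> h x = g x) \<Longrightarrow> fejer_total k h = fejer_total k g"
  unfolding fejer_total_def vil_S_def using coeff_cong[of h g] by (simp add: fun_eq_iff)

lemma fejer_total_sum:
  assumes "\<And>a. a \<in> A \<Longrightarrow> level N (h a)"
  shows "fejer_total k (\<lambda>x. \<Sum>a\<in>A. h a x) x = (\<Sum>a\<in>A. fejer_total k (h a) x)"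
proof -
  have "vil_S m l (\<lambda>x. \<Sum>a\<in>A. h a x) x = (\<Sum>a\<in>A. vil_S m l (h a) x)" for l
    by (simp add: vil_S_def coeff_sum[OF assms] sum_distrib_right sum.swap[of _ A])
  then show ?thesis unfolding fejer_total_def by (simp add: sum.swap[of _ A])
qed

lemma fejer_total_zero: "(\<And>i. i < k \<Longrightarrow> vil_coeff m h i = 0) \<Longrightarrow> fejer_total k h x = 0"
  unfolding fejer_total_def vil_S_def by (intro sum.neutral ballI) auto

text \<open>The weight \<open>k - i\<close> counts the partial sums of order at most
  \<open>k\<close> that contain the \<open>i\<close>-th term.\<close>

lemma fejer_total_poly: "fejer_total k h x = (\<Sum>i<k. of_nat (k - i) * vil_coeff m h i * \<psi> i x)"
proof (induction k)
  case (Suc k)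
  have "fejer_total (Suc k) h x = fejer_total k h x + vil_S m (Suc k) h x" by (simp add: fejer_total_def)
  also have "\<dots> = (\<Sum>i<k. of_nat (k - i) * vil_coeff m h i * \<psi> i x + vil_coeff m h i * \<psi> i x)
      + vil_coeff m h k * \<psi> k x"
    by (simp add: Suc vil_S_def sum.distrib)
  also have "\<dots> = (\<Sum>i<Suc k. of_nat (Suc k - i) * vil_coeff m h i * \<psi> i x)"
    by (simp add: Suc_diff_le less_imp_le algebra_simps)
  finally show ?case .
qed (simp add: fejer_total_def)

lemma fejer_total_level: "level k (fejer_total k h)"
  unfolding fejer_total_poly[abs_def] by (rule level_sum, rule level_comp[OF level_psi]) simp

lemma fejer_total_kernel:
  assumes "level N h"
  shows "fejer_total k h x = (\<integral>t. h t * (\<Sum>l<Suc k. dirichlet l x t) \<partial>\<mu>)"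
proof -
  have D: "level (max N l) (\<lambda>t. h t * dirichlet l x t)" for l
  proof (rule level_comp2[where F="(*)", OF level_mono[OF assms]])
    show "level (max N l) (dirichlet l x)"
      unfolding dirichlet_def[abs_def] by (rule level_sum, rule level_comp[OF level_psi]) simp
  qed simp
  \<comment> \<open>The kernel of order 0 is zero; including it gives the initial segment for which
    the kernel sums are estimated.\<close>
  have "{..<Suc k} = insert 0 {1..k}" by auto
  then have "(\<Sum>l<Suc k. dirichlet l x t) = (\<Sum>l=1..k. dirichlet l x t)" for t by (simp add: dirichlet_def[of 0])
  then have "(\<integral>t. h t * (\<Sum>l<Suc k. dirichlet l x t) \<partial>\<mu>) = (\<integral>t. (\<Sum>l=1..k. h t * dirichlet l x t) \<partial>\<mu>)"
    by (simp only: sum_distrib_left)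
  also have "\<dots> = (\<Sum>l=1..k. (\<integral>t. h t * dirichlet l x t \<partial>\<mu>))"
    by (intro Bochner_Integration.integral_sum level_integrable[OF D])
  finally show ?thesis by (simp add: fejer_total_def S_kernel[OF assms])
qed

text \<open>Averaging multiplies the coefficients by \<open>(k - i) / k\<close>, which lies between
  0 and 1, so Parseval for both sides suffices. \<open>L\<close> is large enough for
  \<open>h\<close> to coincide with its partial sum of order \<open>M L\<close>.\<close>

lemma fejer_total_L2:
  assumes "level N h"
  shows "(\<integral>x. (norm (fejer_total k h x / of_nat k))\<^sup>2 \<partial>\<mu>) \<le> (\<integral>x. (norm (h x))\<^sup>2 \<partial>\<mu>)"
proof -
  define L where "L = max N k"
  have "(\<integral>x. (norm (fejer_total k h x / of_nat k))\<^sup>2 \<partial>\<mu>)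
      = (\<integral>x. (norm (\<Sum>i<k. (of_nat (k - i) / of_nat k * vil_coeff m h i) * \<psi> i x))\<^sup>2 \<partial>\<mu>)"
    by (simp add: fejer_total_poly sum_divide_distrib)
  also have "\<dots> = (\<Sum>i<k. (norm (of_nat (k - i) / of_nat k * vil_coeff m h i))\<^sup>2)"
    by (rule norm2_poly)
  also have "\<dots> \<le> (\<Sum>i<k. (norm (vil_coeff m h i))\<^sup>2)"
  proof (intro sum_mono power_mono)
    fix i assume "i \<in> {..<k}"
    then have "norm (of_nat (k - i) / of_nat k :: complex) \<le> 1"
      unfolding norm_divide norm_of_nat by simp
    then show "norm (of_nat (k - i) / of_nat k * vil_coeff m h i) \<le> norm (vil_coeff m h i)"
      unfolding norm_mult by (intro mult_left_le_one_le) auto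
  qed simp
  also have "\<dots> \<le> (\<Sum>i<M L. (norm (vil_coeff m h i))\<^sup>2)"
    using M_gt[of L] by (intro sum_mono2) (auto simp: L_def)
  also have "\<dots> = (\<integral>x. (norm (vil_S m (M L) h x))\<^sup>2 \<partial>\<mu>)"
    unfolding vil_S_def norm2_poly ..
  also have "\<dots> = (\<integral>x. (norm (h x))\<^sup>2 \<partial>\<mu>)"
    using level_mono[OF assms, of L] by (intro Bochner_Integration.integral_cong) (auto simp: S_level_eq L_def)
  finally show ?thesis .
qed

end

section \<open>Pointwise kernel estimates\<close>

text \<open>For two summands, divide by their sum \<open>?w\<close> and use
  \<open>y \<le> y powr p\<close> on the unit interval.\<close>

lemma powr_sum_le:
  fixes f :: "'a \<Rightarrow> real"
  assumes "0 < p" "p \<le> 1" "finite A" "\<And>a. a \<in> A \<Longrightarrow> 0 \<le> f a"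
  shows "(\<Sum>a\<in>A. f a) powr p \<le> (\<Sum>a\<in>A. f a powr p)"
  using assms(3,4)
proof (induction A rule: finite_induct)
  case (insert a A)
  have two: "(u + v) powr p \<le> u powr p + v powr p" if "0 \<le> u" "0 \<le> v" for u v :: real
  proof (cases "u + v = 0")
    case False
    let ?w = "u + v"
    have w: "?w > 0" using that False by simp
    have "y \<le> y powr p" if "0 \<le> y" "y \<le> 1" for y :: real
      using that assms powr_mono'[of p 1 y] by simp
    from this[of "u / ?w"] this[of "v / ?w"] have "u / ?w + v / ?w \<le> (u / ?w) powr p + (v / ?w) powr p"
      using that w by (intro add_mono) auto
    also have "\<dots> = (u powr p + v powr p) / ?w powr p" using that w by (simp add: powr_divide add_divide_distrib)
    finally show ?thesis using w by (simp add: field_simps flip: add_divide_distrib)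
  qed (use that in auto)
  have "sum f (insert a A) powr p = (f a + sum f A) powr p" using insert by simp
  also have "\<dots> \<le> f a powr p + sum f A powr p" using insert by (intro two sum_nonneg) auto
  also have "\<dots> \<le> f a powr p + (\<Sum>a\<in>A. f a powr p)" using insert by auto
  finally show ?case using insert by simp
qed simp

lemma sum_powr_tail:
  fixes r :: real
  assumes "1 < r" "1 \<le> a" "a \<le> K"
  shows "(\<Sum>k=a..K. real k powr (-r)) \<le> (1 + 1 / (r - 1)) * real a powr (1 - r)"
proof -
  have step: "(r - 1) * real (Suc k) powr (-r) \<le> real k powr (1 - r) - real (Suc k) powr (1 - r)" if "1 \<le> k" for k
  proof -
    have "\<exists>z. real k < z \<and> z < real (Suc k) \<and>
        real (Suc k) powr (1 - r) - real k powr (1 - r) = (real (Suc k) - real k) * ((1 - r) * z powr (1 - r - 1))"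
      using that by (intro MVT2 has_real_derivative_powr) auto
    then obtain z where z: "real k < z" "z < real (Suc k)"
      "real (Suc k) powr (1 - r) - real k powr (1 - r) = (1 - r) * z powr (-r)" by auto
    have "real (Suc k) powr (-r) \<le> z powr (-r)" using z(1,2) assms by (intro powr_mono2') auto
    then have "(r - 1) * real (Suc k) powr (-r) \<le> (r - 1) * z powr (-r)" using assms by (intro mult_left_mono) auto
    then show ?thesis using z(3) by (simp add: algebra_simps)
  qed
  \<comment> \<open>Subtracting the term in \<open>K\<close> turns the comparison with an integral
    into a telescoping induction; the leading 1 in the constant pays for
    \<open>k = a\<close>.\<close>
  have "(\<Sum>k=a..K. real k powr (-r)) \<le> (1 + 1 / (r - 1)) * real a powr (1 - r) - 1 / (r - 1) * real K powr (1 - r)"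
    using assms(3)
  proof (induction K rule: dec_induct)
    case base
    have "real a powr (-r) \<le> real a powr (1 - r)" using assms by (intro powr_mono) auto
    then show ?case by (simp add: algebra_simps)
  next
    case (step K)
    have "real (Suc K) powr (-r) \<le> 1 / (r - 1) * (real K powr (1 - r) - real (Suc K) powr (1 - r))"
      using step.hyps assms \<open>\<And>k. 1 \<le> k \<Longrightarrow> _\<close>[of K] by (simp add: field_simps)
    then show ?case using step by (simp add: right_diff_distrib del: of_nat_Suc)
  qed
  also have "\<dots> \<le> (1 + 1 / (r - 1)) * real a powr (1 - r)" using assms by simp
  finally show ?thesis .
qed

context vilenkin begin

section \<open>Growth of the numbers \<open>M k\<close> and geometric sums\<close>

lemma M_Suc_ge: "2 * real (M k) \<le> real (M (Suc k))"
proof -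
  have "real (2 * M k) \<le> real (m k * M k)" by (intro of_nat_mono mult_right_mono m_ge) simp
  then show ?thesis by simp
qed

declare vil_M.simps(2) [simp del]

lemma M_Suc_le: "real (M (Suc k)) \<le> real B * real (M k)"
  using m_le[of k] by (simp add: vil_M.simps(2) mult_right_mono)

lemma M_ge_1: "1 \<le> real (M k)"
  using M_pos[of k] by (simp add: Suc_leI del: M_pos)

lemma B_ge: "2 \<le> real B"
  using m_ge[of 0] m_le[of 0] by simp

text \<open>The constant \<open>c\<close> solves \<open>c + 1 = c * 2 powr p\<close>, so the
  induction closes because \<open>M l\<close> at least doubles in each step.\<close>

lemma sum_M_powr:
  assumes "0 < p"
  shows "(\<Sum>s<l. real (M s) powr p) \<le> 1 / (2 powr p - 1) * real (M l) powr p"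
proof (induction l)
  case (Suc l)
  have g: "1 < (2::real) powr p" using assms by simp
  have "(\<Sum>s<Suc l. real (M s) powr p) \<le> 1 / (2 powr p - 1) * real (M l) powr p + real (M l) powr p"
    using Suc by (simp del: vil_M.simps)
  also have "\<dots> = 1 / (2 powr p - 1) * (2 * real (M l)) powr p"
  proof -
    have "2 powr p - 1 \<noteq> 0" using assms by simp
    then show ?thesis by (simp add: powr_mult divide_simps algebra_simps)
  qed
  also have "\<dots> \<le> 1 / (2 powr p - 1) * real (M (Suc l)) powr p"
    using less_imp_le[OF g] assms M_Suc_ge[of l]
    by (intro mult_left_mono powr_mono2) (auto simp del: vil_M.simps)
  finally show ?case .
qed (use assms in \<open>simp add: ge_one_powr_ge_zero\<close>)

lemma sum_M_powr_neg:
  assumes "q < 0"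
  shows "(\<Sum>l<n. real (M l) powr q) \<le> 1 / (1 - 2 powr q)"
proof -
  have g: "(2::real) powr q < 1" using assms by (simp add: powr_less_one)
  have "(2::real) ^ l \<le> real (M l)" for l
  proof (induction l)
    case (Suc l)
    then show ?case unfolding power_Suc using M_Suc_ge[of l] by linarith
  qed simp
  then have "real (M l) powr q \<le> (2 ^ l) powr q" for l using assms by (intro powr_mono2') auto
  also have "(2 ^ l) powr q = (2 powr q) ^ l" for l
    by (simp add: powr_powr mult.commute flip: powr_realpow)
  finally have "(\<Sum>l<n. real (M l) powr q) \<le> (\<Sum>l<n. (2 powr q) ^ l)" by (rule sum_mono)
  also have "\<dots> = (1 - (2 powr q) ^ n) / (1 - 2 powr q)" using g assms by (simp add: sum_gp_strict)
  also have "\<dots> \<le> 1 / (1 - 2 powr q)" using g by (intro divide_right_mono) auto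
  finally show ?thesis .
qed

lemma integral_mono_level:
  fixes f g :: "(nat \<Rightarrow> nat) \<Rightarrow> real"
  assumes "level n f" "level k g" "\<And>x. x \<in> G \<Longrightarrow> f x \<le> g x"
  shows "(\<integral>x. f x \<partial>\<mu>) \<le> (\<integral>x. g x \<partial>\<mu>)"
  using assms level_integrable by (intro integral_mono) auto

text \<open>The kernel representation integrates only over the coset carrying \<open>a\<close>,
  whose measure is \<open>1 / M n\<close>; hence a uniform kernel bound on that coset is
  enough.\<close>

lemma norm_fejer_total_le:
  assumes a: "level N a" "z \<in> G" "0 \<le> lam" "\<And>x. x \<in> G \<Longrightarrow> norm (a x) \<le> lam"
    "\<And>x. x \<in> G \<Longrightarrow> \<not> agree {..<n} z x \<Longrightarrow> a x = 0"
    and bd: "\<And>t. t \<in> G \<Longrightarrow> agree {..<n} z t \<Longrightarrow> norm (\<Sum>l<Suc k. dirichlet l x t) \<le> Bd" and "0 \<le> Bd"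
  shows "norm (fejer_total k a x) \<le> lam / M n * Bd"
proof -
  have "norm (fejer_total k a x) \<le> (\<integral>t. norm (a t * (\<Sum>l<Suc k. dirichlet l x t)) \<partial>\<mu>)"
    unfolding fejer_total_kernel[OF a(1)] by (rule integral_norm_bound)
  also have "\<dots> \<le> (\<integral>t. lam * Bd * of_bool (agree {..<n} z t) \<partial>\<mu>)"
  proof (rule integral_mono_level)
    have "level (Suc k) (\<lambda>t. \<Sum>l<Suc k. dirichlet l x t)"
      unfolding dirichlet_def by (rule level_sum, rule level_sum, rule level_comp[OF level_psi]) simp
    then have "level (max N (Suc k)) (\<lambda>t. \<Sum>l<Suc k. dirichlet l x t)" by (rule level_mono) simp
    then show "level (max N (Suc k)) (\<lambda>t. norm (a t * (\<Sum>l<Suc k. dirichlet l x t)))"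
      by (intro level_comp2[where F="\<lambda>a b. norm (a * b)"] level_mono[OF a(1)]) auto
    show "level n (\<lambda>t. lam * Bd * of_bool (agree {..<n} z t))"
      by (intro level_comp[where F="\<lambda>b. lam * Bd * of_bool b"] level_agree) simp
    show "norm (a t * (\<Sum>l<Suc k. dirichlet l x t)) \<le> lam * Bd * of_bool (agree {..<n} z t)" if "t \<in> G" for t
    proof (cases "agree {..<n} z t")
      case True
      then show ?thesis unfolding norm_mult using a(3) a(4)[of t] bd[of t] that by (simp add: mult_mono del: sum.lessThan_Suc)
    qed (use a(5) that in simp)
  qed
  also have "\<dots> = lam / M n * Bd" by (simp add: integral_agree_I[OF a(2)])
  finally show ?thesis .
qed

text \<open>Off the support of the atom: \<open>s\<close> is the first coordinate in which \<open>x\<close> differs from the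
  centre \<open>z\<close>, and \<open>l\<close> the second one, if it is below \<open>n\<close>.\<close>

lemma norm_fejer_total_off:
  assumes a: "level N a" "z \<in> G" "0 < lam" "\<And>x. x \<in> G \<Longrightarrow> norm (a x) \<le> lam"
    "\<And>x. x \<in> G \<Longrightarrow> \<not> agree {..<n} z x \<Longrightarrow> a x = 0"
    and p: "0 < p" and x: "x \<in> G" "\<not> agree {..<n} z x" and k: "1 \<le> k"
  shows "norm (fejer_total k a x) powr p \<le> (lam / M n) powr p *
    ((\<Sum>l<n. \<Sum>s<l. of_bool (agree ({..<l} - {s}) z x) * (2 * real (M (Suc s)) * real (M (Suc l))) powr p) +
     (\<Sum>s<n. of_bool (agree ({..<n} - {s}) z x) * (2 * real k * real (M (Suc s))) powr p))"
    (is "_ \<le> _ * (?A + ?C)")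
proof -
  have a3: "0 \<le> lam" using a(3) by simp
  define s where "s = (LEAST s. x s \<noteq> z s)"
  obtain j where j: "j < n" "x j \<noteq> z j" using x(2) by (auto simp: agree_def)
  have s: "x s \<noteq> z s" unfolding s_def using j(2) by (rule LeastI)
  have sl: "x i = z i" if "i < s" for i using not_less_Least[OF that[unfolded s_def]] by simp
  have sn: "s < n" using sl[of j] j by (cases "s < n") auto
  have nnA: "0 \<le> ?A" "0 \<le> ?C" by (intro sum_nonneg mult_nonneg_nonneg; simp)+
  have ts: "x s \<noteq> t s" if "agree {..<n} z t" for t using s sn that by (simp add: agree_def)
  \<comment> \<open>For a given \<open>x\<close> a single nonnegative summand of
    \<open>?A + ?C\<close> is enough. Adding up all of them makes the bound independent of the
    choice of \<open>s\<close> and \<open>l\<close>, so that it can be integrated term by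
    term.\<close>
  have key: ?thesis if bd: "norm (fejer_total k a x) \<le> lam / M n * b" "0 \<le> b" "b powr p \<le> ?A + ?C" for b
  proof -
    have "norm (fejer_total k a x) powr p \<le> (lam / M n * b) powr p" using bd p by (intro powr_mono2) auto
    also have "\<dots> = (lam / M n) powr p * b powr p" by (rule powr_mult)
    also have "\<dots> \<le> (lam / M n) powr p * (?A + ?C)" using bd(3) by (intro mult_left_mono) auto
    finally show ?thesis .
  qed
  show ?thesis
  proof (cases "\<exists>l. s < l \<and> l < n \<and> x l \<noteq> z l")
    case True
    define l where "l = (LEAST l. s < l \<and> x l \<noteq> z l)"
    obtain l' where l': "s < l'" "x l' \<noteq> z l'" "l' < n" using True by auto
    have l: "s < l" "x l \<noteq> z l" using LeastI[of "\<lambda>l. s < l \<and> x l \<noteq> z l" l'] l' by (auto simp: l_def)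
    have ln: "l < n" using Least_le[of "\<lambda>l. s < l \<and> x l \<noteq> z l" l'] l' by (simp add: l_def)
    have ll: "x i = z i" if "i < l" "i \<noteq> s" for i
      using not_less_Least[OF that(1)[unfolded l_def]] sl[of i] that(2) by (cases "i < s") auto
    let ?b = "2 * real (M (Suc s)) * real (M (Suc l))"
    show ?thesis
    proof (rule key)
      show "norm (fejer_total k a x) \<le> lam / M n * ?b"
      proof (rule norm_fejer_total_le[OF a(1,2) a3 a(4,5)])
        fix t assume t: "t \<in> G" "agree {..<n} z t"
        then have "x l \<noteq> t l" using l ln by (simp add: agree_def)
        then show "norm (\<Sum>l<Suc k. dirichlet l x t) \<le> ?b"
          using norm_sum_dirichlet[OF x(1) t(1) ts[OF t(2)] _ l(1), of "Suc k"] by (simp del: sum.lessThan_Suc)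
      qed auto
      have "?b powr p \<le> (\<Sum>s<l. of_bool (agree ({..<l} - {s}) z x) * (2 * real (M (Suc s)) * real (M (Suc l))) powr p)"
        using l(1) ll member_le_sum[of s "{..<l}" "\<lambda>s. of_bool (agree ({..<l} - {s}) z x) * (2 * real (M (Suc s)) * real (M (Suc l))) powr p"]
        by (simp add: agree_def del: vil_M.simps)
      also have "\<dots> \<le> ?A"
        using ln by (intro member_le_sum[of l "{..<n}" "\<lambda>l. \<Sum>s<l. of_bool (agree ({..<l} - {s}) z x) * (2 * real (M (Suc s)) * real (M (Suc l))) powr p"])
          (auto intro!: sum_nonneg)
      also have "\<dots> \<le> ?A + ?C" using nnA by simp
      finally show "?b powr p \<le> ?A + ?C" .
    qed simp
  next
    case False
    then have ll: "x i = z i" if "i < n" "i \<noteq> s" for i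
      using sl[of i] that by (cases "i < s") auto
    let ?b = "2 * real k * real (M (Suc s))"
    show ?thesis
    proof (rule key)
      show "norm (fejer_total k a x) \<le> lam / M n * ?b"
      proof (rule norm_fejer_total_le[OF a(1,2) a3 a(4,5)])
        fix t assume t: "t \<in> G" "agree {..<n} z t"
        have "norm (\<Sum>l<Suc k. dirichlet l x t) \<le> (\<Sum>l<Suc k. real (M (Suc s)))"
          by (intro sum_norm_le norm_dirichlet x t ts)
        also have "\<dots> = real (Suc k) * real (M (Suc s))" by simp
        also have "\<dots> \<le> ?b" using k by (intro mult_right_mono) auto
        finally show "norm (\<Sum>l<Suc k. dirichlet l x t) \<le> ?b" .
      qed auto
      have "?b powr p \<le> ?C"
        using sn ll member_le_sum[of s "{..<n}" "\<lambda>s. of_bool (agree ({..<n} - {s}) z x) * (2 * real k * real (M (Suc s))) powr p"]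
        by (simp add: agree_def del: vil_M.simps)
      then show "?b powr p \<le> ?A + ?C" using nnA by simp
    qed simp
  qed
qed

text \<open>Freeing coordinate \<open>s\<close> enlarges the coset of level \<open>l\<close> by the
  factor \<open>m s\<close>, at most \<open>B\<close>.\<close>

lemma integral_agree_minus:
  assumes "z \<in> G" "s < l"
  shows "(\<integral>x. of_bool (agree ({..<l} - {s}) z x) \<partial>\<mu>) \<le> real B / real (M l)"
proof -
  have "real (M l) = real (m s) * (\<Prod>j\<in>{..<l} - {s}. real (m j))"
    using assms by (simp add: M_prod prod.remove)
  then have "(\<Prod>j\<in>{..<l} - {s}. 1 / real (m j)) = real (m s) / real (M l)"
    by (simp add: prod_dividef)
  also have "\<dots> \<le> real B / real (M l)" using m_le[of s] by (intro divide_right_mono) auto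
  finally show ?thesis using integral_agree[OF _ assms(1), of "{..<l} - {s}"] by simp
qed

section \<open>Fejer means of atoms\<close>

text \<open>A partial sum of the series to be estimated, as a real number; \<open>2 * p - 2\<close>
  is the negative of the exponent in the denominators.\<close>

definition fejer_sum :: "real \<Rightarrow> nat \<Rightarrow> ((nat \<Rightarrow> nat) \<Rightarrow> complex) \<Rightarrow> real" where
  "fejer_sum p K h = (\<Sum>k=1..K. (\<integral>x. norm (fejer_total k h x / of_nat k) powr p \<partial>\<mu>) * real k powr (2 * p - 2))"

lemma fejer_total_powr_level: "level k (\<lambda>x. norm (fejer_total k h x / of_nat k) powr p)"
  by (rule level_comp[OF fejer_total_level])

lemma fejer_sum_sum_le:
  assumes p: "0 < p" "p \<le> 1" and A: "finite A" "\<And>a. a \<in> A \<Longrightarrow> level N (h a)"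
  shows "fejer_sum p K (\<lambda>x. \<Sum>a\<in>A. h a x) \<le> (\<Sum>a\<in>A. fejer_sum p K (h a))"
proof -
  have "(\<integral>x. norm (fejer_total k (\<lambda>x. \<Sum>a\<in>A. h a x) x / of_nat k) powr p \<partial>\<mu>)
      \<le> (\<Sum>a\<in>A. (\<integral>x. norm (fejer_total k (h a) x / of_nat k) powr p \<partial>\<mu>))" for k
  proof -
    have "(\<integral>x. norm (fejer_total k (\<lambda>x. \<Sum>a\<in>A. h a x) x / of_nat k) powr p \<partial>\<mu>)
        \<le> (\<integral>x. (\<Sum>a\<in>A. norm (fejer_total k (h a) x / of_nat k) powr p) \<partial>\<mu>)"
    proof (rule integral_mono_level)
      fix x
      have "norm (fejer_total k (\<lambda>x. \<Sum>a\<in>A. h a x) x / of_nat k) \<le> (\<Sum>a\<in>A. norm (fejer_total k (h a) x / of_nat k))"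
        unfolding fejer_total_sum[of A N h, OF A(2), simplified] sum_divide_distrib by (rule norm_sum)
      then have "norm (fejer_total k (\<lambda>x. \<Sum>a\<in>A. h a x) x / of_nat k) powr p
          \<le> (\<Sum>a\<in>A. norm (fejer_total k (h a) x / of_nat k)) powr p"
        using p by (intro powr_mono2) auto
      also have "\<dots> \<le> (\<Sum>a\<in>A. norm (fejer_total k (h a) x / of_nat k) powr p)"
        using p A by (intro powr_sum_le) auto
      finally show "norm (fejer_total k (\<lambda>x. \<Sum>a\<in>A. h a x) x / of_nat k) powr p
          \<le> (\<Sum>a\<in>A. norm (fejer_total k (h a) x / of_nat k) powr p)" .
    qed (rule fejer_total_powr_level level_sum | assumption)+
    also have "\<dots> = (\<Sum>a\<in>A. (\<integral>x. norm (fejer_total k (h a) x / of_nat k) powr p \<partial>\<mu>))"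
      by (intro Bochner_Integration.integral_sum level_integrable[OF fejer_total_powr_level])
    finally show ?thesis .
  qed
  then have "fejer_sum p K (\<lambda>x. \<Sum>a\<in>A. h a x)
      \<le> (\<Sum>k=1..K. (\<Sum>a\<in>A. (\<integral>x. norm (fejer_total k (h a) x / of_nat k) powr p \<partial>\<mu>)) * real k powr (2 * p - 2))"
    unfolding fejer_sum_def by (intro sum_mono mult_right_mono) auto
  also have "\<dots> = (\<Sum>a\<in>A. fejer_sum p K (h a))"
    unfolding fejer_sum_def sum_distrib_right by (rule sum.swap)
  finally show ?thesis .
qed

lemma fejer_sum_cong: "(\<And>x. x \<in> G \<Longrightarrow> h x = g x) \<Longrightarrow> fejer_sum p K h = fejer_sum p K g"
  using fejer_total_cong[of h g] by (simp add: fejer_sum_def)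

text \<open>Integrating the pointwise bound, the pairs \<open>s < l\<close> give a sum of
  \<open>M s powr p * M l powr (p - 1)\<close>. Summing over \<open>s\<close> leaves
  \<open>M l powr (2 * p - 1)\<close>, summable because \<open>p < 1/2\<close>. The terms with a
  single differing coordinate add up to \<open>k powr p * M n powr p / M n\<close>. The common
  factor \<open>(lam / M n) powr p\<close> produces the two terms of the bound.\<close>

lemma off_support:
  assumes p: "0 < p" "p < 1/2"
  obtains C where "0 < C" and "\<And>N a z lam n k. \<lbrakk>level N a; z \<in> G; 0 < lam; \<And>x. x \<in> G \<Longrightarrow> norm (a x) \<le> lam;
      \<And>x. x \<in> G \<Longrightarrow> \<not> agree {..<n} z x \<Longrightarrow> a x = 0; 1 \<le> k\<rbrakk> \<Longrightarrow>
      (\<integral>x. of_bool (\<not> agree {..<n} z x) * norm (fejer_total k a x) powr p \<partial>\<mu>)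
        \<le> C * lam powr p * (real (M n) powr (-p) + real k powr p / real (M n))"
proof -
  define C1 where "C1 = 1 / ((2::real) powr p - 1)"
  define C2 where "C2 = 1 / (1 - (2::real) powr (2 * p - 1))"
  \<comment> \<open>The kernel bounds involve \<open>M (Suc s)\<close> and \<open>M (Suc l)\<close>;
    replacing them by \<open>M s\<close> and \<open>M l\<close> costs a factor \<open>B\<close>
    each.\<close>
  define b where "b = 2 * real B ^ 2"
  have C1: "0 < C1" using p by (simp add: C1_def)
  have C2: "0 < C2" using p powr_less_one[of 2 "2 * p - 1"] by (simp add: C2_def)
  have B: "2 \<le> real B" by (rule B_ge)
  have b: "0 < b" using B by (simp add: b_def)
  define C where "C = real B * b powr p * C1 * (C2 + 1)"
  show ?thesis
  proof (rule that[of C])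
    show "0 < C" using B b C1 C2 by (simp add: C_def)
  next
    fix N :: nat and a :: "(nat \<Rightarrow> nat) \<Rightarrow> complex" and z and lam :: real and n k :: nat
    assume a: "level N a" "z \<in> G" "0 < lam" "\<And>x. x \<in> G \<Longrightarrow> norm (a x) \<le> lam"
      "\<And>x. x \<in> G \<Longrightarrow> \<not> agree {..<n} z x \<Longrightarrow> a x = 0" and k: "1 \<le> k"
    let ?f1 = "\<lambda>s l x. of_bool (agree ({..<l} - {s}) z x) * (2 * real (M (Suc s)) * real (M (Suc l))) powr p"
    let ?f2 = "\<lambda>s x. of_bool (agree ({..<n} - {s}) z x) * (2 * real k * real (M (Suc s))) powr p"
    let ?R = "\<lambda>x. (lam / M n) powr p * ((\<Sum>l<n. \<Sum>s<l. ?f1 s l x) + (\<Sum>s<n. ?f2 s x))"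
    have l1: "level n (?f1 s l)" if "l < n" for s l
      using that by (intro level_comp[where F="\<lambda>c. of_bool c * (2 * real (M (Suc s)) * real (M (Suc l))) powr p"] level_agree) auto
    have l2: "level n (?f2 s)" for s
      by (intro level_comp[where F="\<lambda>c. of_bool c * (2 * real k * real (M (Suc s))) powr p"] level_agree) auto
    have L1: "level n (\<lambda>x. \<Sum>l<n. \<Sum>s<l. ?f1 s l x)" by (rule level_sum, rule level_sum, rule l1) simp
    have L2: "level n (\<lambda>x. \<Sum>s<n. ?f2 s x)" by (rule level_sum, rule l2)
    have LR: "level n ?R" by (rule level_comp2[OF L1 L2])
    have LL: "level (max n k) (\<lambda>x. of_bool (\<not> agree {..<n} z x) * norm (fejer_total k a x) powr p)"
    proof (rule level_comp2[where F="\<lambda>c y. of_bool (\<not> c) * norm y powr p"])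
      show "level (max n k) (agree {..<n} z)" by (rule level_agree) auto
      show "level (max n k) (fejer_total k a)" by (rule level_mono[OF fejer_total_level]) simp
    qed
    have i1: "(\<integral>x. ?f1 s l x \<partial>\<mu>) \<le> real B * b powr p * (real (M s) powr p * real (M l) powr (p - 1))" if "s < l" for s l
    proof -
      have "(\<integral>x. ?f1 s l x \<partial>\<mu>) = (\<integral>x. of_bool (agree ({..<l} - {s}) z x) \<partial>\<mu>) * (2 * real (M (Suc s)) * real (M (Suc l))) powr p"
        by simp
      also have "\<dots> \<le> real B / real (M l) * (b * real (M s) * real (M l)) powr p"
      proof (rule mult_mono[OF integral_agree_minus[OF a(2) that] powr_mono2])
        have "real (M (Suc s)) * real (M (Suc l)) \<le> (real B * real (M s)) * (real B * real (M l))"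
          by (intro mult_mono M_Suc_le) auto
        then show "2 * real (M (Suc s)) * real (M (Suc l)) \<le> b * real (M s) * real (M l)"
          by (simp add: b_def power2_eq_square mult_ac)
      qed (use p in auto)
      also have "\<dots> = real B * b powr p * (real (M s) powr p * (real (M l) powr p / real (M l)))"
        by (simp add: powr_mult)
      also have "real (M l) powr p / real (M l) = real (M l) powr (p - 1)"
        by (simp add: powr_diff)
      finally show ?thesis .
    qed
    have i2: "(\<integral>x. ?f2 s x \<partial>\<mu>) \<le> real B * b powr p * (real k powr p / real (M n)) * real (M s) powr p" if "s < n" for s
    proof -
      have "(\<integral>x. ?f2 s x \<partial>\<mu>) = (\<integral>x. of_bool (agree ({..<n} - {s}) z x) \<partial>\<mu>) * (2 * real k * real (M (Suc s))) powr p"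
        by simp
      also have "\<dots> \<le> real B / real (M n) * (b * real k * real (M s)) powr p"
      proof (rule mult_mono[OF integral_agree_minus[OF a(2) that] powr_mono2])
        have "real B * 1 \<le> real B * real B" using B by (intro mult_left_mono) auto
        then have "real B * real (M s) \<le> real B * real B * real (M s)" by (intro mult_right_mono) auto
        then have "real (M (Suc s)) \<le> real B * real B * real (M s)" using M_Suc_le[of s] by linarith
        then have "2 * real k * real (M (Suc s)) \<le> 2 * real k * (real B * real B * real (M s))"
          by (intro mult_left_mono) auto
        then show "2 * real k * real (M (Suc s)) \<le> b * real k * real (M s)"
          by (simp add: b_def power2_eq_square mult_ac)
      qed (use p in auto)
      also have "\<dots> = real B * b powr p * (real k powr p / real (M n)) * real (M s) powr p"
        by (simp add: powr_mult)
      finally show ?thesis .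
    qed
    have c1: "(\<Sum>s<l. real (M s) powr p) \<le> C1 * real (M l) powr p" for l
      unfolding C1_def using p by (intro sum_M_powr) auto
    have c2: "(\<Sum>l<n. real (M l) powr (2 * p - 1)) \<le> C2"
      unfolding C2_def using p by (intro sum_M_powr_neg) auto
    have "(\<Sum>l<n. \<Sum>s<l. (\<integral>x. ?f1 s l x \<partial>\<mu>))
        \<le> (\<Sum>l<n. \<Sum>s<l. real B * b powr p * (real (M s) powr p * real (M l) powr (p - 1)))"
      using i1 by (intro sum_mono) auto
    also have "\<dots> = real B * b powr p * (\<Sum>l<n. (\<Sum>s<l. real (M s) powr p) * real (M l) powr (p - 1))"
      by (simp add: sum_distrib_left sum_distrib_right)
    also have "\<dots> \<le> real B * b powr p * (\<Sum>l<n. C1 * real (M l) powr p * real (M l) powr (p - 1))"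
      using c1 by (intro mult_left_mono sum_mono mult_right_mono) auto
    also have "\<dots> = real B * b powr p * C1 * (\<Sum>l<n. real (M l) powr (2 * p - 1))"
      by (simp add: sum_distrib_left mult_ac flip: powr_add)
    also have "\<dots> \<le> real B * b powr p * C1 * C2" using c2 C1 by (intro mult_left_mono) auto
    finally have s1: "(\<Sum>l<n. \<Sum>s<l. (\<integral>x. ?f1 s l x \<partial>\<mu>)) \<le> real B * b powr p * C1 * C2" .
    have "(\<Sum>s<n. (\<integral>x. ?f2 s x \<partial>\<mu>)) \<le> (\<Sum>s<n. real B * b powr p * (real k powr p / real (M n)) * real (M s) powr p)"
      using i2 by (intro sum_mono) auto
    also have "\<dots> \<le> real B * b powr p * (real k powr p / real (M n)) * (C1 * real (M n) powr p)"
      unfolding sum_distrib_left[symmetric] using c1 by (intro mult_left_mono) auto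
    finally have s2: "(\<Sum>s<n. (\<integral>x. ?f2 s x \<partial>\<mu>)) \<le> real B * b powr p * C1 * (real k powr p / real (M n) * real (M n) powr p)"
      by (simp add: mult_ac)
    have "(\<integral>x. of_bool (\<not> agree {..<n} z x) * norm (fejer_total k a x) powr p \<partial>\<mu>) \<le> (\<integral>x. ?R x \<partial>\<mu>)"
    proof (rule integral_mono_level[OF LL LR])
      fix x assume x: "x \<in> G"
      have "0 \<le> ?R x" by (intro mult_nonneg_nonneg add_nonneg_nonneg sum_nonneg) auto
      then show "of_bool (\<not> agree {..<n} z x) * norm (fejer_total k a x) powr p \<le> ?R x"
        using norm_fejer_total_off[OF a p(1) x _ k] by (cases "agree {..<n} z x") simp_all
    qed
    also have "\<dots> = (lam / M n) powr p * ((\<integral>x. (\<Sum>l<n. \<Sum>s<l. ?f1 s l x) \<partial>\<mu>) + (\<integral>x. (\<Sum>s<n. ?f2 s x) \<partial>\<mu>))"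
      unfolding Bochner_Integration.integral_add[OF level_integrable[OF L1] level_integrable[OF L2], symmetric]
      by (rule integral_mult_right_zero)
    also have "(\<integral>x. (\<Sum>l<n. \<Sum>s<l. ?f1 s l x) \<partial>\<mu>) = (\<Sum>l<n. \<integral>x. (\<Sum>s<l. ?f1 s l x) \<partial>\<mu>)"
      by (rule Bochner_Integration.integral_sum, rule level_integrable, rule level_sum, rule l1) simp
    also have "\<dots> = (\<Sum>l<n. \<Sum>s<l. (\<integral>x. ?f1 s l x \<partial>\<mu>))"
      by (intro sum.cong refl Bochner_Integration.integral_sum) (rule level_integrable, rule l1, simp)
    also have "(\<integral>x. (\<Sum>s<n. ?f2 s x) \<partial>\<mu>) = (\<Sum>s<n. (\<integral>x. ?f2 s x \<partial>\<mu>))"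
      by (intro Bochner_Integration.integral_sum level_integrable[OF l2])
    also have "(lam / M n) powr p * ((\<Sum>l<n. \<Sum>s<l. (\<integral>x. ?f1 s l x \<partial>\<mu>)) + (\<Sum>s<n. (\<integral>x. ?f2 s x \<partial>\<mu>)))
       \<le> (lam / M n) powr p * (real B * b powr p * C1 * C2 + real B * b powr p * C1 * (real k powr p / real (M n) * real (M n) powr p))"
      by (intro mult_left_mono add_mono s1 s2) auto
    also have "\<dots> = real B * b powr p * C1 * lam powr p * (C2 * real (M n) powr (-p) + real k powr p / real (M n))"
      by (simp add: powr_divide powr_minus_divide distrib_left mult_ac)
    also have "\<dots> \<le> real B * b powr p * C1 * lam powr p * ((C2 + 1) * real (M n) powr (-p) + (C2 + 1) * (real k powr p / real (M n)))"
      using C1 C2 mult_right_mono[of 1 "C2 + 1" "real k powr p / real (M n)"]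
      by (intro mult_left_mono add_mono mult_right_mono) auto
    also have "\<dots> = C * lam powr p * (real (M n) powr (-p) + real k powr p / real (M n))"
      by (simp add: C_def distrib_left mult_ac)
    finally show "(\<integral>x. of_bool (\<not> agree {..<n} z x) * norm (fejer_total k a x) powr p \<partial>\<mu>)
        \<le> C * lam powr p * (real (M n) powr (-p) + real k powr p / real (M n))" .
  qed
qed

text \<open>The pointwise inequality \<open>pt\<close> takes the place of Hoelder's inequality. Its
  first term integrates over the coset, its second over the whole group, where the square integral
  is at most that of \<open>a\<close>, hence at most \<open>lam\<^sup>2 / M n\<close>.\<close>

lemma on_support:
  assumes p: "0 < p" "p \<le> 2"
    and a: "level N a" "z \<in> G" "0 < lam" "\<And>x. x \<in> G \<Longrightarrow> norm (a x) \<le> lam"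
    "\<And>x. x \<in> G \<Longrightarrow> \<not> agree {..<n} z x \<Longrightarrow> a x = 0"
  shows "(\<integral>x. of_bool (agree {..<n} z x) * norm (fejer_total k a x / of_nat k) powr p \<partial>\<mu>) \<le> 2 * lam powr p / M n"
proof -
  let ?I = "\<lambda>x. of_bool (agree {..<n} z x) :: real"
  let ?g = "\<lambda>x. norm (fejer_total k a x / of_nat k)"
  have lI: "level (max n k) (agree {..<n} z)" by (rule level_agree) auto
  have ls: "level (max n k) (fejer_total k a)" by (rule level_mono[OF fejer_total_level]) simp
  have ls2: "level k (\<lambda>x. (?g x)\<^sup>2)" by (rule level_comp[OF fejer_total_level])
  have lI': "level n (\<lambda>x. lam powr p * ?I x)" by (rule level_comp[OF level_agree]) simp
  have pt: "u powr p \<le> lam powr p + lam powr (p - 2) * u\<^sup>2" if "0 \<le> u" for u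
  proof (cases "u \<le> lam")
    case True
    then have "u powr p \<le> lam powr p" using that p by (intro powr_mono2) auto
    then show ?thesis by (simp add: add_increasing2)
  next
    case False
    then have u: "0 < u" "lam \<le> u" using a(3) by auto
    have "u powr p = u powr (p - 2) * u\<^sup>2" using u by (simp flip: powr_add powr_numeral)
    also have "\<dots> \<le> lam powr (p - 2) * u\<^sup>2" using u a(3) p by (intro mult_right_mono powr_mono2') auto
    finally show ?thesis by (simp add: add_increasing)
  qed
  have "(\<integral>x. ?I x * ?g x powr p \<partial>\<mu>) \<le> (\<integral>x. lam powr p * ?I x + lam powr (p - 2) * (?g x)\<^sup>2 \<partial>\<mu>)"
  proof (rule integral_mono_level)
    show "level (max n k) (\<lambda>x. ?I x * ?g x powr p)" by (rule level_comp2[OF lI ls])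
    show "level (max n k) (\<lambda>x. lam powr p * ?I x + lam powr (p - 2) * (?g x)\<^sup>2)" by (rule level_comp2[OF lI ls])
    show "?I x * ?g x powr p \<le> lam powr p * ?I x + lam powr (p - 2) * (?g x)\<^sup>2" for x
      using pt[of "?g x"] by (cases "agree {..<n} z x") simp_all
  qed
  also have "\<dots> = (\<integral>x. lam powr p * ?I x \<partial>\<mu>) + (\<integral>x. lam powr (p - 2) * (?g x)\<^sup>2 \<partial>\<mu>)"
    by (intro Bochner_Integration.integral_add level_integrable[OF lI'] integrable_mult_right level_integrable[OF ls2])
  also have "\<dots> = lam powr p / M n + lam powr (p - 2) * (\<integral>x. (?g x)\<^sup>2 \<partial>\<mu>)"
    by (simp add: integral_agree_I[OF a(2)])
  also have "(\<integral>x. (?g x)\<^sup>2 \<partial>\<mu>) \<le> (\<integral>x. (norm (a x))\<^sup>2 \<partial>\<mu>)" by (rule fejer_total_L2[OF a(1)])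
  also have "(\<integral>x. (norm (a x))\<^sup>2 \<partial>\<mu>) \<le> (\<integral>x. lam\<^sup>2 * ?I x \<partial>\<mu>)"
  proof (rule integral_mono_level)
    show "level N (\<lambda>x. (norm (a x))\<^sup>2)" by (rule level_comp[OF a(1)])
    show "level n (\<lambda>x. lam\<^sup>2 * ?I x)" by (rule level_comp[OF level_agree]) simp
    show "(norm (a x))\<^sup>2 \<le> lam\<^sup>2 * ?I x" if "x \<in> G" for x
      using a(4)[OF that] a(5)[OF that] by (cases "agree {..<n} z x") (simp_all add: power_mono)
  qed
  also have "\<dots> = lam\<^sup>2 / M n" by (simp add: integral_agree_I[OF a(2)])
  also have "lam powr p / M n + lam powr (p - 2) * (lam\<^sup>2 / M n) = 2 * lam powr p / M n"
  proof -
    have "lam powr (p - 2) * lam\<^sup>2 = lam powr p" using a(3) by (simp flip: powr_add powr_numeral)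
    then show ?thesis by simp
  qed
  finally show ?thesis by (simp add: mult_left_mono)
qed

text \<open>By the vanishing hypothesis the sum starts at \<open>k = M n\<close>. The sum of
  \<open>k powr (2 * p - 2)\<close> stays bounded since \<open>p < 1/2\<close>, and the tail of
  \<open>k powr (p - 2)\<close> is of order \<open>M n powr (p - 1)\<close>, which turns
  \<open>M n powr (-p)\<close> into \<open>1 / M n\<close>. For \<open>n = 0\<close> the vanishing
  hypothesis only concerns \<open>k = 0\<close>, so any bounded function counts as an atom on the
  whole group.\<close>

lemma fejer_sum_atom:
  assumes p: "0 < p" "p < 1/2"
  obtains C where "0 < C" and "\<And>N a z lam n K. \<lbrakk>level N a; z \<in> G; 0 < lam; \<And>x. x \<in> G \<Longrightarrow> norm (a x) \<le> lam;
      \<And>x. x \<in> G \<Longrightarrow> \<not> agree {..<n} z x \<Longrightarrow> a x = 0; \<And>k x. k < M n \<Longrightarrow> fejer_total k a x = 0\<rbrakk> \<Longrightarrow>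
      fejer_sum p K a \<le> C * lam powr p / M n"
proof -
  obtain C3 where C3: "0 < C3" and off: "\<And>N a z lam n k. \<lbrakk>level N a; z \<in> G; 0 < lam; \<And>x. x \<in> G \<Longrightarrow> norm (a x) \<le> lam;
      \<And>x. x \<in> G \<Longrightarrow> \<not> agree {..<n} z x \<Longrightarrow> a x = 0; 1 \<le> k\<rbrakk> \<Longrightarrow>
      (\<integral>x. of_bool (\<not> agree {..<n} z x) * norm (fejer_total k a x) powr p \<partial>\<mu>)
        \<le> C3 * lam powr p * (real (M n) powr (-p) + real k powr p / real (M n))"
    using off_support[OF p] by blast
  define C4 where "C4 = 1 + 1 / (1 - 2 * p)"
  define C5 where "C5 = 1 + 1 / (1 - p)"
  have C4: "0 < C4" using p by (simp add: C4_def add_pos_pos)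
  have C5: "0 < C5" using p by (simp add: C5_def add_pos_pos)
  show ?thesis
  proof (rule that[of "(2 + C3) * C4 + C3 * C5"])
    show "0 < (2 + C3) * C4 + C3 * C5" using C3 C4 C5 by (simp add: add_pos_pos)
  next
    fix N a z lam n K
    assume a: "level N a" "z \<in> G" "0 < lam" "\<And>x. x \<in> G \<Longrightarrow> norm (a x) \<le> lam"
      "\<And>x. x \<in> G \<Longrightarrow> \<not> agree {..<n} z x \<Longrightarrow> a x = 0"
      and z: "\<And>k x. k < M n \<Longrightarrow> fejer_total k a x = 0"
    let ?W = "\<lambda>k. (\<integral>x. norm (fejer_total k a x / of_nat k) powr p \<partial>\<mu>)"
    have Mn: "1 \<le> M n" using M_pos[of n] by linarith
    have W: "?W k * real k powr (2 * p - 2) \<le> lam powr p * ((2 + C3) / M n * real k powr (- (2 - 2 * p))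
        + C3 * real (M n) powr (-p) * real k powr (- (2 - p)))"
      if k: "1 \<le> k" for k
    proof -
      let ?I = "\<lambda>x. of_bool (agree {..<n} z x) :: real"
      let ?J = "\<lambda>x. of_bool (\<not> agree {..<n} z x) :: real"
      let ?g = "\<lambda>x. norm (fejer_total k a x / of_nat k) powr p"
      have lI: "level (max n k) (agree {..<n} z)" by (rule level_agree) auto
      have ls: "level (max n k) (fejer_total k a)" by (rule level_mono[OF fejer_total_level]) simp
      have "?W k = (\<integral>x. ?I x * ?g x + ?J x * ?g x \<partial>\<mu>)"
        by (intro Bochner_Integration.integral_cong) auto
      also have "\<dots> = (\<integral>x. ?I x * ?g x \<partial>\<mu>) + (\<integral>x. ?J x * ?g x \<partial>\<mu>)"
        by (intro Bochner_Integration.integral_add level_integrable) (rule level_comp2[OF lI ls])+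
      also have "(\<integral>x. ?I x * ?g x \<partial>\<mu>) \<le> 2 * lam powr p / M n"
        using p by (intro on_support[OF _ _ a]) auto
      also have "(\<integral>x. ?J x * ?g x \<partial>\<mu>) = (\<integral>x. ?J x * norm (fejer_total k a x) powr p \<partial>\<mu>) * real k powr (-p)"
        by (simp add: norm_divide powr_divide powr_minus_divide)
      also have "(\<integral>x. ?J x * norm (fejer_total k a x) powr p \<partial>\<mu>) * real k powr (-p)
          \<le> C3 * lam powr p * (real (M n) powr (-p) + real k powr p / real (M n)) * real k powr (-p)"
        using off[OF a k] by (intro mult_right_mono) auto
      also have "\<dots> = C3 * lam powr p * (real (M n) powr (-p) * real k powr (-p) + 1 / real (M n))"
        using k by (simp add: powr_minus distrib_left distrib_right field_simps)
      finally have "?W k \<le> lam powr p * ((2 + C3) / M n + C3 * real (M n) powr (-p) * real k powr (-p))"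
        by (simp add: algebra_simps add_divide_distrib)
      then have "?W k * real k powr (2 * p - 2) \<le> lam powr p * ((2 + C3) / M n + C3 * real (M n) powr (-p) * real k powr (-p)) * real k powr (2 * p - 2)"
        by (intro mult_right_mono) auto
      also have "\<dots> = lam powr p * ((2 + C3) / M n * real k powr (2 * p - 2) + C3 * real (M n) powr (-p) * (real k powr (-p) * real k powr (2 * p - 2)))"
        by (simp only: distrib_right distrib_left mult.assoc)
      also have "real k powr (-p) * real k powr (2 * p - 2) = real k powr (- (2 - p))"
        by (simp flip: powr_add)
      finally show ?thesis by simp
    qed
    have Wz: "?W k = 0" if "k < M n" for k using z[OF that] p by simp
    have "fejer_sum p K a = (\<Sum>k=M n..K. ?W k * real k powr (2 * p - 2))"
      unfolding fejer_sum_def using Mn Wz by (intro sum.mono_neutral_right) auto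
    also have "\<dots> \<le> (\<Sum>k=M n..K. lam powr p * ((2 + C3) / M n * real k powr (- (2 - 2 * p))
        + C3 * real (M n) powr (-p) * real k powr (- (2 - p))))"
      using W Mn by (intro sum_mono) auto
    also have "\<dots> = lam powr p * ((2 + C3) / M n * (\<Sum>k=M n..K. real k powr (- (2 - 2 * p)))
        + C3 * real (M n) powr (-p) * (\<Sum>k=M n..K. real k powr (- (2 - p))))"
      by (simp add: sum_distrib_left sum.distrib distrib_left mult.assoc)
    also have "\<dots> \<le> lam powr p * ((2 + C3) / M n * C4 + C3 * real (M n) powr (-p) * (C5 * real (M n) powr (p - 1)))"
    proof (intro mult_left_mono add_mono)
      show "(\<Sum>k=M n..K. real k powr (- (2 - 2 * p))) \<le> C4"
      proof (cases "M n \<le> K")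
        case True
        have "(\<Sum>k=M n..K. real k powr (- (2 - 2 * p))) \<le> (1 + 1 / (2 - 2 * p - 1)) * real (M n) powr (1 - (2 - 2 * p))"
          using p Mn True by (intro sum_powr_tail) auto
        also have "\<dots> \<le> (1 + 1 / (2 - 2 * p - 1)) * 1"
          using p M_ge_1[of n] powr_mono2'[of "1 - (2 - 2 * p)" 1 "real (M n)"] by (intro mult_left_mono) auto
        finally show ?thesis by (simp add: C4_def)
      qed (use C4 in simp)
      show "(\<Sum>k=M n..K. real k powr (- (2 - p))) \<le> C5 * real (M n) powr (p - 1)"
      proof (cases "M n \<le> K")
        case True
        have "(\<Sum>k=M n..K. real k powr (- (2 - p))) \<le> (1 + 1 / (2 - p - 1)) * real (M n) powr (1 - (2 - p))"
          using p Mn True by (intro sum_powr_tail) auto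
        then show ?thesis by (simp add: C5_def)
      qed (use C5 in simp)
    qed (use C3 in auto)
    also have "C3 * real (M n) powr (-p) * (C5 * real (M n) powr (p - 1)) = C3 * C5 * real (M n) powr (-1)"
      by (simp add: mult_ac flip: powr_add)
    also have "real (M n) powr (-1) = 1 / M n" by (simp add: powr_minus_divide)
    finally show "fejer_sum p K a \<le> ((2 + C3) * C4 + C3 * C5) * lam powr p / M n"
      by (simp add: add_divide_distrib algebra_simps)
  qed
qed

section \<open>Stopping-time decomposition\<close>

lemma fejer_sum_add:
  assumes "0 < p" "p \<le> 1" "level N u" "level N v"
  shows "fejer_sum p K (\<lambda>x. u x + v x) \<le> fejer_sum p K u + fejer_sum p K v"
  using fejer_sum_sum_le[of p UNIV N "\<lambda>b. if b then u else v" K] assms by (simp add: UNIV_bool add.commute)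

text \<open>The conditional expectation on the first \<open>n\<close> coordinates, not an
  exponential.\<close>

definition cexp :: "((nat \<Rightarrow> nat) \<Rightarrow> complex) \<Rightarrow> nat \<Rightarrow> (nat \<Rightarrow> nat) \<Rightarrow> complex" where
  "cexp h n = vil_S m (M n) h"

text \<open>The stopping time looks one step ahead: it stops at the first \<open>i\<close> for which the martingale
  exceeds \<open>lam\<close> at level \<open>i + 1\<close> somewhere on \<open>I\<^sub>i(x)\<close>. Hence stopping is decided by the first \<open>i\<close>
  coordinates while the stopped martingale stays bounded by \<open>lam\<close>.\<close>

definition stays_below :: "((nat \<Rightarrow> nat) \<Rightarrow> complex) \<Rightarrow> real \<Rightarrow> nat \<Rightarrow> (nat \<Rightarrow> nat) \<Rightarrow> bool" where
  "stays_below h lam n x \<longleftrightarrow> (\<forall>i<n. \<forall>y\<in>G. agree {..<i} x y \<longrightarrow> norm (cexp h (Suc i) y) \<le> lam)"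

text \<open>Written as a martingale transform: each increment carries an indicator already decided
  before it. The difference of two stopped martingales is then again a sum of martingale differences
  with such coefficients.\<close>

definition stopped :: "((nat \<Rightarrow> nat) \<Rightarrow> complex) \<Rightarrow> nat \<Rightarrow> real \<Rightarrow> (nat \<Rightarrow> nat) \<Rightarrow> complex" where
  "stopped h N lam x = cexp h 0 x + (\<Sum>n<N. of_bool (stays_below h lam (Suc n) x) * (cexp h (Suc n) x - cexp h n x))"

definition maximal_upto :: "((nat \<Rightarrow> nat) \<Rightarrow> complex) \<Rightarrow> nat \<Rightarrow> (nat \<Rightarrow> nat) \<Rightarrow> real" where
  "maximal_upto h N x = Max ((\<lambda>n. norm (cexp h n x)) ` {..N})"

definition coset_reps :: "nat \<Rightarrow> (nat \<Rightarrow> nat) set" where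
  "coset_reps n = {z \<in> G. \<forall>i\<ge>n. z i = 0}"

lemma cexp_level: "level n (cexp h n)"
  unfolding cexp_def vil_S_def[abs_def] by (rule level_sum, rule level_comp[OF psi_level]) simp

lemma stays_below_level: "level n (stays_below h lam (Suc n))"
proof (rule levelI)
  fix x y :: "nat \<Rightarrow> nat" assume xy: "\<And>i. i < n \<Longrightarrow> x i = y i"
  have "agree {..<i} x = agree {..<i} y" if "i < Suc n" for i
    using xy that by (auto simp: agree_def fun_eq_iff)
  then show "stays_below h lam (Suc n) x = stays_below h lam (Suc n) y" by (auto simp: stays_below_def)
qed

lemma stays_below_level': "level n (stays_below h lam n)"
proof (cases n)
  case (Suc k)
  then show ?thesis using level_mono[OF stays_below_level, of k "Suc k"] by simp
qed (simp add: stays_below_def level_def)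

lemma stays_below_antimono: "stays_below h lam n x \<Longrightarrow> i \<le> n \<Longrightarrow> stays_below h lam i x"
  by (auto simp: stays_below_def)

lemma stays_below_mono: "stays_below h lam n x \<Longrightarrow> lam \<le> lam' \<Longrightarrow> stays_below h lam' n x"
  unfolding stays_below_def by (meson order_trans)

lemma stays_below_self: "stays_below h lam (Suc n) x \<Longrightarrow> x \<in> G \<Longrightarrow> norm (cexp h (Suc n) x) \<le> lam"
  by (auto simp: stays_below_def agree_def)

lemma stopped_level: "level N (stopped h N lam)"
proof -
  have "level N (\<lambda>x. of_bool (stays_below h lam (Suc n) x) * (cexp h (Suc n) x - cexp h n x))" if "n < N" for n
  proof (rule level_comp2[where F="\<lambda>c y. of_bool c * y"])
    show "level N (stays_below h lam (Suc n))" by (rule level_mono[OF stays_below_level]) (use that in simp)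
    show "level N (\<lambda>x. cexp h (Suc n) x - cexp h n x)"
      by (rule level_comp2[where F="(-)"]; rule level_mono[OF cexp_level]) (use that in simp_all)
  qed
  then have "level N (\<lambda>x. \<Sum>n<N. of_bool (stays_below h lam (Suc n) x) * (cexp h (Suc n) x - cexp h n x))"
    by (intro level_sum) auto
  then show ?thesis
    unfolding stopped_def[abs_def] by (rule level_comp2[OF level_mono[OF cexp_level], rotated]) simp
qed

lemma stopped_Suc: "stopped h (Suc N) lam x =
    stopped h N lam x + of_bool (stays_below h lam (Suc N) x) * (cexp h (Suc N) x - cexp h N x)"
  by (simp add: stopped_def add.assoc)

lemma stopped_eq: "stays_below h lam N x \<Longrightarrow> stopped h N lam x = cexp h N x"
proof (induction N)
  case (Suc N)
  then have "stopped h N lam x = cexp h N x" using stays_below_antimono[of h lam "Suc N" x N] by simp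
  then show ?case using Suc.prems by (simp add: stopped_Suc)
qed (simp add: stopped_def)

text \<open>Until stopping it is the martingale itself, still below \<open>lam\<close> because of
  the look-ahead; afterwards it is frozen.\<close>

lemma stopped_bound:
  assumes "x \<in> G" "norm (cexp h 0 x) \<le> lam"
  shows "norm (stopped h N lam x) \<le> lam"
proof (induction N)
  case (Suc N)
  show ?case
  proof (cases "stays_below h lam (Suc N) x")
    case True
    then show ?thesis using stopped_eq[OF True] stays_below_self[OF True assms(1)] by simp
  next
    case False
    then show ?thesis using Suc by (simp add: stopped_def)
  qed
qed (use assms in \<open>simp add: stopped_def\<close>)

lemma stopped_diff:
  "stopped h N lam' x - stopped h N lam x =
    (\<Sum>n<N. (of_bool (stays_below h lam' (Suc n) x) - of_bool (stays_below h lam (Suc n) x)) * (cexp h (Suc n) x - cexp h n x))"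
  by (simp add: stopped_def left_diff_distrib sum_subtractf)

lemma martingale_difference_orthogonal:
  assumes "level N h" "level n u"
  shows "(\<integral>x. (cexp h (Suc n) x - cexp h n x) * u x \<partial>\<mu>) = 0"
proof -
  have u: "level (Suc n) u" by (rule level_mono[OF assms(2)]) simp
  have "integrable \<mu> (\<lambda>x. cexp h k x * u x)" if "n \<le> k" for k
    by (rule level_integrable[OF level_comp2[where F="(*)", OF cexp_level level_mono[OF assms(2) that]]])
  then have "(\<integral>x. (cexp h (Suc n) x - cexp h n x) * u x \<partial>\<mu>)
      = (\<integral>x. cexp h (Suc n) x * u x \<partial>\<mu>) - (\<integral>x. cexp h n x * u x \<partial>\<mu>)"
    by (simp add: left_diff_distrib Bochner_Integration.integral_diff)
  then show ?thesis
    unfolding cexp_def by (simp add: S_M_adjoint[OF assms(1) u] S_M_adjoint[OF assms])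
qed

section \<open>Splitting the stopped differences into pieces on cosets\<close>

lemma finite_coset_reps: "finite (coset_reps n)"
proof -
  have "coset_reps n \<subseteq> (\<lambda>f i. if i < n then f i else 0) ` (\<Pi>\<^sub>E j\<in>{..<n}. {..<m j})"
  proof
    fix z assume z: "z \<in> coset_reps n"
    then have "z = (\<lambda>i. if i < n then restrict z {..<n} i else 0)" by (auto simp: coset_reps_def)
    moreover have "restrict z {..<n} \<in> (\<Pi>\<^sub>E j\<in>{..<n}. {..<m j})" using z by (auto simp: coset_reps_def mem_vil_group)
    ultimately show "z \<in> (\<lambda>f i. if i < n then f i else 0) ` (\<Pi>\<^sub>E j\<in>{..<n}. {..<m j})" by blast
  qed
  then show ?thesis by (rule finite_subset) (intro finite_imageI finite_PiE, auto)
qed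

text \<open>Exactly one representative agrees with \<open>x\<close> in the first \<open>n\<close>
  coordinates: its truncation \<open>w\<close>, which satisfies \<open>P\<close> precisely when
  \<open>x\<close> does.\<close>

lemma sum_coset_reps:
  assumes x: "x \<in> G" and P: "level n P"
  shows "(\<Sum>z\<in>{z\<in>coset_reps n. P z}. of_bool (agree {..<n} z x)) = (of_bool (P x) :: 'b::semiring_1)"
proof -
  define w where "w = (\<lambda>i. if i < n then x i else 0)"
  have w: "w \<in> coset_reps n" using x by (auto simp: w_def coset_reps_def mem_vil_group)
  have eq: "agree {..<n} z x \<longleftrightarrow> z = w" if "z \<in> coset_reps n" for z
    using that by (auto simp: agree_def w_def coset_reps_def fun_eq_iff)
  have Pw: "P w = P x" by (rule levelD[OF P]) (simp add: w_def)
  have "(\<Sum>z\<in>{z\<in>coset_reps n. P z}. of_bool (agree {..<n} z x)) = (\<Sum>z\<in>{z\<in>coset_reps n. P z}. if z = w then 1 else (0::'b))"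
    using eq by (intro sum.cong) auto
  then show ?thesis using finite_coset_reps w Pw by simp
qed

definition stop_at :: "((nat \<Rightarrow> nat) \<Rightarrow> complex) \<Rightarrow> real \<Rightarrow> nat \<Rightarrow> (nat \<Rightarrow> nat) \<Rightarrow> bool" where
  "stop_at h lam n x \<longleftrightarrow> stays_below h lam n x \<and> \<not> stays_below h lam (Suc n) x"

lemma stop_at_level: "level n (stop_at h lam n)"
  unfolding stop_at_def[abs_def] by (rule level_comp2[OF stays_below_level' stays_below_level])

lemma sum_stop_at: "(\<Sum>n<N. of_bool (stop_at h lam n x)) = (1 - of_bool (stays_below h lam N x) :: 'b::ring_1)"
proof (induction N)
  case (Suc N)
  then show ?case using stays_below_antimono[of h lam "Suc N" x N] by (auto simp: stop_at_def)
qed (simp add: stays_below_def)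

text \<open>If the lower threshold stops \<open>x\<close>, then \<open>x\<close> lies in exactly one
  piece. If it never does, neither threshold stops \<open>x\<close> and the difference is
  zero.\<close>

lemma stopped_pieces:
  assumes "x \<in> G" "lam \<le> lam'"
  shows "stopped h N lam' x - stopped h N lam x =
    (\<Sum>n<N. \<Sum>z\<in>{z\<in>coset_reps n. stop_at h lam n z}. of_bool (agree {..<n} z x) * (stopped h N lam' x - stopped h N lam x))"
proof -
  have "(\<Sum>n<N. \<Sum>z\<in>{z\<in>coset_reps n. stop_at h lam n z}. of_bool (agree {..<n} z x) * (stopped h N lam' x - stopped h N lam x))
     = (1 - of_bool (stays_below h lam N x)) * (stopped h N lam' x - stopped h N lam x)"
    by (simp add: sum_coset_reps[OF assms(1) stop_at_level] sum_stop_at flip: sum_distrib_right)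
  moreover have "stopped h N lam' x = stopped h N lam x" if "stays_below h lam N x"
    using stopped_eq[OF that] stopped_eq[OF stays_below_mono[OF that assms(2)]] by simp
  ultimately show ?thesis by auto
qed

text \<open>On the coset both stopped martingales coincide up to time \<open>n\<close>, and from
  then on the lower one is frozen. What remains are increments \<open>i \<ge> n\<close>, each
  multiplied by \<open>u i\<close>. Since \<open>j < M n\<close>, also the character in
  \<open>u i\<close> depends on the first \<open>i\<close> coordinates only, so every increment is
  orthogonal to its factor.\<close>

lemma piece_mean_zero:
  assumes h: "level N h" and st: "stop_at h lam n z" and lam: "lam \<le> lam'" and k: "k < M n"
  shows "fejer_total k (\<lambda>x. of_bool (agree {..<n} z x) * (stopped h N lam' x - stopped h N lam x)) x = 0"
proof (rule fejer_total_zero)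
  fix j assume "j < k"
  then have j: "j < M n" using k by simp
  define u where "u i x = of_bool (agree {..<n} z x) * of_bool (stays_below h lam' (Suc i) x) * cnj (\<psi> j x)" for i x
  have u: "level i (u i)" if "n \<le> i" for i
  proof -
    have 1: "level i (agree {..<n} z)" using that by (intro level_agree) auto
    have 2: "level i (\<psi> j)" by (rule level_mono[OF psi_level[OF j] that])
    show ?thesis
      unfolding u_def by (rule level_comp2[OF level_comp2[where F="\<lambda>a b. of_bool a * of_bool b", OF 1 stays_below_level] 2])
  qed
  have eq: "of_bool (agree {..<n} z x) * (stopped h N lam' x - stopped h N lam x) * cnj (\<psi> j x)
      = (\<Sum>i\<in>{n..<N}. (cexp h (Suc i) x - cexp h i x) * u i x)" for x
  proof (cases "agree {..<n} z x")
    case True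
    have zx: "stop_at h lam n x" using st levelD[OF stop_at_level, of n z x] True by (simp add: agree_def)
    have lo: "stays_below h lam (Suc i) x" "stays_below h lam' (Suc i) x" if "i < n" for i
      using zx that stays_below_antimono[of h lam n x "Suc i"] stays_below_mono[OF _ lam] by (auto simp: stop_at_def)
    have hi: "\<not> stays_below h lam (Suc i) x" if "n \<le> i" for i
      using zx that stays_below_antimono[of h lam "Suc i" x "Suc n"] by (auto simp: stop_at_def)
    have "stopped h N lam' x - stopped h N lam x =
        (\<Sum>i\<in>{n..<N}. (of_bool (stays_below h lam' (Suc i) x) - of_bool (stays_below h lam (Suc i) x)) * (cexp h (Suc i) x - cexp h i x))"
      unfolding stopped_diff using lo by (intro sum.mono_neutral_right) auto
    also have "\<dots> = (\<Sum>i\<in>{n..<N}. of_bool (stays_below h lam' (Suc i) x) * (cexp h (Suc i) x - cexp h i x))"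
      using hi by (intro sum.cong) auto
    finally show ?thesis using True 
      by (simp add: u_def sum_distrib_left sum_distrib_right mult_ac del: sum_of_bool_mult_eq sum_mult_of_bool_eq)
  qed (simp add: u_def)
  have "vil_coeff m (\<lambda>x. of_bool (agree {..<n} z x) * (stopped h N lam' x - stopped h N lam x)) j
      = (\<integral>x. (\<Sum>i\<in>{n..<N}. (cexp h (Suc i) x - cexp h i x) * u i x) \<partial>\<mu>)"
    unfolding vil_coeff_def eq ..
  also have "\<dots> = (\<Sum>i\<in>{n..<N}. (\<integral>x. (cexp h (Suc i) x - cexp h i x) * u i x \<partial>\<mu>))"
  proof (rule Bochner_Integration.integral_sum)
    fix i assume i: "i \<in> {n..<N}"
    have d: "level (Suc i) (\<lambda>x. cexp h (Suc i) x - cexp h i x)"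
      by (rule level_comp2[where F="(-)", OF cexp_level level_mono[OF cexp_level]]) simp
    have "level (Suc i) (u i)" using u[of i] i by (auto intro: level_mono)
    then show "integrable \<mu> (\<lambda>x. (cexp h (Suc i) x - cexp h i x) * u i x)"
      by (intro level_integrable[OF level_comp2[where F="(*)", OF d]])
  qed
  also have "\<dots> = 0" using u by (intro sum.neutral ballI martingale_difference_orthogonal[OF h]) auto
  finally show "vil_coeff m (\<lambda>x. of_bool (agree {..<n} z x) * (stopped h N lam' x - stopped h N lam x)) j = 0" .
qed

lemma maximal_upto_level: "level N (maximal_upto h N)"
proof (rule levelI)
  fix x y :: "nat \<Rightarrow> nat" assume "\<And>i. i < N \<Longrightarrow> x i = y i"
  then have "cexp h n x = cexp h n y" if "n \<le> N" for n using that by (intro levelD[OF cexp_level]) auto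
  then show "maximal_upto h N x = maximal_upto h N y" unfolding maximal_upto_def by (intro arg_cong[where f=Max] image_cong) auto
qed

lemma le_maximal_upto: "n \<le> N \<Longrightarrow> norm (cexp h n x) \<le> maximal_upto h N x"
  unfolding maximal_upto_def by (intro Max_ge) auto

lemma maximal_upto_nonneg: "0 \<le> maximal_upto h N x"
  using le_maximal_upto[of 0 N h x] norm_ge_zero order_trans by blast

text \<open>Stopping at \<open>n\<close> is caused by a point \<open>y\<close> of the coset where
  the martingale exceeds \<open>lam\<close> at level \<open>n + 1\<close>. It does so on the whole
  subcoset of \<open>y\<close>, which occupies at least the share \<open>1 / B\<close> of the coset.
  An index \<open>i < n\<close> is impossible because \<open>lam\<close> was respected until
  then.\<close>

lemma stop_at_measure:
  assumes "n < N" "stop_at h lam n z" "z \<in> G"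
  shows "1 / real (M n) \<le> real B * (\<integral>x. of_bool (agree {..<n} z x) * of_bool (lam < maximal_upto h N x) \<partial>\<mu>)"
proof -
  obtain i y where y: "i < Suc n" "y \<in> G" "agree {..<i} z y" "lam < norm (cexp h (Suc i) y)"
    using assms(2) by (force simp: stop_at_def stays_below_def not_le)
  have "i = n"
  proof (rule ccontr)
    assume "i \<noteq> n"
    then have "i < n" using y(1) by simp
    then have "norm (cexp h (Suc i) y) \<le> lam" using y assms(2) by (auto simp: stop_at_def stays_below_def)
    then show False using y(4) by simp
  qed
  have "1 / real (M n) = real B * (1 / (real B * real (M n)))" using B_ge by simp
  also have "\<dots> \<le> real B * (1 / real (M (Suc n)))"
    using M_Suc_le[of n] M_pos[of "Suc n"] by (intro mult_left_mono divide_left_mono) (auto simp del: M_pos)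
  also have "1 / real (M (Suc n)) = (\<integral>x. of_bool (agree {..<Suc n} y x) \<partial>\<mu>)"
    by (rule integral_agree_I[OF y(2), symmetric])
  also have "\<dots> \<le> (\<integral>x. of_bool (agree {..<n} z x) * of_bool (lam < maximal_upto h N x) \<partial>\<mu>)"
  proof (rule integral_mono_level)
    show "level (Suc n) (\<lambda>x. of_bool (agree {..<Suc n} y x) :: real)" by (rule level_comp[OF level_agree]) simp
    show "level N (\<lambda>x. of_bool (agree {..<n} z x) * of_bool (lam < maximal_upto h N x) :: real)"
      using assms(1) by (intro level_comp2[where F="\<lambda>a b. of_bool a * of_bool (lam < b)", OF level_agree maximal_upto_level]) auto
    fix x
    show "of_bool (agree {..<Suc n} y x) \<le> (of_bool (agree {..<n} z x) * of_bool (lam < maximal_upto h N x) :: real)"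
    proof (cases "agree {..<Suc n} y x")
      case True
      have "cexp h (Suc n) x = cexp h (Suc n) y" using True by (intro levelD[OF cexp_level]) (simp add: agree_def)
      then have "lam < maximal_upto h N x" using y(4) \<open>i = n\<close> le_maximal_upto[of "Suc n" N h x] assms(1) by simp
      moreover have "agree {..<n} z x" using True y(3) \<open>i = n\<close> by (auto simp: agree_def)
      ultimately show ?thesis by simp
    qed simp
  qed
  finally show ?thesis by (simp add: mult_left_mono)
qed

text \<open>The last admissible term is below \<open>V\<close> and dominates the geometric sum up to
  \<open>q / (q - 1)\<close>. This is a discrete layer-cake estimate, used with a p-th power of the
  maximal function as \<open>V\<close>.\<close>

lemma sum_dyadic_le:
  fixes q V c :: real
  assumes "1 < q" "0 < c" "0 \<le> V"
  shows "(\<Sum>j<J. c * q ^ j * of_bool (c * q ^ j < V)) \<le> q / (q - 1) * V"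
proof (induction J)
  case (Suc J)
  show ?case
  proof (cases "c * q ^ J < V")
    case True
    have "(\<Sum>j<Suc J. c * q ^ j * of_bool (c * q ^ j < V)) \<le> (\<Sum>j<Suc J. c * q ^ j)"
      using assms by (intro sum_mono) auto
    also have "\<dots> = c * ((q ^ Suc J - 1) / (q - 1))"
      using assms geometric_sum[of q "Suc J"] by (simp flip: sum_distrib_left del: sum.lessThan_Suc)
    also have "\<dots> \<le> c * (q ^ Suc J / (q - 1))" using assms by (intro mult_left_mono divide_right_mono) auto
    also have "\<dots> = q / (q - 1) * (c * q ^ J)" by simp
    also have "\<dots> \<le> q / (q - 1) * V" using True assms by (intro mult_left_mono) auto
    finally show ?thesis .
  qed (use Suc in simp)
qed (use assms in simp)

end

section \<open>The upper estimate\<close>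

lemma epowr_ennreal: "0 \<le> r \<Longrightarrow> epowr (ennreal r) a = ennreal (r powr a)"
  by (simp add: epowr_def)

lemma epowr_mono:
  assumes "x \<le> y" "0 \<le> a"
  shows "epowr x a \<le> epowr y a"
proof (cases "y = \<infinity>")
  case False
  then have y: "y < \<infinity>" by (simp add: less_top)
  then have "x < \<infinity>" using assms(1) by (rule le_less_trans[rotated])
  then show ?thesis
    using assms enn2real_mono[OF assms(1)] y by (auto simp: epowr_def less_top intro!: ennreal_leI powr_mono2)
qed (simp add: epowr_def)

lemma epowr_epowr:
  assumes "a * b = 1"
  shows "epowr (epowr x a) b = x"
proof (cases "x = \<infinity>")
  case False
  then show ?thesis using assms
    by (cases x) (auto simp: epowr_def powr_powr)
qed (simp add: epowr_def)

context vilenkin begin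

lemma fejer_sum_stopped:
  assumes p: "0 < p" "p < 1/2"
  obtains C where "0 < C" and "\<And>h N lam K. \<lbrakk>level N h; 0 < lam; \<And>x. x \<in> G \<Longrightarrow> norm (cexp h 0 x) \<le> lam\<rbrakk> \<Longrightarrow>
    fejer_sum p K (stopped h N lam) \<le> C * lam powr p"
    "\<And>h N lam K. \<lbrakk>level N h; 0 < lam; \<And>x. x \<in> G \<Longrightarrow> norm (cexp h 0 x) \<le> lam\<rbrakk> \<Longrightarrow>
    fejer_sum p K (\<lambda>x. stopped h N (2 * lam) x - stopped h N lam x)
      \<le> C * (\<integral>x. lam powr p * of_bool (lam < maximal_upto h N x) \<partial>\<mu>)"
proof -
  obtain A where A: "0 < A" and atom: "\<And>N a z lam n K. \<lbrakk>level N a; z \<in> G; 0 < lam; \<And>x. x \<in> G \<Longrightarrow> norm (a x) \<le> lam;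
      \<And>x. x \<in> G \<Longrightarrow> \<not> agree {..<n} z x \<Longrightarrow> a x = 0; \<And>k x. k < M n \<Longrightarrow> fejer_total k a x = 0\<rbrakk> \<Longrightarrow>
      fejer_sum p K a \<le> A * lam powr p / M n"
    using fejer_sum_atom[OF p] by blast
  \<comment> \<open>\<open>3\<close> comes from \<open>2 * lam + lam\<close>, the height of a
    difference of two stopped martingales; \<open>B\<close> is the loss in
    \<open>stop_at_measure\<close>.\<close>
  define C where "C = A * 3 powr p * real B"
  have C: "A \<le> C"
  proof -
    have "1 \<le> 3 powr p" using p by (simp add: ge_one_powr_ge_zero)
    then have "1 * 1 \<le> 3 powr p * real B" using B_ge by (intro mult_mono) auto
    then show ?thesis using A mult_left_mono[of 1 "3 powr p * real B" A] by (simp add: C_def mult.assoc)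
  qed
  show ?thesis
  proof (rule that[of C])
    show "0 < C" using A C by simp
  next
    fix h N lam and K :: nat
    assume h: "level N h" "0 < lam" "\<And>x. x \<in> G \<Longrightarrow> norm (cexp h 0 x) \<le> lam"
    have "fejer_sum p K (stopped h N lam) \<le> A * lam powr p / M 0"
    proof (rule atom[OF stopped_level])
      show "(\<lambda>i. 0) \<in> G" by (simp add: mem_vil_group)
    qed (use h stopped_bound in \<open>auto simp: agree_def fejer_total_def\<close>)
    also have "\<dots> \<le> C * lam powr p" using C by (simp add: mult_right_mono)
    finally show "fejer_sum p K (stopped h N lam) \<le> C * lam powr p" .
  next
    fix h N lam and K :: nat
    assume h: "level N h" "0 < lam" "\<And>x. x \<in> G \<Longrightarrow> norm (cexp h 0 x) \<le> lam"
    define b where "b x = stopped h N (2 * lam) x - stopped h N lam x" for x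
    let ?S = "\<lambda>n. {z\<in>coset_reps n. stop_at h lam n z}"
    let ?piece = "\<lambda>n z x. of_bool (agree {..<n} z x) * b x"
    let ?V = "\<lambda>x. of_bool (lam < maximal_upto h N x) :: real"
    have blev: "level N b" unfolding b_def by (rule level_comp2[OF stopped_level stopped_level])
    have plev: "level N (?piece n z)" if "n < N" for n z
      by (rule level_comp2[where F="\<lambda>c y. of_bool c * y", OF level_agree blev]) (use that in auto)
    have bnd: "norm (b x) \<le> 3 * lam" if "x \<in> G" for x
    proof -
      have "norm (stopped h N (2 * lam) x) \<le> 2 * lam" using h(2) h(3)[OF that] that by (intro stopped_bound) auto
      moreover have "norm (stopped h N lam x) \<le> lam" using h that by (intro stopped_bound)
      ultimately show ?thesis unfolding b_def using norm_triangle_ineq4[of "stopped h N (2 * lam) x" "stopped h N lam x"] by linarith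
    qed
    have ilev: "level N (\<lambda>x. of_bool (agree {..<n} z x) * ?V x)" if "n < N" for n z
      using that by (intro level_comp2[where F="\<lambda>a b. of_bool a * of_bool (lam < b)", OF level_agree maximal_upto_level]) auto
    have piece: "fejer_sum p K (?piece n z) \<le> C * lam powr p * (\<integral>x. of_bool (agree {..<n} z x) * ?V x \<partial>\<mu>)"
      if n: "n < N" and z: "z \<in> ?S n" for n z
    proof -
      have zG: "z \<in> G" using z by (simp add: coset_reps_def)
      have "fejer_sum p K (?piece n z) \<le> A * (3 * lam) powr p / M n"
      proof (rule atom[OF plev[OF n] zG])
        show "fejer_total k (?piece n z) x = 0" if "k < M n" for k x
          unfolding b_def using h(2) z that by (intro piece_mean_zero[OF h(1)]) auto
        show "norm (?piece n z x) \<le> 3 * lam" if "x \<in> G" for x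
          using bnd[OF that] h(2) by (cases "agree {..<n} z x") simp_all
      qed (use h(2) in auto)
      also have "\<dots> = A * (3 * lam) powr p * (1 / M n)" by simp
      also have "\<dots> \<le> A * (3 * lam) powr p * (real B * (\<integral>x. of_bool (agree {..<n} z x) * ?V x \<partial>\<mu>))"
        using stop_at_measure[OF n, of h lam z] z zG A by (intro mult_left_mono) auto
      finally show ?thesis by (simp add: C_def powr_mult mult_ac)
    qed
    have "fejer_sum p K b = fejer_sum p K (\<lambda>x. \<Sum>n<N. \<Sum>z\<in>?S n. ?piece n z x)"
      unfolding b_def using h(2) by (intro fejer_sum_cong stopped_pieces) auto
    also have "\<dots> \<le> (\<Sum>n<N. fejer_sum p K (\<lambda>x. \<Sum>z\<in>?S n. ?piece n z x))"
    proof (rule fejer_sum_sum_le)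
      show "level N (\<lambda>x. \<Sum>z\<in>?S n. ?piece n z x)" if "n \<in> {..<N}" for n
        by (rule level_sum, rule plev) (use that in simp)
    qed (use p in auto)
    also have "\<dots> \<le> (\<Sum>n<N. \<Sum>z\<in>?S n. fejer_sum p K (?piece n z))"
      by (rule sum_mono, rule fejer_sum_sum_le[where N=N]) (use p finite_coset_reps plev in auto)
    also have "\<dots> \<le> (\<Sum>n<N. \<Sum>z\<in>?S n. C * lam powr p * (\<integral>x. of_bool (agree {..<n} z x) * ?V x \<partial>\<mu>))"
      by (intro sum_mono piece) auto
    also have "\<dots> = C * lam powr p * (\<Sum>n<N. \<Sum>z\<in>?S n. (\<integral>x. of_bool (agree {..<n} z x) * ?V x \<partial>\<mu>))"
      by (simp only: sum_distrib_left)
    also have "(\<Sum>n<N. \<Sum>z\<in>?S n. (\<integral>x. of_bool (agree {..<n} z x) * ?V x \<partial>\<mu>))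
        = (\<integral>x. (\<Sum>n<N. \<Sum>z\<in>?S n. of_bool (agree {..<n} z x) * ?V x) \<partial>\<mu>)"
    proof -
      have "(\<integral>x. (\<Sum>n<N. \<Sum>z\<in>?S n. of_bool (agree {..<n} z x) * ?V x) \<partial>\<mu>)
          = (\<Sum>n<N. \<integral>x. (\<Sum>z\<in>?S n. of_bool (agree {..<n} z x) * ?V x) \<partial>\<mu>)"
        by (rule Bochner_Integration.integral_sum, rule level_integrable, rule level_sum, rule ilev) simp
      also have "\<dots> = (\<Sum>n<N. \<Sum>z\<in>?S n. (\<integral>x. of_bool (agree {..<n} z x) * ?V x \<partial>\<mu>))"
        by (intro sum.cong refl Bochner_Integration.integral_sum) (rule level_integrable, rule ilev, simp)
      finally show ?thesis ..
    qed
    also have "\<dots> \<le> (\<integral>x. ?V x \<partial>\<mu>)"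
    proof (rule integral_mono_level)
      show "level N (\<lambda>x. \<Sum>n<N. \<Sum>z\<in>?S n. of_bool (agree {..<n} z x) * ?V x)"
        by (rule level_sum, rule level_sum, rule ilev) simp
      show "level N ?V" by (rule level_comp[OF maximal_upto_level])
      fix x assume x: "x \<in> G"
      have "(\<Sum>n<N. \<Sum>z\<in>?S n. of_bool (agree {..<n} z x) * ?V x) = (1 - of_bool (stays_below h lam N x)) * ?V x"
        unfolding sum_distrib_right[symmetric] sum_coset_reps[OF x stop_at_level] sum_stop_at ..
      also have "\<dots> \<le> ?V x" by simp
      finally show "(\<Sum>n<N. \<Sum>z\<in>?S n. of_bool (agree {..<n} z x) * ?V x) \<le> ?V x" .
    qed
    finally have "fejer_sum p K b \<le> C * lam powr p * (\<integral>x. ?V x \<partial>\<mu>)" using A C by (simp add: mult_left_mono)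
    then show "fejer_sum p K (\<lambda>x. stopped h N (2 * lam) x - stopped h N lam x)
      \<le> C * (\<integral>x. lam powr p * ?V x \<partial>\<mu>)"
      by (simp add: b_def[abs_def] mult.assoc)
  qed
qed

lemma fejer_sum_Hp:
  assumes p: "0 < p" "p < 1/2"
  obtains C where "0 < C" and "\<And>h N r K. \<lbrakk>level N h; 0 < r; (\<integral>x. maximal_upto h N x powr p \<partial>\<mu>) \<le> r\<rbrakk> \<Longrightarrow>
    fejer_sum p K h \<le> C * r"
proof -
  obtain C where C: "0 < C" and start: "\<And>h N lam K. \<lbrakk>level N h; 0 < lam; \<And>x. x \<in> G \<Longrightarrow> norm (cexp h 0 x) \<le> lam\<rbrakk> \<Longrightarrow>
    fejer_sum p K (stopped h N lam) \<le> C * lam powr p"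
    and step: "\<And>h N lam K. \<lbrakk>level N h; 0 < lam; \<And>x. x \<in> G \<Longrightarrow> norm (cexp h 0 x) \<le> lam\<rbrakk> \<Longrightarrow>
    fejer_sum p K (\<lambda>x. stopped h N (2 * lam) x - stopped h N lam x)
      \<le> C * (\<integral>x. lam powr p * of_bool (lam < maximal_upto h N x) \<partial>\<mu>)"
    using fejer_sum_stopped[OF p] by blast
  \<comment> \<open>The p-th powers of the doubling thresholds form a geometric sequence with this
    ratio.\<close>
  define q where "q = (2::real) powr p"
  have q: "1 < q" using p by (simp add: q_def)
  show ?thesis
  proof (rule that[of "C * (1 + q / (q - 1))"])
    show "0 < C * (1 + q / (q - 1))" using C q by (simp add: add_pos_pos)
  next
    fix h N K and r :: real
    assume h: "level N h" and r: "0 < r" "(\<integral>x. maximal_upto h N x powr p \<partial>\<mu>) \<le> r"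
    \<comment> \<open>The martingale at time 0 is constant and dominated by the maximal function, so
      its modulus is at most \<open>l0\<close>. The thresholds may therefore start here instead of
      descending to zero.\<close>
    define l0 where "l0 = r powr (1 / p)"
    have l0: "0 < l0" "l0 powr p = r" using r p by (auto simp: l0_def powr_powr)
    define lam where "lam j = l0 * 2 ^ j" for j :: nat
    have lam: "0 < lam j" "l0 \<le> lam j" "lam (Suc j) = 2 * lam j" for j
      using l0(1) by (auto simp: lam_def)
    have lamp: "lam j powr p = r * q ^ j" for j
      using l0 by (simp add: lam_def powr_mult q_def powr_powr mult.commute flip: powr_realpow)
    have zero: "norm (cexp h 0 x) \<le> l0" for x
    proof (rule ccontr)
      let ?c = "norm (cexp h 0 x)"
      assume "\<not> ?c \<le> l0"
      then have "l0 powr p < ?c powr p" using l0 p by (intro powr_less_mono2) auto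
      also have "?c powr p = (\<integral>y. ?c powr p \<partial>\<mu>)" by (simp add: haar.prob_space[simplified])
      also have "\<dots> \<le> (\<integral>y. maximal_upto h N y powr p \<partial>\<mu>)"
      proof (rule integral_mono_level)
        show "level N (\<lambda>y. maximal_upto h N y powr p)" by (rule level_comp[OF maximal_upto_level])
        show "level N (\<lambda>y. ?c powr p)" by (rule level_const)
        fix y
        have "cexp h 0 x = cexp h 0 y" by (rule levelD[OF cexp_level]) simp
        then show "?c powr p \<le> maximal_upto h N y powr p" using le_maximal_upto[of 0 N h y] p by (intro powr_mono2) auto
      qed
      finally show False using r l0 by simp
    qed
    have zero': "norm (cexp h 0 x) \<le> lam j" for x j using zero[of x] lam(2)[of j] by linarith
    let ?U = "\<lambda>j x. lam j powr p * of_bool (lam j < maximal_upto h N x) :: real"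
    have Ulev: "level N (?U j)" for j by (rule level_comp[OF maximal_upto_level])
    have chain: "fejer_sum p K (stopped h N (lam J)) \<le> C * r + C * (\<Sum>j<J. (\<integral>x. ?U j x \<partial>\<mu>))" for J
    proof (induction J)
      case 0
      show ?case using start[OF h l0(1) zero] l0 by (simp add: lam_def)
    next
      case (Suc J)
      have "fejer_sum p K (stopped h N (lam (Suc J)))
        = fejer_sum p K (\<lambda>x. stopped h N (lam J) x + (stopped h N (2 * lam J) x - stopped h N (lam J) x))"
        by (simp add: lam(3))
      also have "\<dots> \<le> fejer_sum p K (stopped h N (lam J)) + fejer_sum p K (\<lambda>x. stopped h N (2 * lam J) x - stopped h N (lam J) x)"
      proof (rule fejer_sum_add)
        show "level N (\<lambda>x. stopped h N (2 * lam J) x - stopped h N (lam J) x)"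
          by (rule level_comp2[OF stopped_level stopped_level])
      qed (use p stopped_level in auto)
      also have "\<dots> \<le> (C * r + C * (\<Sum>j<J. (\<integral>x. ?U j x \<partial>\<mu>))) + C * (\<integral>x. ?U J x \<partial>\<mu>)"
        by (intro add_mono Suc step[OF h lam(1) zero'])
      finally show ?case by (simp add: distrib_left)
    qed
    obtain c where c: "c > 0" "\<And>x. x \<in> G \<Longrightarrow> norm (maximal_upto h N x) \<le> c" using level_bounded[OF maximal_upto_level] by blast
    \<comment> \<open>At this threshold nothing is stopped any more, so the chain of differences
      ends with \<open>h\<close> itself.\<close>
    obtain J where J: "c / l0 < 2 ^ J" using real_arch_pow[of 2 "c / l0"] by auto
    then have cJ: "c \<le> lam J" using l0 by (simp add: lam_def field_simps)
    have eq: "stopped h N (lam J) x = h x" if "x \<in> G" for x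
    proof -
      have "stays_below h (lam J) N x"
        unfolding stays_below_def
      proof (intro allI ballI impI)
        fix i y assume "i < N" "y \<in> G"
        then show "norm (cexp h (Suc i) y) \<le> lam J"
          using le_maximal_upto[of "Suc i" N h y] c(2)[of y] cJ by auto
      qed
      then show ?thesis using stopped_eq[of h "lam J" N x] S_level_eq[OF h that] by (simp add: cexp_def)
    qed
    have "fejer_sum p K h = fejer_sum p K (stopped h N (lam J))"
      using eq by (intro fejer_sum_cong) simp
    also have "\<dots> \<le> C * r + C * (\<Sum>j<J. (\<integral>x. ?U j x \<partial>\<mu>))" by (rule chain)
    also have "(\<Sum>j<J. (\<integral>x. ?U j x \<partial>\<mu>)) = (\<integral>x. (\<Sum>j<J. ?U j x) \<partial>\<mu>)"
      by (intro Bochner_Integration.integral_sum[symmetric] level_integrable[OF Ulev])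
    also have "\<dots> \<le> (\<integral>x. q / (q - 1) * maximal_upto h N x powr p \<partial>\<mu>)"
    proof (rule integral_mono_level)
      show "level N (\<lambda>x. \<Sum>j<J. ?U j x)" by (rule level_sum, rule Ulev)
      show "level N (\<lambda>x. q / (q - 1) * maximal_upto h N x powr p)" by (rule level_comp[OF maximal_upto_level])
      fix x
      have "?U j x \<le> r * q ^ j * of_bool (r * q ^ j < maximal_upto h N x powr p)" for j
        using powr_less_mono2[of p "lam j" "maximal_upto h N x"] p lam(1)[of j] r q by (auto simp: less_imp_le simp flip: lamp)
      then have "(\<Sum>j<J. ?U j x) \<le> (\<Sum>j<J. r * q ^ j * of_bool (r * q ^ j < maximal_upto h N x powr p))" by (rule sum_mono)
      also have "\<dots> \<le> q / (q - 1) * maximal_upto h N x powr p" using q r by (intro sum_dyadic_le) auto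
      finally show "(\<Sum>j<J. ?U j x) \<le> q / (q - 1) * maximal_upto h N x powr p" .
    qed
    also have "\<dots> = q / (q - 1) * (\<integral>x. maximal_upto h N x powr p \<partial>\<mu>)" by simp
    also have "\<dots> \<le> q / (q - 1) * r" using r q by (intro mult_left_mono) auto
    finally show "fejer_sum p K h \<le> C * (1 + q / (q - 1)) * r"
      using C by (simp add: mult_left_mono algebra_simps)
  qed
qed

section \<open>From functions of finitely many coordinates to martingales\<close>

lemma mcoeff_eq:
  assumes f: "vil_martingale m f" and i: "i < M N"
  shows "vil_mcoeff m f i = vil_coeff m (f N) i"
proof -
  have "vil_coeff m (f k) i = vil_coeff m (f N) i" if "N \<le> k" for k
  proof -
    have "vil_coeff m (f N) i = vil_coeff m (vil_S m (M N) (f k)) i"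
      using f that by (intro coeff_cong) (simp add: vil_martingale_def)
    also have "\<dots> = vil_coeff m (f k) i"
      unfolding vil_S_def[abs_def] coeff_poly using i by simp
    finally show ?thesis ..
  qed
  then have "eventually (\<lambda>k. vil_coeff m (f k) i = vil_coeff m (f N) i) sequentially"
    by (rule eventually_sequentiallyI)
  then show ?thesis unfolding vil_mcoeff_def by (intro limI tendsto_eventually)
qed

text \<open>Only coefficients of index below \<open>M N\<close> enter, and these are already those
  of the single function \<open>f N\<close>.\<close>

lemma sigma_eq:
  assumes f: "vil_martingale m f" and k: "k \<le> M N"
  shows "vil_sigma m k f x = fejer_total k (f N) x / of_nat k"
proof -
  have "vil_mS m l f x = vil_S m l (f N) x" if "l \<le> k" for l
    unfolding vil_mS_def vil_S_def using that k by (intro sum.cong) (auto simp: mcoeff_eq[OF f])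
  then show ?thesis unfolding vil_sigma_def fejer_total_def by simp
qed

lemma Lp_qnorm_level:
  fixes g :: "(nat \<Rightarrow> nat) \<Rightarrow> complex"
  assumes "level n g" "0 < p"
  shows "epowr (Lp_qnorm \<mu> p (\<lambda>x. ennreal (norm (g x)))) p = ennreal (\<integral>x. norm (g x) powr p \<partial>\<mu>)"
proof -
  have "level n (\<lambda>x. norm (g x) powr p)" by (rule level_comp[OF assms(1)])
  then have "(\<integral>\<^sup>+x. ennreal (norm (g x) powr p) \<partial>\<mu>) = ennreal (\<integral>x. norm (g x) powr p \<partial>\<mu>)"
    by (intro nn_integral_eq_integral level_integrable) auto
  then show ?thesis using assms(2) by (simp add: Lp_qnorm_def epowr_ennreal powr_powr)
qed

theorem fejer_means_Hp_bound:
  assumes p: "0 < p" "p < 1/2"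
  shows "\<exists>c>0. \<forall>f\<in>vil_Hp m p.
    (\<Sum>k. epowr (Lp_qnorm \<mu> p (\<lambda>x. ennreal (norm (vil_sigma m (Suc k) f x)))) p / ennreal (real (Suc k) powr (2 - 2 * p)))
      \<le> ennreal c * epowr (vil_Hp_norm m p f) p"
proof -
  obtain C where C: "0 < C" and main: "\<And>h N r K. \<lbrakk>level N h; 0 < r; (\<integral>x. maximal_upto h N x powr p \<partial>\<mu>) \<le> r\<rbrakk> \<Longrightarrow>
    fejer_sum p K h \<le> C * r"
    using fejer_sum_Hp[OF p] by blast
  show ?thesis
  proof (intro exI conjI ballI)
    show "0 < C" by (rule C)
    fix f assume fH: "f \<in> vil_Hp m p"
    then have f: "vil_martingale m f" and fin: "vil_Hp_norm m p f < \<infinity>" by (auto simp: vil_Hp_def)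
    define R where "R = (\<integral>\<^sup>+x. epowr (vil_maximal f x) p \<partial>\<mu>)"
    have R: "epowr (vil_Hp_norm m p f) p = R"
      using p by (simp add: vil_Hp_norm_def Lp_qnorm_def R_def epowr_epowr)
    have "epowr R (1 / p) < \<infinity>" using fin by (simp only: vil_Hp_norm_def Lp_qnorm_def R_def)
    then have "R \<noteq> \<infinity>" by (auto simp: epowr_def)
    then obtain r where r: "R = ennreal r" "0 \<le> r" by (cases R) auto
    \<comment> \<open>The slack \<open>e\<close> provides the strictly positive bound that the
      estimate for functions requires, also when \<open>r = 0\<close>.\<close>
    have part: "(\<Sum>k<K. epowr (Lp_qnorm \<mu> p (\<lambda>x. ennreal (norm (vil_sigma m (Suc k) f x)))) p
        / ennreal (real (Suc k) powr (2 - 2 * p))) \<le> ennreal (C * (r + e))" if e: "0 < e" for K and e :: real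
    proof -
      \<comment> \<open>\<open>f K\<close> is a function of \<open>K\<close> coordinates only on the
        group, while \<open>level\<close> speaks of all sequences; \<open>h\<close> has the same
        values on the group and satisfies \<open>level K\<close> everywhere.\<close>
      define h where "h = cexp (f K) K"
      have hf: "h x = f K x" if "x \<in> G" for x
        using f that by (simp add: h_def cexp_def vil_martingale_def)
      have hlev: "level K h" unfolding h_def by (rule cexp_level)
      have sgh: "fejer_total k h = fejer_total k (f K)" for k using hf by (rule fejer_total_cong)
      have cexph: "cexp h n x = f n x" if "n \<le> K" "x \<in> G" for n x
      proof -
        have "cexp h n x = vil_S m (M n) (f K) x"
          unfolding cexp_def vil_S_def using coeff_cong[of h "f K"] hf by simp
        then show ?thesis using f that by (simp add: vil_martingale_def)
      qed
      have "ennreal (\<integral>x. maximal_upto h K x powr p \<partial>\<mu>) = (\<integral>\<^sup>+x. ennreal (maximal_upto h K x powr p) \<partial>\<mu>)"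
        by (intro nn_integral_eq_integral[symmetric] level_integrable[OF level_comp[OF maximal_upto_level]]) auto
      also have "\<dots> \<le> R"
        unfolding R_def
      proof (rule nn_integral_mono)
        fix x assume "x \<in> space \<mu>"
        then have x: "x \<in> G" by simp
        have "maximal_upto h K x \<in> (\<lambda>n. norm (cexp h n x)) ` {..K}" unfolding maximal_upto_def by (rule Max_in) auto
        then obtain n where n: "n \<le> K" "maximal_upto h K x = norm (cexp h n x)" by auto
        then have "ennreal (maximal_upto h K x) = ennreal (norm (f n x))" using cexph[OF n(1) x] by simp
        also have "\<dots> \<le> vil_maximal f x" unfolding vil_maximal_def by (rule SUP_upper) simp
        finally have "epowr (ennreal (maximal_upto h K x)) p \<le> epowr (vil_maximal f x) p" using p by (intro epowr_mono) auto
        then show "ennreal (maximal_upto h K x powr p) \<le> epowr (vil_maximal f x) p" by (simp add: epowr_ennreal maximal_upto_nonneg)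
      qed
      finally have "(\<integral>x. maximal_upto h K x powr p \<partial>\<mu>) \<le> r" using r by (simp add: ennreal_le_iff)
      then have bound: "fejer_sum p K h \<le> C * (r + e)" using e r(2) by (intro main[OF hlev]) auto
      have term_eq: "epowr (Lp_qnorm \<mu> p (\<lambda>x. ennreal (norm (vil_sigma m (Suc k) f x)))) p / ennreal (real (Suc k) powr (2 - 2 * p))
          = ennreal ((\<integral>x. norm (fejer_total (Suc k) h x / of_nat (Suc k)) powr p \<partial>\<mu>) * real (Suc k) powr (2 * p - 2))"
        if "k < K" for k
      proof -
        have "Suc k \<le> M K" using that M_gt[of K] by simp
        then have s: "vil_sigma m (Suc k) f x = fejer_total (Suc k) h x / of_nat (Suc k)" for x
          using sigma_eq[OF f, of "Suc k" K x] by (simp add: sgh)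
        have l: "level (Suc k) (\<lambda>x. fejer_total (Suc k) h x / of_nat (Suc k))" by (rule level_comp[OF fejer_total_level])
        have "real (Suc k) powr (2 * p - 2) = inverse (real (Suc k) powr (2 - 2 * p))"
          by (simp flip: powr_minus)
        then show ?thesis
          unfolding s Lp_qnorm_level[OF l p(1)] by (subst divide_ennreal) (auto simp: divide_inverse simp del: of_nat_Suc)
      qed
      have "(\<Sum>k<K. epowr (Lp_qnorm \<mu> p (\<lambda>x. ennreal (norm (vil_sigma m (Suc k) f x)))) p / ennreal (real (Suc k) powr (2 - 2 * p)))
          = ennreal (\<Sum>k<K. (\<integral>x. norm (fejer_total (Suc k) h x / of_nat (Suc k)) powr p \<partial>\<mu>) * real (Suc k) powr (2 * p - 2))"
        by (subst sum_ennreal[symmetric]) (auto intro!: sum.cong simp: term_eq simp del: of_nat_Suc)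
      also have "(\<Sum>k<K. (\<integral>x. norm (fejer_total (Suc k) h x / of_nat (Suc k)) powr p \<partial>\<mu>) * real (Suc k) powr (2 * p - 2)) = fejer_sum p K h"
        unfolding fejer_sum_def by (simp add: sum.atLeast1_atMost_eq del: of_nat_Suc)
      finally show ?thesis using bound by (simp add: ennreal_leI)
    qed
    have "(\<Sum>k. epowr (Lp_qnorm \<mu> p (\<lambda>x. ennreal (norm (vil_sigma m (Suc k) f x)))) p / ennreal (real (Suc k) powr (2 - 2 * p)))
        \<le> ennreal (C * r)"
    proof (rule ennreal_le_epsilon)
      fix e :: real assume e: "0 < e"
      have "(\<Sum>k. epowr (Lp_qnorm \<mu> p (\<lambda>x. ennreal (norm (vil_sigma m (Suc k) f x)))) p / ennreal (real (Suc k) powr (2 - 2 * p)))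
        \<le> ennreal (C * (r + e / C))"
        unfolding suminf_eq_SUP using part[of "e / C"] e C by (intro SUP_least) auto
      also have "\<dots> = ennreal (C * r) + ennreal e"
        using e C r(2) by (subst ennreal_plus[symmetric]) (auto simp: distrib_left)
      finally show "(\<Sum>k. epowr (Lp_qnorm \<mu> p (\<lambda>x. ennreal (norm (vil_sigma m (Suc k) f x)))) p / ennreal (real (Suc k) powr (2 - 2 * p)))
        \<le> ennreal (C * r) + ennreal e" .
    qed
    then show "(\<Sum>k. epowr (Lp_qnorm \<mu> p (\<lambda>x. ennreal (norm (vil_sigma m (Suc k) f x)))) p / ennreal (real (Suc k) powr (2 - 2 * p)))
        \<le> ennreal C * epowr (vil_Hp_norm m p f) p"
      unfolding R r(1) using C r(2) by (simp add: ennreal_mult)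
  qed
qed

section \<open>Martingales with block-constant coefficients\<close>

lemma weak_Lp_qnorm_ge:
  assumes "level n g" "0 < p" "0 < l"
  shows "ennreal (l powr p * measure \<mu> {x\<in>G. l < norm (g x)}) \<le> epowr (weak_Lp_qnorm \<mu> p (\<lambda>x. ennreal (norm (g x)))) p"
proof -
  let ?A = "{x\<in>G. l < norm (g x)}"
  have "{x\<in>space \<mu>. ennreal l < ennreal (norm (g x))} = ?A" using assms(3) by (auto simp: ennreal_less_iff)
  then have "ennreal l * epowr (ennreal (measure \<mu> ?A)) (1 / p) \<le> weak_Lp_qnorm \<mu> p (\<lambda>x. ennreal (norm (g x)))"
    unfolding weak_Lp_qnorm_def haar.emeasure_eq_measure[symmetric] using assms(3)
    by (intro SUP_upper2[of l]) auto
  then have "epowr (ennreal l * epowr (ennreal (measure \<mu> ?A)) (1 / p)) p \<le> epowr (weak_Lp_qnorm \<mu> p (\<lambda>x. ennreal (norm (g x)))) p"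
    using assms(2) by (intro epowr_mono) auto
  also have "epowr (ennreal l * epowr (ennreal (measure \<mu> ?A)) (1 / p)) p = ennreal (l powr p * measure \<mu> ?A)"
    using assms(2,3) by (simp add: epowr_ennreal powr_mult powr_powr flip: ennreal_mult)
  finally show ?thesis .
qed

text \<open>The index 0 lies in no block and gets coefficient zero; for every other \<open>k\<close>
  the least such \<open>n\<close> is the number of its block.\<close>

definition block_coeff :: "(nat \<Rightarrow> real) \<Rightarrow> nat \<Rightarrow> complex" where
  "block_coeff w k = (if k = 0 then 0 else of_real (w (LEAST n. k < M (Suc n))))"

definition block_mart :: "(nat \<Rightarrow> real) \<Rightarrow> nat \<Rightarrow> (nat \<Rightarrow> nat) \<Rightarrow> complex" where
  "block_mart w n x = (\<Sum>k<M n. block_coeff w k * \<psi> k x)"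

lemma block_coeff_eq:
  assumes "M n \<le> k" "k < M (Suc n)"
  shows "block_coeff w k = of_real (w n)"
proof -
  have "(LEAST n. k < M (Suc n)) = n"
  proof (rule Least_equality)
    fix y assume "k < M (Suc y)"
    then show "n \<le> y" using assms M_mono[of "Suc y" n] by (cases "n \<le> y") auto
  qed (rule assms)
  moreover have "k \<noteq> 0" using assms M_pos[of n] by linarith
  ultimately show ?thesis by (simp add: block_coeff_def)
qed

lemma block_mart_level: "level n (block_mart w n)"
  unfolding block_mart_def by (rule level_sum, rule level_comp[OF psi_level]) simp

lemma block_mart_martingale: "vil_martingale m (block_mart w)"
  unfolding vil_martingale_def
proof (intro conjI allI impI ballI)
  show "integrable \<mu> (block_mart w n)" for n by (rule level_integrable[OF block_mart_level])
  show "block_mart w n \<in> borel_measurable (vil_F m n)" for n by (rule level_measurable_F[OF block_mart_level])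
  show "vil_S m (M n) (block_mart w k) x = block_mart w n x" if "n \<le> k" for n k x
    unfolding vil_S_def block_mart_def coeff_poly using M_mono[OF that] by (intro sum.cong) auto
qed

lemma block_mcoeff: "vil_mcoeff m (block_mart w) k = block_coeff w k"
  using M_gt[of k] mcoeff_eq[OF block_mart_martingale, of k k w]
  by (simp add: block_mart_def[abs_def] coeff_poly)

lemma zero_in_G: "(\<lambda>i. 0) \<in> G"
  by (simp add: mem_vil_group)

lemma psi_zero: "\<psi> k (\<lambda>i. 0) = 1"
  using psi_prod[OF M_gt[of k], of "\<lambda>i. 0"] by (simp add: vil_r_def)

lemma sum_block:
  assumes "M n \<le> j" "j \<le> M (Suc n)"
  shows "(\<Sum>k<j. block_coeff w k * \<psi> k x) = block_mart w n x + of_real (w n) * (dirichlet j x (\<lambda>i. 0) - dirichlet (M n) x (\<lambda>i. 0))"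
proof -
  have s: "(\<Sum>k<j. F k) = (\<Sum>k<M n. F k) + (\<Sum>k\<in>{M n..<j}. F k)" for F :: "nat \<Rightarrow> complex"
    using assms(1) by (simp add: sum.atLeastLessThan_concat lessThan_atLeast0)
  have "(\<Sum>k\<in>{M n..<j}. block_coeff w k * \<psi> k x) = of_real (w n) * (\<Sum>k\<in>{M n..<j}. \<psi> k x)"
    unfolding sum_distrib_left using assms by (intro sum.cong) (auto simp: block_coeff_eq)
  then show ?thesis
    unfolding s block_mart_def dirichlet_def by (simp add: psi_zero)
qed

lemma block_mart_sum:
  "block_mart w n x = (\<Sum>i<n. of_real (w i) * (dirichlet (M (Suc i)) x (\<lambda>i. 0) - dirichlet (M i) x (\<lambda>i. 0)))"
proof (induction n)
  case 0
  show ?case by (simp add: block_mart_def block_coeff_def)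
next
  case (Suc n)
  have "block_mart w (Suc n) x = block_mart w n x + of_real (w n) * (dirichlet (M (Suc n)) x (\<lambda>i. 0) - dirichlet (M n) x (\<lambda>i. 0))"
    unfolding block_mart_def[of w "Suc n"] by (rule sum_block) (auto simp: M_mono)
  then show ?case using Suc by simp
qed

text \<open>Since \<open>x 0 \<noteq> 0\<close>, all kernels of order \<open>M i\<close> with
  \<open>i > 0\<close> vanish at \<open>x\<close>, and \<open>w 0 = 0\<close> removes the remaining
  one of order 1. Only \<open>w n\<close> times the kernel of order \<open>m 0 * u + 1\<close> is
  left; modulo \<open>m 0\<close> this order is 1, so the kernel has modulus 1.\<close>

lemma norm_block_mS:
  assumes w: "w 0 = 0" "0 \<le> w n" and x: "x \<in> G" "x 0 \<noteq> 0" and u: "M n \<le> m 0 * u" "m 0 * u < M (Suc n)"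
  shows "norm (vil_mS m (m 0 * u + 1) (block_mart w) x) = w n"
proof -
  let ?o = "\<lambda>i. 0 :: nat"
  have D0: "dirichlet (M i) x ?o = 0" if "0 < i" for i
    using x that by (auto simp: dirichlet_M[OF x(1) zero_in_G] agree_def)
  have "block_mart w n x = 0"
    unfolding block_mart_sum
  proof (intro sum.neutral ballI)
    fix i
    show "complex_of_real (w i) * (dirichlet (M (Suc i)) x ?o - dirichlet (M i) x ?o) = 0"
      using w(1) D0[of i] D0[of "Suc i"] by (cases "i = 0") auto
  qed
  then have "vil_mS m (m 0 * u + 1) (block_mart w) x = of_real (w n) * (dirichlet (m 0 * u + 1) x ?o - dirichlet (M n) x ?o)"
    unfolding vil_mS_def block_mcoeff using u by (subst sum_block[of n]) auto
  also have "of_real (w n) * dirichlet (M n) x ?o = 0" using w(1) D0[of n] by (cases "n = 0") auto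
  then have "of_real (w n) * (dirichlet (m 0 * u + 1) x ?o - dirichlet (M n) x ?o) = of_real (w n) * dirichlet (m 0 * u + 1) x ?o"
    by (simp add: right_diff_distrib)
  finally have "norm (vil_mS m (m 0 * u + 1) (block_mart w) x) = w n * norm (dirichlet (m 0 * u + 1) x ?o)"
    using w(2) by (simp add: norm_mult)
  moreover have "norm (dirichlet (m 0 * u + 1) x ?o) = 1"
  proof -
    have md: "(m 0 * u + 1) mod m 0 = 1" unfolding mod_mult_self4 using m_ge[of 0] by simp
    have "dirichlet 1 x ?o = 1" by (simp add: dirichlet_def psi_prod[of 0 0])
    then show ?thesis
      using dirichlet_mod[OF x(1) zero_in_G x(2), of "m 0 * u + 1"] md
      by (simp add: vil_M.simps(2) norm_mult del: mod_mult_self4)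
  qed
  ultimately show ?thesis by simp
qed

text \<open>The kernel difference of block \<open>i\<close> lives on the coset of zero of level
  \<open>i\<close> and is at most \<open>B * M i\<close> there. The exponents in \<open>w\<close>
  make the p-th power of this bound, times \<open>w i powr p\<close>, integrate to
  \<open>e i * B powr p\<close>. Subadditivity of p-th powers sums the blocks, and the resulting
  series dominates the maximal function.\<close>

lemma block_mart_Hp:
  assumes p: "0 < p" "p \<le> 1" and e: "\<And>n. 0 \<le> e n" "\<And>n. (\<Sum>i<n. e i) \<le> c"
    and w: "\<And>n. w n = e n powr (1 / p) * real (M n) powr (1 / p - 1)"
  shows "block_mart w \<in> vil_Hp m p"
proof -
  let ?o = "\<lambda>i. 0 :: nat"
  define t where "t i x = e i * real B powr p * real (M i) * of_bool (agree {..<i} ?o x)" for i x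
  have t0: "0 \<le> t i x" for i x using e by (simp add: t_def)
  have tlev: "level i (t i)" for i unfolding t_def[abs_def] by (rule level_comp[OF level_agree]) simp
  have w0: "0 \<le> w n" for n by (simp add: w)
  have wp: "w n powr p * (real B * real (M n)) powr p = e n * real B powr p * real (M n)" for n
  proof -
    have "w n powr p = e n * real (M n) powr (1 - p)"
      using e(1)[of n] p by (simp add: w powr_mult powr_powr left_diff_distrib)
    then show ?thesis by (simp add: powr_mult mult_ac flip: powr_add)
  qed
  have bound: "norm (block_mart w n x) powr p \<le> (\<Sum>i<n. t i x)" if x: "x \<in> G" for n x
  proof -
    let ?d = "\<lambda>i. real B * real (M i) * of_bool (agree {..<i} ?o x)"
    have d: "norm (dirichlet (M (Suc i)) x ?o - dirichlet (M i) x ?o) \<le> ?d i" for i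
    proof (cases "agree {..<i} ?o x")
      case True
      have D: "dirichlet (M j) x ?o = of_real (real (M j) * of_bool (agree {..<j} ?o x))" for j
        by (simp add: dirichlet_M[OF x zero_in_G])
      have "norm (dirichlet (M (Suc i)) x ?o - dirichlet (M i) x ?o)
          = \<bar>real (M (Suc i)) * of_bool (agree {..<Suc i} ?o x) - real (M i)\<bar>"
        unfolding D of_real_diff[symmetric] norm_of_real using True by simp
      also have "\<dots> \<le> real (M (Suc i))"
        using M_mono[of i "Suc i"] by (cases "agree {..<Suc i} ?o x") auto
      also have "\<dots> \<le> ?d i" using True M_Suc_le[of i] by simp
      finally show ?thesis .
    next
      case False
      then have "\<not> agree {..<Suc i} ?o x" by (auto simp: agree_def)
      with False show ?thesis by (simp add: dirichlet_M[OF x zero_in_G])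
    qed
    have "norm (block_mart w n x) \<le> (\<Sum>i<n. w i * ?d i)"
      unfolding block_mart_sum by (rule sum_norm_le) (use d w0 in \<open>simp add: norm_mult mult_left_mono\<close>)
    then have "norm (block_mart w n x) powr p \<le> (\<Sum>i<n. w i * ?d i) powr p"
      using p by (intro powr_mono2) auto
    also have "\<dots> \<le> (\<Sum>i<n. (w i * ?d i) powr p)" using p w0 by (intro powr_sum_le) auto
    also have "\<dots> = (\<Sum>i<n. t i x)"
    proof (intro sum.cong refl)
      fix i
      show "(w i * ?d i) powr p = t i x"
        using wp[of i] p by (cases "agree {..<i} ?o x") (simp_all add: t_def powr_mult mult.assoc)
    qed
    finally show ?thesis .
  qed
  define T where "T x = (\<Sum>i. ennreal (t i x))" for x
  have maxT: "epowr (vil_maximal (block_mart w) x) p \<le> T x" if x: "x \<in> G" for x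
  proof -
    have "ennreal (norm (block_mart w n x)) \<le> epowr (T x) (1 / p)" for n
    proof -
      have "ennreal (norm (block_mart w n x) powr p) \<le> (\<Sum>i<n. ennreal (t i x))"
        using bound[OF x, of n] t0 by (subst sum_ennreal) (auto intro: ennreal_leI)
      also have "\<dots> \<le> T x" unfolding T_def by (intro sum_le_suminf) auto
      finally have "epowr (ennreal (norm (block_mart w n x) powr p)) (1 / p) \<le> epowr (T x) (1 / p)"
        using p by (intro epowr_mono) auto
      then show ?thesis using p by (simp add: epowr_ennreal powr_powr)
    qed
    then have "vil_maximal (block_mart w) x \<le> epowr (T x) (1 / p)"
      unfolding vil_maximal_def by (intro SUP_least)
    then have "epowr (vil_maximal (block_mart w) x) p \<le> epowr (epowr (T x) (1 / p)) p"
      using p by (intro epowr_mono) auto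
    then show ?thesis using p by (simp add: epowr_epowr)
  qed
  have "(\<integral>\<^sup>+x. epowr (vil_maximal (block_mart w) x) p \<partial>\<mu>) \<le> (\<integral>\<^sup>+x. T x \<partial>\<mu>)"
    using maxT by (intro nn_integral_mono) simp
  also have "\<dots> = (\<Sum>i. \<integral>\<^sup>+x. ennreal (t i x) \<partial>\<mu>)"
    unfolding T_def by (intro nn_integral_suminf measurable_compose[OF level_measurable[OF tlev]]) simp
  also have "\<dots> = (\<Sum>i. ennreal (e i * real B powr p))"
  proof (intro suminf_cong)
    fix i
    have "(\<integral>\<^sup>+x. ennreal (t i x) \<partial>\<mu>) = ennreal (\<integral>x. t i x \<partial>\<mu>)"
      using t0 by (intro nn_integral_eq_integral level_integrable[OF tlev]) auto
    then show "(\<integral>\<^sup>+x. ennreal (t i x) \<partial>\<mu>) = ennreal (e i * real B powr p)"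
      by (simp add: t_def integral_agree_I[OF zero_in_G])
  qed
  also have "\<dots> \<le> ennreal (c * real B powr p)"
    unfolding suminf_eq_SUP
  proof (rule SUP_least)
    fix n
    show "(\<Sum>i<n. ennreal (e i * real B powr p)) \<le> ennreal (c * real B powr p)"
      using e by (subst sum_ennreal) (auto intro!: ennreal_leI mult_right_mono simp flip: sum_distrib_right)
  qed
  finally have fin: "(\<integral>\<^sup>+x. epowr (vil_maximal (block_mart w) x) p \<partial>\<mu>) < \<infinity>"
    using ennreal_less_top le_less_trans infinity_ennreal_def by metis
  have "vil_Hp_norm m p (block_mart w) < \<infinity>"
    unfolding vil_Hp_norm_def Lp_qnorm_def using fin by (subst epowr_def) (simp add: less_top[symmetric])
  then show ?thesis using block_mart_martingale by (simp add: vil_Hp_def)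
qed

end

text \<open>Pick indices \<open>\<alpha> k\<close> where \<open>v\<close> exceeds
  \<open>4 ^ k\<close> and place weight \<open>(1/2) ^ k\<close> there: the weights are summable
  while the products exceed \<open>2 ^ k\<close>.\<close>

lemma summable_weights_unbounded:
  fixes v :: "nat \<Rightarrow> real"
  assumes "\<And>C N. \<exists>n\<ge>N. C < v n"
  obtains e :: "nat \<Rightarrow> real" where "\<And>n. 0 \<le> e n" "e 0 = 0" "\<And>n. (\<Sum>i<n. e i) \<le> 2"
    "\<And>C. \<exists>n. 0 < e n \<and> C < e n * v n"
proof -
  have "\<exists>n>k. 4 ^ k < v n" for k using assms[of "Suc k" "4 ^ k"] by (auto simp: Suc_le_eq)
  then obtain \<alpha> where \<alpha>: "\<And>k. k < \<alpha> k" "\<And>k. 4 ^ k < v (\<alpha> k)" by metis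
  \<comment> \<open>Several \<open>k\<close> may share one index, so their weights are added. Since
    \<open>k < \<alpha> k\<close>, the finite range \<open>k < n\<close> misses none of them, and no
    weight falls on index 0.\<close>
  define e where "e n = (\<Sum>k<n. of_bool (\<alpha> k = n) * (1 / 2) ^ k :: real)" for n
  have pos: "0 \<le> e n" for n unfolding e_def by (intro sum_nonneg) simp
  show ?thesis
  proof (rule that[OF pos])
    show "e 0 = 0" by (simp add: e_def)
    fix n
    have "(\<Sum>i<n. e i) \<le> (\<Sum>i<n. \<Sum>k<n. of_bool (\<alpha> k = i) * (1 / 2) ^ k)"
      unfolding e_def by (intro sum_mono sum_mono2) auto
    also have "\<dots> = (\<Sum>k<n. \<Sum>i<n. of_bool (\<alpha> k = i) * (1 / 2) ^ k)" by (rule sum.swap)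
    also have "\<dots> \<le> (\<Sum>k<n. (1 / 2) ^ k)"
      by (intro sum_mono) (simp add: of_bool_def if_distrib[of "\<lambda>x. x * _"] sum.delta' cong: if_cong)
    also have "\<dots> \<le> 2" by (simp add: sum_gp_strict)
    finally show "(\<Sum>i<n. e i) \<le> 2" .
  next
    fix C :: real
    obtain k where k: "C < 2 ^ k" using real_arch_pow[of 2 C] by auto
    have "(1 / 2) ^ k = of_bool (\<alpha> k = \<alpha> k) * (1 / 2 :: real) ^ k" by simp
    also have "\<dots> \<le> e (\<alpha> k)"
      unfolding e_def using \<alpha>(1)[of k]
      by (intro member_le_sum[of k "{..<\<alpha> k}" "\<lambda>k'. of_bool (\<alpha> k' = \<alpha> k) * (1 / 2) ^ k'"]) auto
    finally have ek: "(1 / 2) ^ k \<le> e (\<alpha> k)" .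
    have "C < (1 / 2) ^ k * 4 ^ k" using k by (simp flip: power_mult_distrib)
    also have "\<dots> \<le> e (\<alpha> k) * v (\<alpha> k)" using ek \<alpha>(2)[of k] by (intro mult_mono) (auto intro: pos)
    finally have "C < e (\<alpha> k) * v (\<alpha> k)" .
    moreover have "0 < e (\<alpha> k)" using ek by (rule less_le_trans[rotated]) simp
    ultimately show "\<exists>n. 0 < e n \<and> C < e n * v n" by blast
  qed
qed

context vilenkin begin

text \<open>Since \<open>j \<sigma>\<^sub>j - (j - 1) \<sigma>\<^sub>j\<^sub>-\<^sub>1 = S\<^sub>j\<close>, on a set of measure \<open>1 / m\<^sub>0\<close> at least one of
  two consecutive means is large.\<close>

lemma weak_pair_ge:
  assumes p: "0 < p" and w: "w 0 = 0" "0 < w n" and u: "M n \<le> m 0 * u" "m 0 * u + 1 \<le> 2 * M n" "0 < u"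
  shows "ennreal ((w n / (6 * M n)) powr p / m 0)
    \<le> epowr (weak_Lp_qnorm \<mu> p (\<lambda>x. ennreal (norm (vil_sigma m (m 0 * u + 1) (block_mart w) x)))) p
     + epowr (weak_Lp_qnorm \<mu> p (\<lambda>x. ennreal (norm (vil_sigma m (m 0 * u) (block_mart w) x)))) p"
proof -
  let ?f = "block_mart w" and ?j = "m 0 * u"
  \<comment> \<open>Both orders are at most \<open>2 * M n\<close>. If both means were at most
    \<open>?l\<close>, each product of order and mean would be at most \<open>w n / 3\<close>, and
    together they would fall short of \<open>w n\<close>.\<close>
  let ?l = "w n / (6 * M n)"
  define z where "z = (\<lambda>i::nat. if i = 0 then 1 else 0 :: nat)"
  have z: "z \<in> G" using m_ge[of 0] by (auto simp: z_def mem_vil_group)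
  have l: "0 < ?l" using w by simp
  have slev: "level k (vil_sigma m k ?f)" for k
  proof -
    have "vil_sigma m k ?f = (\<lambda>x. fejer_total k (?f k) x / of_nat k)"
      using M_gt[of k] by (intro ext sigma_eq[OF block_mart_martingale]) simp
    then show ?thesis using level_comp[OF fejer_total_level] by simp
  qed
  let ?A = "\<lambda>k. {x\<in>G. ?l < norm (vil_sigma m k ?f x)}"
  have meas: "?A k \<in> sets \<mu>" for k
  proof -
    have "vil_sigma m k ?f \<in> borel_measurable \<mu>" by (rule level_measurable[OF slev])
    then have "{x\<in>space \<mu>. ?l < norm (vil_sigma m k ?f x)} \<in> sets \<mu>" by measurable
    then show ?thesis by simp
  qed
  have sub: "{x\<in>G. agree {0} z x} \<subseteq> ?A (?j + 1) \<union> ?A ?j"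
  proof
    fix x assume "x \<in> {x\<in>G. agree {0} z x}"
    then have x: "x \<in> G" "x 0 \<noteq> 0" by (auto simp: agree_def z_def)
    have "2 * M n \<le> M (Suc n)" unfolding vil_M.simps(2) by (intro mult_right_mono m_ge) simp
    then have "norm (vil_mS m (?j + 1) ?f x) = w n"
      using u w by (intro norm_block_mS x) auto
    moreover have S: "of_nat k * vil_sigma m k ?f x = (\<Sum>i=1..k. vil_mS m i ?f x)" for k
      by (cases "k = 0") (auto simp: vil_sigma_def)
    have "vil_mS m (?j + 1) ?f x = of_nat (?j + 1) * vil_sigma m (?j + 1) ?f x - of_nat ?j * vil_sigma m ?j ?f x"
      unfolding S by simp
    ultimately have tri: "w n \<le> real (?j + 1) * norm (vil_sigma m (?j + 1) ?f x) + real ?j * norm (vil_sigma m ?j ?f x)"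
      by (metis norm_mult norm_of_nat norm_triangle_ineq4)
    show "x \<in> ?A (?j + 1) \<union> ?A ?j"
    proof (rule ccontr)
      assume "x \<notin> ?A (?j + 1) \<union> ?A ?j"
      then have le: "norm (vil_sigma m (?j + 1) ?f x) \<le> ?l" "norm (vil_sigma m ?j ?f x) \<le> ?l" using x by auto
      have ju: "real (?j + 1) \<le> 2 * real (M n)" "real ?j \<le> 2 * real (M n)"
        using of_nat_mono[OF u(2), where 'a=real] by auto
      have "real (?j + 1) * norm (vil_sigma m (?j + 1) ?f x) \<le> 2 * real (M n) * ?l"
        using ju(1) le(1) by (intro mult_mono) auto
      moreover have "real ?j * norm (vil_sigma m ?j ?f x) \<le> 2 * real (M n) * ?l"
        using ju(2) le(2) by (intro mult_mono) auto
      moreover have "2 * real (M n) * ?l = w n / 3" using M_pos[of n] by (simp del: M_pos)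
      ultimately show False using tri w(2) by linarith
    qed
  qed
  have "1 / real (m 0) = measure \<mu> {x\<in>G. agree {0} z x}" using cylinder(2)[OF _ z, of "{0}"] by simp
  also have "\<dots> \<le> measure \<mu> (?A (?j + 1) \<union> ?A ?j)" using meas by (intro haar.finite_measure_mono sub) auto
  also have "\<dots> \<le> measure \<mu> (?A (?j + 1)) + measure \<mu> (?A ?j)" using meas by (intro measure_Un_le) auto
  finally have "?l powr p * (1 / m 0) \<le> ?l powr p * (measure \<mu> (?A (?j + 1)) + measure \<mu> (?A ?j))"
    by (intro mult_left_mono) auto
  then have "ennreal (?l powr p / m 0) \<le> ennreal (?l powr p * (measure \<mu> (?A (?j + 1)) + measure \<mu> (?A ?j)))"
    by (intro ennreal_leI) simp
  also have "\<dots> = ennreal (?l powr p * measure \<mu> (?A (?j + 1))) + ennreal (?l powr p * measure \<mu> (?A ?j))"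
    by (simp add: distrib_left)
  also have "\<dots> \<le> epowr (weak_Lp_qnorm \<mu> p (\<lambda>x. ennreal (norm (vil_sigma m (?j + 1) ?f x)))) p
     + epowr (weak_Lp_qnorm \<mu> p (\<lambda>x. ennreal (norm (vil_sigma m ?j ?f x)))) p"
    by (intro add_mono weak_Lp_qnorm_ge[OF slev p l])
  finally show ?thesis .
qed

text \<open>With \<open>P = M n / m 0\<close>, the orders \<open>m 0 * u\<close> for
  \<open>P \<le> u < 2 * P\<close> stay in block \<open>n\<close>, which reaches at least to
  \<open>2 * M n\<close>. Each \<open>u\<close> yields a pair of means. One factor
  \<open>m 0\<close> comes from the measure of the set in \<open>weak_pair_ge\<close>, the other
  from the number of pairs; the factor 2 arises because the upper and the lower members of the pairs
  are each compared with the full series.\<close>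

lemma weak_sum_ge:
  fixes \<Phi> :: "nat \<Rightarrow> real"
  assumes p: "0 < p" and \<Phi>: "mono \<Phi>" "\<And>k. 0 < \<Phi> k" and w: "w 0 = 0" "0 < w n" and n: "0 < n"
  shows "ennreal (real (M n) * (w n / (6 * M n)) powr p / (m 0 ^ 2 * \<Phi> (2 * M n)))
    \<le> 2 * (\<Sum>k. epowr (weak_Lp_qnorm \<mu> p (\<lambda>x. ennreal (norm (vil_sigma m (Suc k) (block_mart w) x)))) p / ennreal (\<Phi> (Suc k)))"
    (is "_ \<le> 2 * suminf ?t")
proof -
  let ?om = "\<lambda>k. epowr (weak_Lp_qnorm \<mu> p (\<lambda>x. ennreal (norm (vil_sigma m k (block_mart w) x)))) p"
  let ?b = "(w n / (6 * M n)) powr p / m 0"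
  have "m 0 dvd M n" using n M_dvd[of 1 n] by (simp add: vil_M.simps(2))
  then obtain P where P: "M n = m 0 * P" by (auto elim: dvdE)
  have P0: "0 < P" using P M_pos[of n] by (metis mult_0_right neq0_conv)
  have pair: "ennreal (?b / \<Phi> (2 * M n)) \<le> ?t (m 0 * u) + ?t (m 0 * u - 1)" if u: "u \<in> {P..<2 * P}" for u
  proof -
    have up: "0 < u" using u P0 by simp
    have Su: "Suc (m 0 * u - 1) = m 0 * u" using up by simp
    have "m 0 * u + m 0 \<le> m 0 * (2 * P)" using mult_le_mono2[of "Suc u" "2 * P" "m 0"] u by simp
    then have ub: "m 0 * u + 1 \<le> 2 * M n" using m_ge[of 0] P by simp
    have le: "y / ennreal (\<Phi> (2 * M n)) \<le> y / ennreal (\<Phi> k)" if "k \<le> 2 * M n" for k and y :: ennreal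
      unfolding divide_ennreal_def inverse_ennreal[OF \<Phi>(2)] using monoD[OF \<Phi>(1) that] \<Phi>(2)
      by (intro mult_left_mono ennreal_leI le_imp_inverse_le) auto
    have "ennreal (?b / \<Phi> (2 * M n)) = ennreal ?b / ennreal (\<Phi> (2 * M n))"
      using \<Phi>(2) by (intro divide_ennreal[symmetric]) auto
    also have "\<dots> \<le> (?om (m 0 * u + 1) + ?om (m 0 * u)) / ennreal (\<Phi> (2 * M n))"
      using u ub up P by (intro divide_right_mono_ennreal weak_pair_ge[OF p w]) auto
    also have "\<dots> = ?om (m 0 * u + 1) / ennreal (\<Phi> (2 * M n)) + ?om (m 0 * u) / ennreal (\<Phi> (2 * M n))"
      by (rule add_divide_distrib_ennreal)
    also have "\<dots> \<le> ?om (m 0 * u + 1) / ennreal (\<Phi> (m 0 * u + 1)) + ?om (m 0 * u) / ennreal (\<Phi> (m 0 * u))"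
      using ub by (intro add_mono le) auto
    finally show ?thesis unfolding Su by simp
  qed
  have sums: "(\<Sum>u\<in>{P..<2 * P}. ?t (g u)) \<le> suminf ?t" if "inj_on g {P..<2 * P}" for g
  proof -
    have "(\<Sum>u\<in>{P..<2 * P}. ?t (g u)) = sum ?t (g ` {P..<2 * P})"
      using that by (simp add: sum.reindex)
    also have "\<dots> \<le> suminf ?t" by (intro sum_le_suminf) auto
    finally show ?thesis .
  qed
  have "ennreal (real (M n) * (w n / (6 * M n)) powr p / (m 0 ^ 2 * \<Phi> (2 * M n))) = (\<Sum>u\<in>{P..<2 * P}. ennreal (?b / \<Phi> (2 * M n)))"
  proof -
    have "real (M n) * (w n / (6 * M n)) powr p / (m 0 ^ 2 * \<Phi> (2 * M n)) = real P * (?b / \<Phi> (2 * M n))"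
      using P m_pos[of 0] by (simp add: power2_eq_square)
    also have "ennreal \<dots> = of_nat P * ennreal (?b / \<Phi> (2 * M n))"
      using less_imp_le[OF \<Phi>(2)] by (subst ennreal_mult) (auto simp: ennreal_of_nat_eq_real_of_nat)
    finally show ?thesis by simp
  qed
  also have "\<dots> \<le> (\<Sum>u\<in>{P..<2 * P}. ?t (m 0 * u) + ?t (m 0 * u - 1))" by (intro sum_mono pair)
  also have "\<dots> = (\<Sum>u\<in>{P..<2 * P}. ?t (m 0 * u)) + (\<Sum>u\<in>{P..<2 * P}. ?t (m 0 * u - 1))" by (rule sum.distrib)
  also have "\<dots> \<le> suminf ?t + suminf ?t"
  proof (intro add_mono sums)
    show "inj_on (\<lambda>u. m 0 * u) {P..<2 * P}" using m_pos[of 0] by (auto simp: inj_on_def simp del: m_pos)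
    show "inj_on (\<lambda>u. m 0 * u - 1) {P..<2 * P}"
    proof (rule inj_onI)
      fix u v assume uv: "u \<in> {P..<2 * P}" "v \<in> {P..<2 * P}" "m 0 * u - 1 = m 0 * v - 1"
      then have "0 < m 0 * u" "0 < m 0 * v" using P0 by auto
      then have "m 0 * u = m 0 * v" using uv(3) by linarith
      then show "u = v" using m_pos[of 0] by (simp del: m_pos)
    qed
  qed
  also have "\<dots> = 2 * suminf ?t" by (rule mult_2[symmetric])
  finally show ?thesis .
qed

theorem fejer_means_divergence:
  fixes \<Phi> :: "nat \<Rightarrow> real"
  assumes p: "0 < p" "p < 1/2" and \<Phi>: "mono \<Phi>" "\<And>k. 0 < \<Phi> k"
    and lim: "limsup (\<lambda>k. ereal (real k powr (2 - 2 * p) / \<Phi> k)) = \<infinity>"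
  shows "\<exists>f\<in>vil_Hp m p.
    (\<Sum>k. epowr (weak_Lp_qnorm \<mu> p (\<lambda>x. ennreal (norm (vil_sigma m (Suc k) f x)))) p / ennreal (\<Phi> (Suc k))) = \<infinity>"
proof -
  define v where "v n = real (M n) powr (2 - 2 * p) / \<Phi> (2 * M n)" for n
  have B0: "0 < real B" using B_ge by simp
  have unb: "\<exists>n\<ge>N. C < v n" for C N
  proof -
    \<comment> \<open>The extra factor is the loss in passing from \<open>k\<close> to some
      \<open>M n\<close> with \<open>k \<le> 2 * B * M n\<close>.\<close>
    define D where "D = max C 1 * (2 * real B) powr (2 - 2 * p)"
    have "\<exists>k\<ge>2 * M N. D < real k powr (2 - 2 * p) / \<Phi> k"
    proof (rule ccontr)
      assume "\<not> ?thesis"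
      then have "eventually (\<lambda>k. ereal (real k powr (2 - 2 * p) / \<Phi> k) \<le> ereal D) sequentially"
        by (intro eventually_sequentiallyI[of "2 * M N"]) (auto simp: not_less)
      then have "limsup (\<lambda>k. ereal (real k powr (2 - 2 * p) / \<Phi> k)) \<le> ereal D" by (rule Limsup_bounded)
      then show False using lim by simp
    qed
    then obtain k where k: "2 * M N \<le> k" "D < real k powr (2 - 2 * p) / \<Phi> k" by blast
    \<comment> \<open>This places \<open>k\<close> between \<open>2 * M n\<close> and
      \<open>2 * M (Suc n)\<close>: the lower end gives
      \<open>\<Phi> (2 * M n) \<le> \<Phi> k\<close>, the upper end bounds \<open>k\<close> by a
      multiple of \<open>M n\<close>.\<close>
    define n where "n = (LEAST n. k < 2 * M (Suc n))"
    have ex: "k < 2 * M (Suc k)" using M_gt[of "Suc k"] by simp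
    have n1: "k < 2 * M (Suc n)" unfolding n_def by (rule LeastI[of "\<lambda>n. k < 2 * M (Suc n)", OF ex])
    have Nn: "N \<le> n"
    proof (rule ccontr)
      assume "\<not> N \<le> n"
      then have "M (Suc n) \<le> M N" by (intro M_mono) simp
      then show False using n1 k(1) by linarith
    qed
    have n2: "2 * M n \<le> k"
    proof (cases n)
      case 0
      then show ?thesis using Nn k(1) by simp
    next
      case (Suc n')
      then have "\<not> k < 2 * M (Suc n')" using not_less_Least[of n' "\<lambda>n. k < 2 * M (Suc n)"] by (simp add: n_def)
      then show ?thesis using Suc by simp
    qed
    have "real k \<le> 2 * real B * real (M n)" using n1 M_Suc_le[of n] by linarith
    then have "real k powr (2 - 2 * p) \<le> (2 * real B * real (M n)) powr (2 - 2 * p)"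
      using p by (intro powr_mono2) auto
    also have "\<dots> = (2 * real B) powr (2 - 2 * p) * real (M n) powr (2 - 2 * p)" by (rule powr_mult)
    finally have k2: "real k powr (2 - 2 * p) \<le> (2 * real B) powr (2 - 2 * p) * real (M n) powr (2 - 2 * p)" .
    have "max C 1 * (2 * real B) powr (2 - 2 * p) < real k powr (2 - 2 * p) / \<Phi> k" using k(2) by (simp add: D_def)
    also have "\<dots> \<le> (2 * real B) powr (2 - 2 * p) * real (M n) powr (2 - 2 * p) / \<Phi> (2 * M n)"
      using k2 \<Phi>(2) monoD[OF \<Phi>(1) n2] by (intro frac_le) auto
    also have "\<dots> = v n * (2 * real B) powr (2 - 2 * p)" by (simp add: v_def)
    finally have "max C 1 < v n" using B0 by (subst (asm) mult_less_cancel_right) auto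
    then show ?thesis using Nn by auto
  qed
  obtain e :: "nat \<Rightarrow> real" where e: "\<And>n. 0 \<le> e n" "e 0 = 0" "\<And>n. (\<Sum>i<n. e i) \<le> 2"
    "\<And>C. \<exists>n. 0 < e n \<and> C < e n * v n"
    using summable_weights_unbounded[of v] unb by blast
  \<comment> \<open>With the exponents required by \<open>block_mart_Hp\<close>, the lower bound
    from block \<open>n\<close> becomes a constant times \<open>e n * v n\<close>.\<close>
  define w where "w n = e n powr (1 / p) * real (M n) powr (1 / p - 1)" for n
  have w0: "w 0 = 0" using e(2) by (simp add: w_def)
  have wp: "(w n / (6 * M n)) powr p * real (M n) = e n * real (M n) powr (2 - 2 * p) / 6 powr p" for n
  proof -
    have "w n powr p = e n * real (M n) powr (1 - p)"
      using e(1)[of n] p by (simp add: w_def powr_mult powr_powr left_diff_distrib)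
    moreover have "real (M n) powr (1 - p) / real (M n) powr p * real (M n) = real (M n) powr (2 - 2 * p)"
    proof -
      have "real (M n) powr (1 - p) / real (M n) powr p * real (M n) = real (M n) powr (1 - p - p) * real (M n) powr 1"
        unfolding powr_diff[of _ "1 - p"] by simp
      also have "\<dots> = real (M n) powr (1 - p - p + 1)" by (rule powr_add[symmetric])
      also have "1 - p - p + 1 = 2 - 2 * p" by simp
      finally show ?thesis .
    qed
    ultimately show ?thesis by (simp add: powr_divide powr_mult field_simps)
  qed
  let ?S = "\<Sum>k. epowr (weak_Lp_qnorm \<mu> p (\<lambda>x. ennreal (norm (vil_sigma m (Suc k) (block_mart w) x)))) p / ennreal (\<Phi> (Suc k))"
  define c where "c = 1 / (6 powr p * real (m 0) ^ 2)"
  have c0: "0 < c" by (simp add: c_def)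
  have big: "ennreal C \<le> 2 * ?S" for C
  proof -
    obtain n where n: "0 < e n" "C / c < e n * v n" using e(4) by blast
    have "0 < n" using n(1) e(2) by (cases n) auto
    moreover have "0 < w n" using n(1) by (simp add: w_def)
    ultimately have ge: "ennreal (real (M n) * (w n / (6 * M n)) powr p / (m 0 ^ 2 * \<Phi> (2 * M n))) \<le> 2 * ?S"
      by (intro weak_sum_ge p \<Phi> w0)
    have "real (M n) * (w n / (6 * M n)) powr p / (m 0 ^ 2 * \<Phi> (2 * M n)) = c * (e n * v n)"
      using wp[of n] by (simp add: c_def v_def mult.commute[of "real (M n)"])
    moreover have "C \<le> c * (e n * v n)" using n(2) c0 by (simp add: divide_less_eq mult.commute)
    ultimately have "ennreal C \<le> ennreal (real (M n) * (w n / (6 * M n)) powr p / (m 0 ^ 2 * \<Phi> (2 * M n)))"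
      by (intro ennreal_leI) simp
    then show ?thesis using ge by (rule order_trans)
  qed
  have "?S = \<infinity>"
  proof (rule ccontr)
    assume "?S \<noteq> \<infinity>"
    then have "2 * ?S \<noteq> \<infinity>" by (simp add: ennreal_mult_eq_top_iff)
    then obtain s where s: "2 * ?S = ennreal s" "0 \<le> s" by (cases "2 * ?S") auto
    show False using big[of "s + 1"] s by (simp add: ennreal_le_iff)
  qed
  moreover have "block_mart w \<in> vil_Hp m p"
    using p e by (intro block_mart_Hp[of p e 2] w_def) auto
  ultimately show ?thesis by blast
qed

end

theorem theorem3p25:
  fixes m :: "nat \<Rightarrow> nat"
  assumes m_ge_2: "\<forall>k. 2 \<le> m k"
    and m_bounded: "\<exists>B. \<forall>k. m k \<le> B"
  shows
    "(\<forall>p::real. 0 < p \<and> p < 1/2 \<longrightarrow>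
        (\<exists>c::real. 0 < c \<and> (\<forall>f \<in> vil_Hp m p.
           (\<Sum>k. epowr (Lp_qnorm (vil_haar m) p (\<lambda>x. ennreal (norm (vil_sigma m (Suc k) f x)))) p
                  / ennreal (real (Suc k) powr (2 - 2 * p)))
             \<le> ennreal c * epowr (vil_Hp_norm m p f) p)))
     \<and>
     (\<forall>p::real. \<forall>\<Phi> :: nat \<Rightarrow> real.
        0 < p \<and> p < 1/2 \<and>
        mono \<Phi> \<and> (\<forall>k. 0 < \<Phi> k) \<and> filterlim \<Phi> at_top sequentially \<and>
        limsup (\<lambda>k. ereal (real k powr (2 - 2 * p) / \<Phi> k)) = \<infinity>
        \<longrightarrow>
        (\<exists>f \<in> vil_Hp m p.
           (\<Sum>k. epowr (weak_Lp_qnorm (vil_haar m) p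
                          (\<lambda>x. ennreal (norm (vil_sigma m (Suc k) f x)))) p
                  / ennreal (\<Phi> (Suc k))) = \<infinity>))"
proof -
  obtain B where "\<And>k. m k \<le> B" using m_bounded by blast
  then interpret vilenkin m B using m_ge_2 by unfold_locales auto
  show ?thesis
    using fejer_means_Hp_bound fejer_means_divergence by blast
qed

end
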